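(* Let $k$ be a field, $T$ and $S$ bialgebras over $k$, and $A$ a commutative $k$-algebra. Let $\theta_T\colon B(T,A)\otimes T\to A$, $\theta_S\colon B(S,A)\otimes S\to A$ and $\theta_{T\otimes S}\colon B(T\otimes S,A)\otimes T\otimes S\to A$ be the universal bimeasurings. The map $\psi\colon B(T,A)\otimes B(S,A)\otimes T\otimes S\to A$, $\psi(f\otimes g,t\otimes s)=\theta_T(f,t)\theta_S(g,s)$, is a bimeasuring; let $\alpha\colon B(T,A)\otimes B(S,A)\to B(T\otimes S,A)$ be the unique coalgebra map with $\psi=\theta_{T\otimes S}(\alpha\otimes 1)$. Then $\alpha$ is injective, and it restricts to an isomorphism $B_c(T,A)\otimes B_c(S,A)\to B_c(T\otimes S,A)$.
   Context: All algebras are unital and associative over $k$; $\Delta(c)=c_1\otimes c_2$ is Sweedler notation. Bimeasuring: for bialgebras $N,T$ and an algebra $A$, a linear map $\psi\colon N\otimes T\to A$ is a bimeasuring if $\psi(nm,t)=\psi(n,t_1)\psi(m,t_2)$, $\psi(1_N,t)=\varepsilon(t)1_A$, $\psi(n,ts)=\psi(n_1,t)\psi(n_2,s)$, $\psi(n,1_T)=\varepsilon(n)1_A$. Universal bimeasuring bialgebra: $B(T,A)$ is a bialgebra with a bimeasuring $\theta_T\colon B(T,A)\otimes T\to A$ such that for every bialgebra $N$ and every bimeasuring $f\colon N\otimes T\to A$ there is a unique bialgebra map $\overline f\colon N\to B(T,A)$ with $f=\theta_T(\overline f\otimes 1)$. For $A$ commutative it always exists; its underlying coalgebra with $\theta_T$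 is Sweedler's universal measuring coalgebra $M(T,A)$: for every coalgebra $C$ and every linear $f\colon C\otimes T\to A$ with $f(c,tt')=f(c_1,t)f(c_2,t')$ and $f(c,1)=\varepsilon(c)1_A$ (a measuring) there is a unique coalgebra map $\overline f\colon C\to B(T,A)$ with $f=\theta_T(\overline f\otimes 1)$. $B_c(T,A)$ is the universal cocommutative bimeasuring bialgebra (same universal property among cocommutative bialgebras $N$); for $A$ commutative it equals $B(T,A)_c$, the largest cocommutative subcoalgebra of $B(T,A)$, which is a subbialgebra. *)

theory Defs
  imports Complex_Main "HOL-Library.Function_Algebras"
begin

section \<open>Vector spaces over a field and linear maps\<close>

text \<open>
  A vector space over the field \<^typ>\<open>'k\<close> is a linear subspace \<open>carr\<close> of a type that is a vector
  space under \<open>scl\<close>; maps are only meaningful on carriers. Hence subspaces, subcoalgebras and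
  subbialgebras are obtained by changing \<open>carr\<close> only.
\<close>

record ('k, 'v) vspace =
  carr :: "'v set"
  scl :: "'k \<Rightarrow> 'v \<Rightarrow> 'v"

definition vect :: "('k::field, 'v::ab_group_add, 'm) vspace_scheme \<Rightarrow> bool" where
  "vect V \<longleftrightarrow> vector_space (scl V) \<and> module.subspace (scl V) (carr V)"

definition ground :: "('k::field, 'k) vspace" where
  "ground = \<lparr>carr = UNIV, scl = (*)\<rparr>"

definition lin ::
    "('k::field, 'v::ab_group_add, 'm) vspace_scheme \<Rightarrow> ('k, 'w::ab_group_add, 'n) vspace_scheme
      \<Rightarrow> ('v \<Rightarrow> 'w) \<Rightarrow> bool" where
  "lin V W f \<longleftrightarrow> f ` carr V \<subseteq> carr W
     \<and> (\<forall>x\<in>carr V. \<forall>y\<in>carr V. f (x + y) = f x + f y)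
     \<and> (\<forall>c. \<forall>x\<in>carr V. f (scl V c x) = scl W c (f x))"

definition bilin ::
    "('k::field, 'v::ab_group_add, 'm) vspace_scheme \<Rightarrow> ('k, 'w::ab_group_add, 'n) vspace_scheme
      \<Rightarrow> ('k, 'x::ab_group_add, 'o) vspace_scheme \<Rightarrow> ('v \<Rightarrow> 'w \<Rightarrow> 'x) \<Rightarrow> bool" where
  "bilin V W X b \<longleftrightarrow> (\<forall>w\<in>carr W. lin V X (\<lambda>v. b v w)) \<and> (\<forall>v\<in>carr V. lin W X (b v))"


section \<open>Tensor products\<close>

text \<open>
  Over a field, the canonical map from \<open>V \<otimes> W\<close> to the dual of the space of bilinear forms
  on \<open>V \<times> W\<close> is injective; the tensor product is taken to be its image: \<open>v \<otimes> w\<close> is evaluation of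
  bilinear forms at \<open>(v, w)\<close>. The forms are taken on the ambient types (every form on the carriers
  extends to them), so \<open>V' \<otimes> W'\<close> is literally a subspace of \<open>V \<otimes> W\<close> for subspaces \<open>V'\<close>, \<open>W'\<close>.
  The universal property is given by the lemmas \<open>tensor_universal\<close> and \<open>tensor_lin_unique\<close>.
\<close>

type_synonym ('k, 'v, 'w) tensor = "('v \<Rightarrow> 'w \<Rightarrow> 'k) \<Rightarrow> 'k"

definition bilin_form ::
    "('k::field, 'v::ab_group_add, 'm) vspace_scheme \<Rightarrow> ('k, 'w::ab_group_add, 'n) vspace_scheme
      \<Rightarrow> ('v \<Rightarrow> 'w \<Rightarrow> 'k) \<Rightarrow> bool" where
  "bilin_form V W \<beta> \<longleftrightarrow>
     (\<forall>w. Vector_Spaces.linear (scl V) (*) (\<lambda>v. \<beta> v w)) \<and>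
     (\<forall>v. Vector_Spaces.linear (scl W) (*) (\<beta> v))"

definition tens ::
    "('k::field, 'v::ab_group_add, 'm) vspace_scheme \<Rightarrow> ('k, 'w::ab_group_add, 'n) vspace_scheme
      \<Rightarrow> 'v \<Rightarrow> 'w \<Rightarrow> ('k, 'v, 'w) tensor" where
  "tens V W v w = (\<lambda>\<beta>. if bilin_form V W \<beta> then \<beta> v w else 0)"

definition pt_scale :: "'k::field \<Rightarrow> ('i \<Rightarrow> 'k) \<Rightarrow> 'i \<Rightarrow> 'k" where
  "pt_scale c x = (\<lambda>i. c * x i)"

definition tspace ::
    "('k::field, 'v::ab_group_add, 'm) vspace_scheme \<Rightarrow> ('k, 'w::ab_group_add, 'n) vspace_scheme
      \<Rightarrow> ('k, ('k, 'v, 'w) tensor) vspace" where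
  "tspace V W =
     \<lparr>carr = module.span pt_scale {tens V W v w | v w. v \<in> carr V \<and> w \<in> carr W},
      scl = pt_scale\<rparr>"

text \<open>
  \<open>tlift V W X b\<close> is the linear map \<open>V \<otimes> W \<rightarrow> X\<close> induced by a bilinear map \<open>b\<close>. In particular
  the Sweedler sum of \<open>b c\<^sub>1 c\<^sub>2\<close> is \<open>tlift C C X b (comul C c)\<close>.
\<close>

definition tlift ::
    "('k::field, 'v::ab_group_add, 'm) vspace_scheme \<Rightarrow> ('k, 'w::ab_group_add, 'n) vspace_scheme
      \<Rightarrow> ('k, 'x::ab_group_add, 'o) vspace_scheme
      \<Rightarrow> ('v \<Rightarrow> 'w \<Rightarrow> 'x) \<Rightarrow> ('k, 'v, 'w) tensor \<Rightarrow> 'x" where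
  "tlift V W X b = (SOME h. lin (tspace V W) X h
     \<and> (\<forall>v\<in>carr V. \<forall>w\<in>carr W. h (tens V W v w) = b v w))"

definition tmap ::
    "('k::field, 'v::ab_group_add, 'm) vspace_scheme \<Rightarrow> ('k, 'w::ab_group_add, 'n) vspace_scheme
      \<Rightarrow> ('k, 'x::ab_group_add, 'o) vspace_scheme \<Rightarrow> ('k, 'y::ab_group_add, 'p) vspace_scheme
      \<Rightarrow> ('v \<Rightarrow> 'x) \<Rightarrow> ('w \<Rightarrow> 'y) \<Rightarrow> ('k, 'v, 'w) tensor \<Rightarrow> ('k, 'x, 'y) tensor" where
  "tmap V W X Y f g = tlift V W (tspace X Y) (\<lambda>v w. tens X Y (f v) (g w))"

lemma vector_space_pt_scale: "vector_space pt_scale"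
  by unfold_locales (auto simp: pt_scale_def fun_eq_iff algebra_simps)

lemma vect_tspace: "vect (tspace V W)"
proof -
  interpret P: vector_space pt_scale by (rule vector_space_pt_scale)
  show ?thesis
    unfolding vect_def tspace_def by (simp add: vector_space_pt_scale)
qed

lemma vect_ground: "vect ground"
proof -
  interpret G: vector_space "(*) :: 'a \<Rightarrow> 'a \<Rightarrow> 'a"
    by unfold_locales (auto simp: algebra_simps)
  show ?thesis
    unfolding vect_def ground_def by (simp add: G.vector_space_axioms)
qed

lemma tens_in_tspace:
  assumes "v \<in> carr V" "w \<in> carr W"
  shows "tens V W v w \<in> carr (tspace V W)"
proof -
  interpret P: vector_space pt_scale by (rule vector_space_pt_scale)
  show ?thesis
    using assms unfolding tspace_def by (auto intro!: P.span_base)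
qed

lemma bilin_tens: "bilin V W (tspace V W) (tens V W)"
proof -
  have "tens V W (v + v') w = tens V W v w + tens V W v' w"
       "tens V W v (w + w') = tens V W v w + tens V W v w'"
       "tens V W (scl V c v) w = pt_scale c (tens V W v w)"
       "tens V W v (scl W c w) = pt_scale c (tens V W v w)" for v v' w w' c
    unfolding tens_def bilin_form_def pt_scale_def
    by (auto simp: fun_eq_iff Vector_Spaces.linear_iff)
  thus ?thesis
    unfolding bilin_def lin_def by (auto simp: tens_in_tspace) (auto simp: tspace_def)
qed

lemma tensor_universal:
  assumes V: "vect V" and W: "vect W" and X: "vect X" and b: "bilin V W X b"
  shows "\<exists>h. lin (tspace V W) X h
     \<and> (\<forall>v\<in>carr V. \<forall>w\<in>carr W. h (tens V W v w) = b v w)"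
proof -
  interpret P: vector_space pt_scale by (rule vector_space_pt_scale)
  interpret V: vector_space "scl V" using V by (simp add: vect_def)
  interpret W: vector_space "scl W" using W by (simp add: vect_def)
  interpret X: vector_space "scl X" using X by (simp add: vect_def)
  interpret K: vector_space "(*) :: 'a \<Rightarrow> 'a \<Rightarrow> 'a"
    by unfold_locales (auto simp: algebra_simps)
  interpret VK: vector_space_pair "scl V" "(*)" ..
  interpret WK: vector_space_pair "scl W" "(*)" ..
  interpret PX: vector_space_pair pt_scale "scl X" ..
  have sV: "V.subspace (carr V)" and sW: "W.subspace (carr W)" and sX: "X.subspace (carr X)"
    using V W X by (auto simp: vect_def)
  have bX: "b v w \<in> carr X" if "v \<in> carr V" "w \<in> carr W" for v w
    using b that unfolding bilin_def lin_def by blast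
  have t_add1: "tens V W (v + v') w = tens V W v w + tens V W v' w"
   and t_add2: "tens V W v (w + w') = tens V W v w + tens V W v w'"
   and t_scl1: "tens V W (scl V c v) w = pt_scale c (tens V W v w)"
   and t_scl2: "tens V W v (scl W c w) = pt_scale c (tens V W v w)" for v v' w w' c
    unfolding tens_def bilin_form_def pt_scale_def
    by (auto simp: fun_eq_iff Vector_Spaces.linear_iff)
  have t_zero1: "tens V W 0 w = 0" and t_zero2: "tens V W v 0 = 0" for v w
    using t_scl1[of 0 0 w] t_scl2[of v 0 0] by (auto simp: pt_scale_def fun_eq_iff)
  obtain E where E: "E \<subseteq> carr V" "V.independent E" "carr V \<subseteq> V.span E"
    by (rule V.basis_exists[of "carr V"]) blast
  obtain F where F: "F \<subseteq> carr W" "W.independent F" "carr W \<subseteq> W.span F"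
    by (rule W.basis_exists[of "carr W"]) blast
  have spE: "V.span E = carr V" and spF: "W.span F = carr W"
    using E F sV sW V.span_minimal W.span_minimal by blast+
  have "\<forall>e. \<exists>g. Vector_Spaces.linear (scl V) (*) g \<and> (\<forall>x\<in>E. g x = (if x = e then 1 else 0))"
    by (intro allI VK.linear_independent_extend[OF E(2)])
  then obtain p where p: "\<And>e. Vector_Spaces.linear (scl V) (*) (p e)"
      "\<And>e x. x \<in> E \<Longrightarrow> p e x = (if x = e then 1 else 0)" by metis
  have "\<forall>e. \<exists>g. Vector_Spaces.linear (scl W) (*) g \<and> (\<forall>x\<in>F. g x = (if x = e then 1 else 0))"
    by (intro allI WK.linear_independent_extend[OF F(2)])
  then obtain q where q: "\<And>e. Vector_Spaces.linear (scl W) (*) (q e)"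
      "\<And>e x. x \<in> F \<Longrightarrow> q e x = (if x = e then 1 else 0)" by metis
  define \<beta> where "\<beta> e f v w = p e v * q f w" for e f v w
  have \<beta>: "bilin_form V W (\<beta> e f)" for e f
  proof -
    interpret p: Vector_Spaces.linear "scl V" "(*)" "p e" by (rule p(1))
    interpret q: Vector_Spaces.linear "scl W" "(*)" "q f" by (rule q(1))
    have "Vector_Spaces.linear (scl V) (*) (\<lambda>v. p e v * q f w)" for w
      by unfold_locales (simp_all only: p.add p.scale distrib_right mult.assoc)
    moreover have "Vector_Spaces.linear (scl W) (*) (\<lambda>w. p e v * q f w)" for v
      by unfold_locales (simp_all only: q.add q.scale distrib_left mult.left_commute)
    ultimately show ?thesis unfolding bilin_form_def \<beta>_def by blast
  qed
  have dual: "tens V W e f (\<beta> e' f') = (if e = e' \<and> f = f' then 1 else 0)"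
    if "e \<in> E" "f \<in> F" for e f e' f'
    using \<beta>[of e' f'] p(2)[OF that(1), of e'] q(2)[OF that(2), of f']
    unfolding tens_def by (simp only: if_True) (auto simp: \<beta>_def)
  let ?t = "\<lambda>(e, f). tens V W e f"
  have inj: "inj_on ?t (E \<times> F)"
  proof (rule inj_onI, clarify)
    fix e f e' f'
    assume *: "e \<in> E" "f \<in> F" "e' \<in> E" "f' \<in> F" "tens V W e f = tens V W e' f'"
    then have "tens V W e f (\<beta> e f) = tens V W e' f' (\<beta> e f)" by simp
    then show "e = e' \<and> f = f'"
      unfolding dual[OF *(1,2)] dual[OF *(3,4)] by (auto split: if_splits)
  qed
  have ind: "P.independent (?t ` (E \<times> F))"
  proof -
    have "u v = 0" if S: "finite S" "S \<subseteq> ?t ` (E \<times> F)" "(\<Sum>x\<in>S. pt_scale (u x) x) = 0" "v \<in> S"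
      for S u v
    proof -
      obtain e f where ef: "e \<in> E" "f \<in> F" "v = tens V W e f" using S by auto
      have one: "x (\<beta> e f) = (if x = v then 1 else 0)" if x: "x \<in> S" for x
      proof -
        obtain e' f' where e': "e' \<in> E" "f' \<in> F" "x = tens V W e' f'" using S x by auto
        have "(x = v) = (e' = e \<and> f' = f)"
          using inj_onD[OF inj, of "(e', f')" "(e, f)"] e' ef by auto
        thus ?thesis using e' by (simp add: dual)
      qed
      have ap: "(\<Sum>x\<in>R. pt_scale (u x) x) g = (\<Sum>x\<in>R. u x * x g)" if "finite R"
        for R :: "('a, 'b, 'd) tensor set" and g
        using that by induction (auto simp: pt_scale_def)
      have "(\<Sum>x\<in>S. u x * x (\<beta> e f)) = 0"
        using S(3) ap[OF S(1), of "\<beta> e f"] by simp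
      also have "(\<Sum>x\<in>S. u x * x (\<beta> e f)) = (\<Sum>x\<in>S. if x = v then u x else 0)"
        by (rule sum.cong) (auto simp: one)
      also have "\<dots> = u v" using S by simp
      finally show ?thesis .
    qed
    thus ?thesis unfolding P.independent_explicit_module by blast
  qed
  define b' where "b' x = (case the_inv_into (E \<times> F) ?t x of (e, f) \<Rightarrow> b e f)" for x
  obtain h where h: "Vector_Spaces.linear pt_scale (scl X) h" "\<forall>x\<in>?t ` (E \<times> F). h x = b' x"
    using PX.linear_independent_extend[OF ind, of b'] by blast
  have h_ef: "h (tens V W e f) = b e f" if "e \<in> E" "f \<in> F" for e f
  proof -
    have "the_inv_into (E \<times> F) ?t (tens V W e f) = (e, f)"
      using the_inv_into_f_f[OF inj, of "(e, f)"] that by simp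
    then have "b' (tens V W e f) = b e f" by (simp only: b'_def prod.case)
    moreover have "tens V W e f \<in> ?t ` (E \<times> F)" using that by force
    ultimately show ?thesis using h(2) by metis
  qed
  interpret h: Vector_Spaces.linear pt_scale "scl X" h by (rule h(1))
  have b_lin: "b (v + v') w = b v w + b v' w" "b (scl V c v) w = scl X c (b v w)"
    "b v (w + w') = b v w + b v w'" "b v (scl W c w) = scl X c (b v w)"
    if "v \<in> carr V" "v' \<in> carr V" "w \<in> carr W" "w' \<in> carr W" for v v' w w' c
    using b that unfolding bilin_def lin_def by blast+
  have step1: "h (tens V W e w) = b e w" if e: "e \<in> E" and w: "w \<in> carr W" for e w
  proof -
    have eV: "e \<in> carr V" using e E by blast
    have "w \<in> W.span F" using w F by blast
    then have "w \<in> carr W \<and> h (tens V W e w) = b e w"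
    proof (induction rule: W.span_induct_alt)
      case base
      have "b e (scl W 0 0) = scl X 0 (b e 0)"
        using b_lin(4)[OF eV eV W.subspace_0[OF sW] W.subspace_0[OF sW]] .
      then show ?case unfolding t_zero2 h.zero by (simp add: W.subspace_0[OF sW])
    next
      case (step c x y)
      have "x \<in> carr W" using step F by blast
      then show ?case
        using step eV b_lin(3)[OF eV eV, of "scl W c x" y] b_lin(4)[OF eV eV, of x x c]
        by (simp del: plus_fun_apply zero_fun_apply add: t_add2 t_scl2 h.add h.scale h_ef[OF e] W.subspace_add[OF sW]
            W.subspace_scale[OF sW])
    qed
    thus ?thesis ..
  qed
  have pure: "h (tens V W v w) = b v w" if v: "v \<in> carr V" and w: "w \<in> carr W" for v w
  proof -
    have "v \<in> V.span E" using v E by blast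
    then have "v \<in> carr V \<and> h (tens V W v w) = b v w"
    proof (induction rule: V.span_induct_alt)
      case base
      have "b (scl V 0 0) w = scl X 0 (b 0 w)"
        using b_lin(2)[OF V.subspace_0[OF sV] V.subspace_0[OF sV] w w] .
      then show ?case unfolding t_zero1 h.zero by (simp add: V.subspace_0[OF sV])
    next
      case (step c x y)
      have "x \<in> carr V" using step E by blast
      then show ?case
        using step w b_lin(1)[OF _ _ w w, of "scl V c x" y] b_lin(2)[OF _ _ w w, of x x c]
        by (simp del: plus_fun_apply zero_fun_apply add: t_add1 t_scl1 h.add h.scale step1 V.subspace_add[OF sV]
            V.subspace_scale[OF sV])
    qed
    thus ?thesis ..
  qed
  have im: "h x \<in> carr X" if "x \<in> carr (tspace V W)" for x
  proof -
    have "x \<in> P.span {tens V W v w | v w. v \<in> carr V \<and> w \<in> carr W}"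
      using that by (simp add: tspace_def)
    then show ?thesis
    proof (induction rule: P.span_induct_alt)
      case base
      show ?case unfolding h.zero by (rule X.subspace_0[OF sX])
    next
      case (step c x y)
      then show ?case
        by (auto simp del: plus_fun_apply zero_fun_apply simp: h.add h.scale pure intro!: X.subspace_add[OF sX] X.subspace_scale[OF sX] bX)
    qed
  qed
  have "lin (tspace V W) X h"
    using im by (auto simp del: plus_fun_apply simp: lin_def h.add) (auto simp: tspace_def h.scale)
  with pure show ?thesis by blast
qed

lemma tensor_lin_unique:
  assumes h: "lin (tspace V W) X h" and h': "lin (tspace V W) X h'"
    and eq: "\<forall>v\<in>carr V. \<forall>w\<in>carr W. h (tens V W v w) = h' (tens V W v w)"
    and x: "x \<in> carr (tspace V W)"
  shows "h x = h' x"
proof -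
  interpret P: vector_space pt_scale by (rule vector_space_pt_scale)
  let ?T = "{tens V W v w | v w. v \<in> carr V \<and> w \<in> carr W}"
  have l: "g (y + z) = g y + g z" "g (pt_scale c y) = scl X c (g y)"
    if "g = h \<or> g = h'" "y \<in> P.span ?T" "z \<in> P.span ?T" for g y z c
    using that h h' by (auto simp: lin_def tspace_def)
  have "x \<in> P.span ?T" using x by (simp add: tspace_def)
  then have "x \<in> P.span ?T \<and> h x = h' x"
  proof (induction rule: P.span_induct_alt)
    case base
    have "h 0 = 0" "h' 0 = 0"
      using l(1)[of h 0 0] l(1)[of h' 0 0] by (simp_all del: zero_fun_apply add: P.span_zero)
    then show ?case by (simp del: zero_fun_apply add: P.span_zero)
  next
    case (step c y z)
    have y: "y \<in> P.span ?T" using step by (auto intro: P.span_base)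
    have hy: "h y = h' y" using step eq by auto
    show ?case
      using step y hy l(1)[of h "pt_scale c y" z] l(1)[of h' "pt_scale c y" z]
        l(2)[of h y y c] l(2)[of h' y y c]
      by (simp del: plus_fun_apply add: P.span_add P.span_scale)
  qed
  thus "h x = h' x" ..
qed

lemma tlift:
  assumes "vect V" "vect W" "vect X" "bilin V W X b"
  shows "lin (tspace V W) X (tlift V W X b)"
    and "\<lbrakk>v \<in> carr V; w \<in> carr W\<rbrakk> \<Longrightarrow> tlift V W X b (tens V W v w) = b v w"
  using someI_ex[OF tensor_universal[OF assms]] unfolding tlift_def by blast+


section \<open>Algebras, coalgebras, bialgebras\<close>

record ('k, 'v) kalg = "('k, 'v) vspace" +
  mul :: "'v \<Rightarrow> 'v \<Rightarrow> 'v"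
  unit :: "'v"

record ('k, 'v) kbialg = "('k, 'v) kalg" +
  comul :: "'v \<Rightarrow> ('k, 'v, 'v) tensor"
  counit :: "'v \<Rightarrow> 'k"

definition algebra :: "('k::field, 'v::ab_group_add, 'm) kalg_scheme \<Rightarrow> bool" where
  "algebra A \<longleftrightarrow> vect A \<and> bilin A A A (mul A) \<and> unit A \<in> carr A
     \<and> (\<forall>x\<in>carr A. \<forall>y\<in>carr A. \<forall>z\<in>carr A. mul A (mul A x y) z = mul A x (mul A y z))
     \<and> (\<forall>x\<in>carr A. mul A (unit A) x = x \<and> mul A x (unit A) = x)"

definition comm_algebra :: "('k::field, 'v::ab_group_add, 'm) kalg_scheme \<Rightarrow> bool" where
  "comm_algebra A \<longleftrightarrow> algebra A \<and> (\<forall>x\<in>carr A. \<forall>y\<in>carr A. mul A x y = mul A y x)"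

definition coalgebra :: "('k::field, 'v::ab_group_add, 'm) kbialg_scheme \<Rightarrow> bool" where
  "coalgebra C \<longleftrightarrow> vect C \<and> lin C (tspace C C) (comul C) \<and> lin C ground (counit C)
     \<and> (\<forall>c\<in>carr C.
          tlift C C (tspace C (tspace C C))
            (\<lambda>c1 c2. tlift C C (tspace C (tspace C C))
               (\<lambda>x y. tens C (tspace C C) x (tens C C y c2)) (comul C c1)) (comul C c)
        = tlift C C (tspace C (tspace C C))
            (\<lambda>c1 c2. tens C (tspace C C) c1 (comul C c2)) (comul C c))
     \<and> (\<forall>c\<in>carr C. tlift C C C (\<lambda>c1 c2. scl C (counit C c1) c2) (comul C c) = c)
     \<and> (\<forall>c\<in>carr C. tlift C C C (\<lambda>c1 c2. scl C (counit C c2) c1) (comul C c) = c)"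

definition cocommutative :: "('k::field, 'v::ab_group_add, 'm) kbialg_scheme \<Rightarrow> bool" where
  "cocommutative C \<longleftrightarrow>
     (\<forall>c\<in>carr C. tlift C C (tspace C C) (\<lambda>c1 c2. tens C C c2 c1) (comul C c) = comul C c)"

definition tmul ::
    "('k::field, 'v::ab_group_add, 'm) kalg_scheme \<Rightarrow> ('k, 'w::ab_group_add, 'n) kalg_scheme
      \<Rightarrow> ('k, 'v, 'w) tensor \<Rightarrow> ('k, 'v, 'w) tensor \<Rightarrow> ('k, 'v, 'w) tensor" where
  "tmul A B x y =
     tlift A B (tspace A B) (\<lambda>a b.
       tlift A B (tspace A B) (\<lambda>a' b'. tens A B (mul A a a') (mul B b b')) y) x"

definition bialgebra :: "('k::field, 'v::ab_group_add, 'm) kbialg_scheme \<Rightarrow> bool" where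
  "bialgebra B \<longleftrightarrow> algebra B \<and> coalgebra B
     \<and> (\<forall>x\<in>carr B. \<forall>y\<in>carr B. comul B (mul B x y) = tmul B B (comul B x) (comul B y))
     \<and> comul B (unit B) = tens B B (unit B) (unit B)
     \<and> (\<forall>x\<in>carr B. \<forall>y\<in>carr B. counit B (mul B x y) = counit B x * counit B y)
     \<and> counit B (unit B) = 1"

definition coalgebra_map ::
    "('k::field, 'v::ab_group_add, 'm) kbialg_scheme \<Rightarrow> ('k, 'w::ab_group_add, 'n) kbialg_scheme
      \<Rightarrow> ('v \<Rightarrow> 'w) \<Rightarrow> bool" where
  "coalgebra_map C D f \<longleftrightarrow> lin C D f
     \<and> (\<forall>c\<in>carr C. comul D (f c) = tmap C C D D f f (comul C c))
     \<and> (\<forall>c\<in>carr C. counit D (f c) = counit C c)"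

definition algebra_map ::
    "('k::field, 'v::ab_group_add, 'm) kalg_scheme \<Rightarrow> ('k, 'w::ab_group_add, 'n) kalg_scheme
      \<Rightarrow> ('v \<Rightarrow> 'w) \<Rightarrow> bool" where
  "algebra_map A B f \<longleftrightarrow> lin A B f
     \<and> (\<forall>x\<in>carr A. \<forall>y\<in>carr A. f (mul A x y) = mul B (f x) (f y))
     \<and> f (unit A) = unit B"

definition bialgebra_map ::
    "('k::field, 'v::ab_group_add, 'm) kbialg_scheme \<Rightarrow> ('k, 'w::ab_group_add, 'n) kbialg_scheme
      \<Rightarrow> ('v \<Rightarrow> 'w) \<Rightarrow> bool" where
  "bialgebra_map B C f \<longleftrightarrow> algebra_map B C f \<and> coalgebra_map B C f"

definition bialgebra_iso ::
    "('k::field, 'v::ab_group_add, 'm) kbialg_scheme \<Rightarrow> ('k, 'w::ab_group_add, 'n) kbialg_scheme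
      \<Rightarrow> ('v \<Rightarrow> 'w) \<Rightarrow> bool" where
  "bialgebra_iso B C f \<longleftrightarrow> bialgebra_map B C f \<and> bij_betw f (carr B) (carr C)"

definition tensor_bialg ::
    "('k::field, 'v::ab_group_add, 'm) kbialg_scheme \<Rightarrow> ('k, 'w::ab_group_add, 'n) kbialg_scheme
      \<Rightarrow> ('k, ('k, 'v, 'w) tensor) kbialg" where
  "tensor_bialg B C =
     \<lparr>carr = carr (tspace B C), scl = scl (tspace B C),
      mul = tmul B C, unit = tens B C (unit B) (unit C),
      comul = tlift B C (tspace (tspace B C) (tspace B C)) (\<lambda>b c.
        tlift B B (tspace (tspace B C) (tspace B C)) (\<lambda>b1 b2.
          tlift C C (tspace (tspace B C) (tspace B C)) (\<lambda>c1 c2.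
            tens (tspace B C) (tspace B C) (tens B C b1 c1) (tens B C b2 c2))
          (comul C c)) (comul B b)),
      counit = tlift B C ground (\<lambda>b c. counit B b * counit C c)\<rparr>"


section \<open>Bimeasurings and universal bimeasuring bialgebras\<close>

definition bimeasuring ::
    "('k::field, 'n::ab_group_add, 'm) kbialg_scheme \<Rightarrow> ('k, 't::ab_group_add, 'o) kbialg_scheme
      \<Rightarrow> ('k, 'a::ab_group_add, 'p) kalg_scheme \<Rightarrow> (('k, 'n, 't) tensor \<Rightarrow> 'a) \<Rightarrow> bool" where
  "bimeasuring N T A \<psi> \<longleftrightarrow> lin (tspace N T) A \<psi>
     \<and> (\<forall>n\<in>carr N. \<forall>m\<in>carr N. \<forall>t\<in>carr T.
          \<psi> (tens N T (mul N n m) t)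
          = tlift T T A (\<lambda>t1 t2. mul A (\<psi> (tens N T n t1)) (\<psi> (tens N T m t2))) (comul T t))
     \<and> (\<forall>t\<in>carr T. \<psi> (tens N T (unit N) t) = scl A (counit T t) (unit A))
     \<and> (\<forall>n\<in>carr N. \<forall>t\<in>carr T. \<forall>s\<in>carr T.
          \<psi> (tens N T n (mul T t s))
          = tlift N N A (\<lambda>n1 n2. mul A (\<psi> (tens N T n1 t)) (\<psi> (tens N T n2 s))) (comul N n))
     \<and> (\<forall>n\<in>carr N. \<psi> (tens N T n (unit T)) = scl A (counit N n) (unit A))"

definition factors_through ::
    "('k::field, 'n::ab_group_add, 'm) kbialg_scheme \<Rightarrow> ('k, 'b::ab_group_add, 'o) kbialg_scheme
      \<Rightarrow> ('k, 't::ab_group_add, 'p) kbialg_scheme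
      \<Rightarrow> (('k, 'b, 't) tensor \<Rightarrow> 'a) \<Rightarrow> (('k, 'n, 't) tensor \<Rightarrow> 'a) \<Rightarrow> ('n \<Rightarrow> 'b) \<Rightarrow> bool" where
  "factors_through N B T \<theta> f h \<longleftrightarrow>
     (\<forall>x\<in>carr (tspace N T). f x = \<theta> (tmap N T B T h (\<lambda>t. t) x))"

text \<open>
  HOL cannot quantify over all types inside a formula, so in the universal properties the test
  bialgebras \<open>N\<close> are those whose underlying vector space is a subspace of a fixed type \<open>'u\<close>,
  with an arbitrary \<open>'k\<close>-vector space structure extending the addition of \<open>'u\<close>. If \<open>'u\<close> admits
  an infinite dimensional such structure (\<open>large_universe\<close>), this is no restriction: every countable
  subset of a bialgebra lies in a subbialgebra of countable dimension, which has a copy in \<open>'u\<close>,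
  and by uniqueness the maps on these subbialgebras glue. As assumptions on \<open>(B, \<theta>)\<close> these
  properties are in any case implied by universality among all bialgebras, for every \<open>'u\<close>.
\<close>

definition large_universe :: "'k::field itself \<Rightarrow> 'u::ab_group_add itself \<Rightarrow> bool" where
  "large_universe _ _ \<longleftrightarrow>
     (\<exists>s :: 'k \<Rightarrow> 'u \<Rightarrow> 'u. vector_space s \<and> (\<exists>X. infinite X \<and> \<not> module.dependent s X))"

definition universal_bimeasuring ::
    "'u::ab_group_add itself \<Rightarrow> ('k::field, 'b::ab_group_add) kbialg
      \<Rightarrow> ('k, 't::ab_group_add) kbialg \<Rightarrow> ('k, 'a::ab_group_add) kalg
      \<Rightarrow> (('k, 'b, 't) tensor \<Rightarrow> 'a) \<Rightarrow> bool" where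
  "universal_bimeasuring _ B T A \<theta> \<longleftrightarrow>
     bialgebra B \<and> bimeasuring B T A \<theta> \<and>
     (\<forall>(N :: ('k, 'u) kbialg) f. bialgebra N \<and> bimeasuring N T A f \<longrightarrow>
        (\<exists>h. bialgebra_map N B h \<and> factors_through N B T \<theta> f h \<and>
          (\<forall>h'. bialgebra_map N B h' \<and> factors_through N B T \<theta> f h' \<longrightarrow>
             (\<forall>n\<in>carr N. h' n = h n))))"

definition universal_cocomm_bimeasuring ::
    "'u::ab_group_add itself \<Rightarrow> ('k::field, 'b::ab_group_add) kbialg
      \<Rightarrow> ('k, 't::ab_group_add) kbialg \<Rightarrow> ('k, 'a::ab_group_add) kalg
      \<Rightarrow> (('k, 'b, 't) tensor \<Rightarrow> 'a) \<Rightarrow> bool" where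
  "universal_cocomm_bimeasuring _ B T A \<theta> \<longleftrightarrow>
     bialgebra B \<and> cocommutative B \<and> bimeasuring B T A \<theta> \<and>
     (\<forall>(N :: ('k, 'u) kbialg) f. bialgebra N \<and> cocommutative N \<and> bimeasuring N T A f \<longrightarrow>
        (\<exists>h. bialgebra_map N B h \<and> factors_through N B T \<theta> f h \<and>
          (\<forall>h'. bialgebra_map N B h' \<and> factors_through N B T \<theta> f h' \<longrightarrow>
             (\<forall>n\<in>carr N. h' n = h n))))"

text \<open>
  The subspace \<open>D\<close> of \<open>B = B(T,A)\<close> is a realization of \<open>B\<^sub>c(T,A)\<close> inside \<open>B(T,A)\<close>: it is a
  subbialgebra which together with the restriction of \<open>\<theta>\<close> is a universal cocommutative
  bimeasuring bialgebra.
\<close>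

definition cocomm_universal_part ::
    "'u::ab_group_add itself \<Rightarrow> ('k::field, 'b::ab_group_add) kbialg
      \<Rightarrow> ('k, 't::ab_group_add) kbialg \<Rightarrow> ('k, 'a::ab_group_add) kalg
      \<Rightarrow> (('k, 'b, 't) tensor \<Rightarrow> 'a) \<Rightarrow> 'b set \<Rightarrow> bool" where
  "cocomm_universal_part u B T A \<theta> D \<longleftrightarrow>
     D \<subseteq> carr B \<and> universal_cocomm_bimeasuring u (B\<lparr>carr := D\<rparr>) T A \<theta>"

end

theory Submission
  imports Defs "HOL-Library.Countable_Set"
begin

text \<open>
  Restriction along \<open>t \<mapsto> t \<otimes> 1\<close> and \<open>s \<mapsto> 1 \<otimes> s\<close> gives, by universality, bialgebra maps
  \<open>p : B(T \<otimes> S, A) \<rightarrow> B(T, A)\<close> and \<open>q : B(T \<otimes> S, A) \<rightarrow> B(S, A)\<close>. The composite \<open>p \<circ> \<alpha>\<close> and the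
  projection \<open>id \<otimes> \<epsilon>\<close> represent the same bimeasuring, so they are equal, and likewise
  \<open>q \<circ> \<alpha> = \<epsilon> \<otimes> id\<close>. Since \<open>\<alpha>\<close> is a coalgebra map, \<open>(p \<otimes> q) \<circ> \<Delta> \<circ> \<alpha>\<close> sends \<open>f \<otimes> g\<close> to
  \<open>f\<^sub>1 \<epsilon>(g\<^sub>1) \<otimes> \<epsilon>(f\<^sub>2) g\<^sub>2 = f \<otimes> g\<close> (\<open>tmap_projections_comul\<close>), and \<open>\<alpha>\<close> is injective.

  The left inverse \<open>(p \<otimes> q) \<circ> \<Delta>\<close> is not a coalgebra map in general, but it is a bialgebra map on a
  cocommutative subbialgebra, because there \<open>\<Delta>\<close> is one (\<open>bialgebra_map_comul\<close>). On \<open>B\<^sub>c(T \<otimes> S, A)\<close>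
  the bialgebra maps \<open>\<alpha> \<circ> (p \<otimes> q) \<circ> \<Delta>\<close> and the inclusion represent the same bimeasuring: as
  \<open>t \<otimes> s = (t \<otimes> 1) (1 \<otimes> s)\<close>,
  \<open>\<theta>(x, t \<otimes> s) = \<theta>(x\<^sub>1, t \<otimes> 1) \<theta>(x\<^sub>2, 1 \<otimes> s) = \<theta>(p x\<^sub>1, t) \<theta>(q x\<^sub>2, s)\<close>. So they are equal. Every
  bialgebra map from a cocommutative bialgebra lands in the cocommutative part
  (\<open>maps_into_cocomm_part\<close>), so \<open>\<alpha>\<close> and \<open>(p \<otimes> q) \<circ> \<Delta>\<close> restrict to mutually inverse maps.

  Two supplements to the hypotheses are needed. First, universality is assumed only for bialgebras
  on one type, whereas it is applied to bialgebras on several others. Every countable subset of a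
  bialgebra lies in a subbialgebra of countable dimension (\<open>countable_sub_exists\<close>), which has a
  copy on the given type, and by uniqueness the maps obtained in this way glue
  (\<open>universal_unique\<close>, \<open>universal_exists\<close>). Secondly, universality concerns bialgebra maps only,
  whereas \<open>\<alpha>\<close> must be unique among coalgebra maps. If coalgebra maps \<open>\<alpha>, \<beta> : C \<rightarrow> B\<close> represent the
  same measuring, then the ideal \<open>J\<close> generated by all \<open>\<alpha> x - \<beta> x\<close> is a biideal, and the universal
  bimeasuring \<open>\<theta>\<close> vanishes on it. Hence \<open>\<theta>\<close> factors through \<open>B / J\<close>, universality gives a
  bialgebra map \<open>B / J \<rightarrow> B\<close>, whose composite with the quotient map is the identity by uniqueness,
  and \<open>J = 0\<close>. For the sake of the first point this is done inside subbialgebras of countable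
  dimension (\<open>universal_coalgebra_map_unique\<close>).

  Sweedler notation is rendered by \<open>tsum\<close>, a sum over a chosen decomposition of a tensor into pure
  tensors.
\<close>


section \<open>Linear maps and tensors\<close>

text \<open>
  The rules \<open>lin_intros\<close> and \<open>mem_intros\<close> reduce linearity and membership in carriers to those of
  the constituents, guided by the form of the term. Together with \<open>bilinI\<close> they discharge the side
  conditions of the calculations below by \<open>intro\<close>.
\<close>

named_theorems lin_intros
named_theorems mem_intros

lemma vect_ops:
  assumes "vect V"
  shows vect_zero: "0 \<in> carr V"
    and vect_add: "x \<in> carr V \<Longrightarrow> y \<in> carr V \<Longrightarrow> x + y \<in> carr V"
    and vect_diff: "x \<in> carr V \<Longrightarrow> y \<in> carr V \<Longrightarrow> x - y \<in> carr V"
    and vect_scl: "x \<in> carr V \<Longrightarrow> scl V c x \<in> carr V"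
proof -
  interpret vector_space "scl V" using assms by (simp add: vect_def)
  have "subspace (carr V)" using assms by (simp add: vect_def)
  then show "0 \<in> carr V" "x \<in> carr V \<Longrightarrow> y \<in> carr V \<Longrightarrow> x + y \<in> carr V"
    "x \<in> carr V \<Longrightarrow> y \<in> carr V \<Longrightarrow> x - y \<in> carr V" "x \<in> carr V \<Longrightarrow> scl V c x \<in> carr V"
    by (auto intro: subspace_0 subspace_add subspace_diff subspace_scale)
qed

lemma vect_scl_laws:
  assumes "vect V"
  shows vect_scl_add: "scl V c (x + y) = scl V c x + scl V c y"
    and vect_scl_add_left: "scl V (c + d) x = scl V c x + scl V d x"
    and vect_scl_scl: "scl V c (scl V d x) = scl V (c * d) x"
    and vect_scl_one: "scl V 1 x = x"
    and vect_scl_diff: "scl V c (x - y) = scl V c x - scl V c y"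
proof -
  interpret vector_space "scl V" using assms by (simp add: vect_def)
  show "scl V c (x + y) = scl V c x + scl V c y" "scl V (c + d) x = scl V c x + scl V d x"
    "scl V c (scl V d x) = scl V (c * d) x" "scl V 1 x = x"
    "scl V c (x - y) = scl V c x - scl V c y"
    by (simp_all add: scale_right_distrib scale_left_distrib scale_right_diff_distrib)
qed

lemma carr_ground [simp]: "carr ground = UNIV" and scl_ground [simp]: "scl ground = (*)"
  by (simp_all add: ground_def)

lemma scl_tspace: "scl (tspace V W) = pt_scale"
  by (simp add: tspace_def)

lemma lin_mem: "lin V W f \<Longrightarrow> x \<in> carr V \<Longrightarrow> f x \<in> carr W"
  and lin_add: "lin V W f \<Longrightarrow> x \<in> carr V \<Longrightarrow> y \<in> carr V \<Longrightarrow> f (x + y) = f x + f y"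
  and lin_scl: "lin V W f \<Longrightarrow> x \<in> carr V \<Longrightarrow> f (scl V c x) = scl W c (f x)"
  unfolding lin_def by blast+

lemma linI:
  assumes "\<And>x. x \<in> carr V \<Longrightarrow> f x \<in> carr W"
    and "\<And>x y. x \<in> carr V \<Longrightarrow> y \<in> carr V \<Longrightarrow> f (x + y) = f x + f y"
    and "\<And>c x. x \<in> carr V \<Longrightarrow> f (scl V c x) = scl W c (f x)"
  shows "lin V W f"
  using assms unfolding lin_def by blast

lemma lin_0:
  assumes "lin V W f" "vect V" shows "f 0 = 0"
  using lin_add[OF assms(1) vect_zero[OF assms(2)] vect_zero[OF assms(2)]] by simp

lemma lin_minus:
  assumes "lin V W f" "vect V" "x \<in> carr V" "y \<in> carr V" shows "f (x - y) = f x - f y"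
proof -
  have "f ((x - y) + y) = f (x - y) + f y"
    by (rule lin_add[OF assms(1) vect_diff[OF assms(2-4)] assms(4)])
  then show ?thesis by simp
qed

lemma lin_cong:
  assumes "lin V W f" "vect V" "\<And>x. x \<in> carr V \<Longrightarrow> f x = g x"
  shows "lin V W g"
  using assms(1) assms(3)[symmetric] vect_add[OF assms(2)] vect_scl[OF assms(2)]
  unfolding lin_def by (auto simp del: plus_fun_apply)

lemma lin_id [lin_intros]: "lin V V (\<lambda>x. x)"
  unfolding lin_def by auto

lemma lin_comp: "lin V W h \<Longrightarrow> lin U V f \<Longrightarrow> lin U W (\<lambda>u. h (f u))"
  unfolding lin_def by (auto simp: image_subset_iff)

lemma bilinI:
  assumes "\<And>w. w \<in> carr W \<Longrightarrow> lin V X (\<lambda>v. b v w)"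
    and "\<And>v. v \<in> carr V \<Longrightarrow> lin W X (b v)"
  shows "bilin V W X b"
  using assms unfolding bilin_def by blast

lemma bilin_lin1: "bilin V W X b \<Longrightarrow> w \<in> carr W \<Longrightarrow> lin V X (\<lambda>v. b v w)"
  and bilin_lin2: "bilin V W X b \<Longrightarrow> v \<in> carr V \<Longrightarrow> lin W X (b v)"
  unfolding bilin_def by blast+

lemma bilin_mem: "bilin V W X b \<Longrightarrow> v \<in> carr V \<Longrightarrow> w \<in> carr W \<Longrightarrow> b v w \<in> carr X"
  by (rule lin_mem[OF bilin_lin2])

lemma lin_bilin1: "bilin V W X b \<Longrightarrow> lin U V f \<Longrightarrow> w \<in> carr W \<Longrightarrow> lin U X (\<lambda>u. b (f u) w)"
  by (rule lin_comp[OF bilin_lin1])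

lemma lin_bilin2: "bilin V W X b \<Longrightarrow> lin U W f \<Longrightarrow> v \<in> carr V \<Longrightarrow> lin U X (\<lambda>u. b v (f u))"
  by (rule lin_comp[OF bilin_lin2])

lemma lin_tens1 [lin_intros]:
  "lin U V f \<Longrightarrow> w \<in> carr W \<Longrightarrow> lin U (tspace V W) (\<lambda>u. tens V W (f u) w)"
  by (rule lin_bilin1[OF bilin_tens])

lemma lin_tens2 [lin_intros]:
  "lin U W f \<Longrightarrow> v \<in> carr V \<Longrightarrow> lin U (tspace V W) (\<lambda>u. tens V W v (f u))"
  by (rule lin_bilin2[OF bilin_tens])

declare tens_in_tspace [mem_intros]

declare vect_zero [mem_intros] vect_add [mem_intros] vect_diff [mem_intros] vect_scl [mem_intros]

lemma lin_scl1 [lin_intros]: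
  assumes "vect X" "lin U ground f" "x \<in> carr X" shows "lin U X (\<lambda>u. scl X (f u) x)"
  using assms by (intro linI) (simp_all del: plus_fun_apply
    add: lin_mem lin_add lin_scl vect_scl vect_scl_laws)

lemma lin_scl2 [lin_intros]:
  assumes "vect X" "lin U X f" shows "lin U X (\<lambda>u. scl X c (f u))"
  using assms by (intro linI) (simp_all del: plus_fun_apply
    add: lin_mem lin_add lin_scl vect_scl vect_scl_laws mult.commute)

lemma lin_mult1 [lin_intros]: "lin U ground f \<Longrightarrow> lin U ground (\<lambda>u. f u * c)"
  and lin_mult2 [lin_intros]: "lin U ground f \<Longrightarrow> lin U ground (\<lambda>u. c * f u)"
  unfolding lin_def by (auto simp: algebra_simps)

text \<open>
  Unlike \<open>tlift\<close>, the sum of \<open>F\<close> over a chosen decomposition makes sense for every \<open>F\<close>. Hence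
  exchange of sums, congruence and compatibility with linear maps need no bilinearity; this is
  required only where independence of the decomposition matters.
\<close>

definition trep ::
    "('k::field, 'v::ab_group_add, 'm) vspace_scheme \<Rightarrow> ('k, 'w::ab_group_add, 'n) vspace_scheme
      \<Rightarrow> ('k, 'v, 'w) tensor \<Rightarrow> ('v \<times> 'w) list" where
  "trep V W x = (SOME xs. set xs \<subseteq> carr V \<times> carr W \<and> x = (\<Sum>(v, w)\<leftarrow>xs. tens V W v w))"

definition tsum ::
    "('k::field, 'v::ab_group_add, 'm) vspace_scheme \<Rightarrow> ('k, 'w::ab_group_add, 'n) vspace_scheme
      \<Rightarrow> ('k, 'v, 'w) tensor \<Rightarrow> ('v \<Rightarrow> 'w \<Rightarrow> 'x::ab_group_add) \<Rightarrow> 'x" where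
  "tsum V W x F = (\<Sum>(v, w)\<leftarrow>trep V W x. F v w)"

lemma trep_spec:
  assumes V: "vect V" and x: "x \<in> carr (tspace V W)"
  shows trep_set: "set (trep V W x) \<subseteq> carr V \<times> carr W"
    and trep_eq: "x = (\<Sum>(v, w)\<leftarrow>trep V W x. tens V W v w)"
proof -
  interpret P: vector_space pt_scale by (rule vector_space_pt_scale)
  let ?R = "\<lambda>x xs. set xs \<subseteq> carr V \<times> carr W \<and> x = (\<Sum>(v, w)\<leftarrow>xs. tens V W v w)"
  have "x \<in> P.span {tens V W v w | v w. v \<in> carr V \<and> w \<in> carr W}"
    using x by (simp add: tspace_def)
  then have "\<exists>xs. ?R x xs"
  proof (induction rule: P.span_induct_alt)
    case base
    show ?case by (rule exI[of _ "[]"]) simp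
  next
    case (step c y z)
    from step obtain v w xs where *: "v \<in> carr V" "w \<in> carr W" "y = tens V W v w" "?R z xs" by blast
    have "pt_scale c y = tens V W (scl V c v) w"
      using lin_scl[OF bilin_lin1[OF bilin_tens *(2)] *(1)] *(3) by (simp add: scl_tspace)
    with * V show ?case
      by (intro exI[of _ "(scl V c v, w) # xs"]) (simp add: vect_scl)
  qed
  from someI_ex[OF this]
  show "set (trep V W x) \<subseteq> carr V \<times> carr W" "x = (\<Sum>(v, w)\<leftarrow>trep V W x. tens V W v w)"
    unfolding trep_def by blast+
qed

lemma vect_sum_list:
  assumes "vect X" "\<And>p. p \<in> set xs \<Longrightarrow> F p \<in> carr X" shows "sum_list (map F xs) \<in> carr X"
  using assms(2) by (induction xs) (auto simp del: plus_fun_apply simp: vect_zero[OF assms(1)]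
      intro!: vect_add[OF assms(1)])

lemma lin_sum_list:
  assumes "lin X Y L" "vect X" "\<And>p. p \<in> set xs \<Longrightarrow> F p \<in> carr X"
  shows "L (sum_list (map F xs)) = sum_list (map (\<lambda>p. L (F p)) xs)"
  using assms(3)
proof (induction xs)
  case (Cons p xs)
  have "L (F p + sum_list (map F xs)) = L (F p) + L (sum_list (map F xs))"
    by (rule lin_add[OF assms(1)]) (use Cons.prems in \<open>auto intro!: vect_sum_list[OF assms(2)]\<close>)
  with Cons show ?case by simp
qed (simp add: lin_0[OF assms(1,2)])

lemma tsum_mem [mem_intros]:
  assumes "vect V" "vect X" "x \<in> carr (tspace V W)"
    and "\<And>v w. v \<in> carr V \<Longrightarrow> w \<in> carr W \<Longrightarrow> F v w \<in> carr X"
  shows "tsum V W x F \<in> carr X"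
  unfolding tsum_def using trep_set[OF assms(1,3)]
  by (intro vect_sum_list[OF assms(2)]) (auto intro!: assms(4))

lemma tsum_cong:
  assumes "vect V" "x \<in> carr (tspace V W)"
    and "\<And>v w. v \<in> carr V \<Longrightarrow> w \<in> carr W \<Longrightarrow> F v w = G v w"
  shows "tsum V W x F = tsum V W x G"
proof -
  have "map (\<lambda>(v, w). F v w) (trep V W x) = map (\<lambda>(v, w). G v w) (trep V W x)"
    using trep_set[OF assms(1,2)] by (auto intro!: assms(3))
  then show ?thesis unfolding tsum_def by (rule arg_cong)
qed

lemma tsum_lin:
  assumes "vect V" "vect X" "x \<in> carr (tspace V W)" "lin X Y L"
    and "\<And>v w. v \<in> carr V \<Longrightarrow> w \<in> carr W \<Longrightarrow> F v w \<in> carr X"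
  shows "L (tsum V W x F) = tsum V W x (\<lambda>v w. L (F v w))"
proof -
  have "L (tsum V W x F) = sum_list (map (\<lambda>p. L (case p of (v, w) \<Rightarrow> F v w)) (trep V W x))"
    unfolding tsum_def using trep_set[OF assms(1,3)]
    by (intro lin_sum_list[OF assms(4,2)]) (auto intro!: assms(5))
  also have "\<dots> = tsum V W x (\<lambda>v w. L (F v w))"
    unfolding tsum_def by (rule arg_cong[where f=sum_list]) auto
  finally show ?thesis .
qed

lemma tsum_tens_id:
  assumes "vect V" "x \<in> carr (tspace V W)" shows "tsum V W x (tens V W) = x"
  unfolding tsum_def by (rule trep_eq[OF assms, symmetric])

lemma tsum_zero [simp]: "tsum V W x (\<lambda>v w. 0) = 0"
proof -
  have "(\<Sum>(v, w)\<leftarrow>xs. 0) = (0::'x::ab_group_add)" for xs :: "('v \<times> 'w) list"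
    by (induction xs) auto
  then show ?thesis unfolding tsum_def .
qed

lemma tsum_plus: "tsum V W x (\<lambda>v w. F v w + G v w) = tsum V W x F + tsum V W x G"
proof -
  have "(\<Sum>(v, w)\<leftarrow>xs. F v w + G v w) = (\<Sum>(v, w)\<leftarrow>xs. F v w) + (\<Sum>(v, w)\<leftarrow>xs. G v w)" for xs
    by (induction xs) (auto simp: algebra_simps)
  then show ?thesis unfolding tsum_def .
qed

lemma tsum_minus: "tsum V W x (\<lambda>v w. F v w - G v w) = tsum V W x F - tsum V W x G"
proof -
  have "(\<Sum>(v, w)\<leftarrow>xs. F v w - G v w) = (\<Sum>(v, w)\<leftarrow>xs. F v w) - (\<Sum>(v, w)\<leftarrow>xs. G v w)" for xs
    by (induction xs) (auto simp: algebra_simps)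
  then show ?thesis unfolding tsum_def .
qed

lemma tsum_swap:
  "tsum V W x (\<lambda>a b. tsum V' W' y (F a b)) = tsum V' W' y (\<lambda>c d. tsum V W x (\<lambda>a b. F a b c d))"
proof -
  have zero: "(\<Sum>(c, d)\<leftarrow>ys. 0) = (0::'x::ab_group_add)" for ys :: "('v \<times> 'w) list"
    by (induction ys) auto
  have plus: "(\<Sum>(c, d)\<leftarrow>ys. f c d + g c d) = (\<Sum>(c, d)\<leftarrow>ys. f c d) + (\<Sum>(c, d)\<leftarrow>ys. g c d)"
    for f g :: "'v \<Rightarrow> 'w \<Rightarrow> 'x::ab_group_add" and ys by (induction ys) (auto simp: algebra_simps)
  have "(\<Sum>(a, b)\<leftarrow>xs. \<Sum>(c, d)\<leftarrow>ys. F a b c d) = (\<Sum>(c, d)\<leftarrow>ys. \<Sum>(a, b)\<leftarrow>xs. F a b c d)" for xs ys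
    by (induction xs) (auto simp: zero plus)
  then show ?thesis unfolding tsum_def .
qed

lemma tlift_eq_tsum:
  assumes "vect V" "vect W" "vect X" "bilin V W X F" "x \<in> carr (tspace V W)"
  shows "tlift V W X F x = tsum V W x F"
proof -
  have "tlift V W X F x = tlift V W X F (tsum V W x (tens V W))"
    by (simp add: tsum_tens_id assms)
  also have "\<dots> = tsum V W x (\<lambda>v w. tlift V W X F (tens V W v w))"
    by (rule tsum_lin[OF assms(1) vect_tspace assms(5) tlift(1)[OF assms(1-4)]]) (rule
        tens_in_tspace)
  also have "\<dots> = tsum V W x F"
    by (rule tsum_cong[OF assms(1,5)]) (rule tlift(2)[OF assms(1-4)])
  finally show ?thesis .
qed

lemma lin_tsum:
  assumes "vect V" "vect W" "vect X" "bilin V W X F"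
  shows "lin (tspace V W) X (\<lambda>x. tsum V W x F)"
  by (rule lin_cong[OF tlift(1)[OF assms] vect_tspace]) (rule tlift_eq_tsum[OF assms])

lemma tsum_tens:
  assumes "vect V" "vect W" "vect X" "bilin V W X F" "v \<in> carr V" "w \<in> carr W"
  shows "tsum V W (tens V W v w) F = F v w"
  using tlift(2)[OF assms] tlift_eq_tsum[OF assms(1-4) tens_in_tspace[OF assms(5,6)]] by simp

lemma lin_tsum_arg [lin_intros]:
  assumes "vect V" "vect W" "vect X" "bilin V W X F" "lin U (tspace V W) f"
  shows "lin U X (\<lambda>u. tsum V W (f u) F)"
  by (rule lin_comp[OF lin_tsum[OF assms(1-4)] assms(5)])

lemma lin_tsum_body [lin_intros]:
  assumes "vect U" "vect V" "vect X" "x \<in> carr (tspace V W)"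
    and F: "\<And>v w. v \<in> carr V \<Longrightarrow> w \<in> carr W \<Longrightarrow> lin U X (\<lambda>u. F u v w)"
  shows "lin U X (\<lambda>u. tsum V W x (F u))"
proof (rule linI)
  show "tsum V W x (F u) \<in> carr X" if "u \<in> carr U" for u
    using that by (intro tsum_mem assms lin_mem[OF F])
  show "tsum V W x (F (u + u')) = tsum V W x (F u) + tsum V W x (F u')"
    if "u \<in> carr U" "u' \<in> carr U" for u u'
    unfolding tsum_plus[symmetric]
    by (intro tsum_cong assms lin_add[OF F] that)
  show "tsum V W x (F (scl U c u)) = scl X c (tsum V W x (F u))" if u: "u \<in> carr U" for c u
  proof -
    have "scl X c (tsum V W x (F u)) = tsum V W x (\<lambda>v w. scl X c (F u v w))"
      by (intro tsum_lin[where X=X and Y=X] assms lin_mem[OF F] u lin_intros)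
    then show ?thesis
      by (simp only:) (intro tsum_cong assms lin_scl[OF F] u)
  qed
qed

lemma tsum_tsum:
  assumes "vect V" "vect W" "vect V'" "vect W'" "vect X" "x \<in> carr (tspace V W)"
    and "bilin V' W' X F"
    and "\<And>v w. v \<in> carr V \<Longrightarrow> w \<in> carr W \<Longrightarrow> G v w \<in> carr (tspace V' W')"
  shows "tsum V' W' (tsum V W x G) F = tsum V W x (\<lambda>v w. tsum V' W' (G v w) F)"
  by (rule tsum_lin[OF assms(1) vect_tspace assms(6) lin_tsum[OF assms(3,4,5,7)] assms(8)])

lemma tmap_eq_tsum:
  assumes "vect V" "vect W" "lin V X f" "lin W Y g" "x \<in> carr (tspace V W)"
  shows "tmap V W X Y f g x = tsum V W x (\<lambda>v w. tens X Y (f v) (g w))"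
  unfolding tmap_def
  by (intro tlift_eq_tsum assms vect_tspace bilinI lin_intros lin_mem[OF assms(3)] lin_mem[OF
      assms(4)])

lemma lin_tmap:
  assumes "vect V" "vect W" "lin V X f" "lin W Y g"
  shows "lin (tspace V W) (tspace X Y) (tmap V W X Y f g)"
  unfolding tmap_def
  by (intro tlift assms vect_tspace bilinI lin_intros lin_mem[OF assms(3)] lin_mem[OF assms(4)])

lemma tmap_tens:
  assumes "vect V" "vect W" "lin V X f" "lin W Y g" "v \<in> carr V" "w \<in> carr W"
  shows "tmap V W X Y f g (tens V W v w) = tens X Y (f v) (g w)"
  unfolding tmap_def
  by (intro tlift assms vect_tspace bilinI lin_intros lin_mem[OF assms(3)] lin_mem[OF assms(4)])

text \<open>
  Pure tensors depend on the scalar multiplications only, so the tensor product of subspaces is a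
  subspace of the tensor product, and computations may pass between a bialgebra and its
  subbialgebras, or between \<open>tensor_bialg B C\<close> and \<open>tspace B C\<close>.
\<close>

lemma tens_scl_cong: "scl V = scl V' \<Longrightarrow> scl W = scl W' \<Longrightarrow> tens V W = tens V' W'"
  unfolding tens_def bilin_form_def by simp

lemma tspace_mono:
  assumes "scl V = scl V'" "scl W = scl W'" "carr V \<subseteq> carr V'" "carr W \<subseteq> carr W'"
  shows "carr (tspace V W) \<subseteq> carr (tspace V' W')"
proof -
  interpret P: vector_space pt_scale by (rule vector_space_pt_scale)
  show ?thesis
    unfolding tspace_def using assms tens_scl_cong[OF assms(1,2)]
    by (simp, intro P.span_mono) auto
qed

lemma tspace_cong:
  assumes "scl V = scl V'" "scl W = scl W'" "carr V = carr V'" "carr W = carr W'"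
  shows "tspace V W = tspace V' W'"
  unfolding tspace_def using assms tens_scl_cong[OF assms(1,2)] by simp

lemma tsum_carr_cong:
  assumes "scl V = scl V'" "scl W = scl W'" "carr V = carr V'" "carr W = carr W'"
  shows "tsum V W = tsum V' W'"
  unfolding tsum_def[abs_def] trep_def assms(3,4) tens_scl_cong[OF assms(1,2)] ..

lemma lin_carr_cong:
  assumes "scl V = scl V'" "scl W = scl W'" "carr V = carr V'" "carr W = carr W'"
  shows "lin V W = lin V' W'"
  unfolding lin_def using assms by (simp add: fun_eq_iff)

lemma lin_subset:
  assumes "lin V' W f" "scl V = scl V'" "carr V \<subseteq> carr V'"
  shows "lin V W f"
  using assms unfolding lin_def by (auto simp: subset_iff)

lemma lin_subset2:
  assumes "lin V W' f" "scl W = scl W'" "carr W' \<subseteq> carr W"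
  shows "lin V W f"
  using assms unfolding lin_def by (auto simp: subset_iff)

lemma tsum_subset:
  assumes V: "vect V" "vect W" "vect V'" "vect W'" "vect X"
    and s: "scl V = scl V'" "scl W = scl W'" "carr V \<subseteq> carr V'" "carr W \<subseteq> carr W'"
    and F: "bilin V' W' X F" and x: "x \<in> carr (tspace V W)"
  shows "tsum V W x F = tsum V' W' x F"
proof -
  have "tsum V' W' x F = tsum V' W' (tsum V W x (tens V W)) F"
    by (simp add: tsum_tens_id V x)
  also have "\<dots> = tsum V W x (\<lambda>v w. tsum V' W' (tens V W v w) F)"
    unfolding tens_scl_cong[OF s(1,2)]
    by (intro tsum_tsum[where X=X] V x F tens_in_tspace) (use s in auto)
  also have "\<dots> = tsum V W x F"
    unfolding tens_scl_cong[OF s(1,2)]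
    by (intro tsum_cong V x tsum_tens[where X=X] F) (use s in auto)
  finally show ?thesis ..
qed

lemma tens_eqI:
  assumes "lin (tspace V W) X h" "lin (tspace V W) X h'" "x \<in> carr (tspace V W)"
    and "\<And>v w. v \<in> carr V \<Longrightarrow> w \<in> carr W \<Longrightarrow> h (tens V W v w) = h' (tens V W v w)"
  shows "h x = h' x"
  using tensor_lin_unique[OF assms(1,2)] assms(3,4) by blast

text \<open>
  The conclusions are bounded quantifications rather than equations for fixed \<open>x\<close>: then the two
  sides are determined by higher-order pattern unification.
\<close>

lemma tens_ballI:
  assumes "lin (tspace V W) X h" "lin (tspace V W) X h'"
    and "\<And>v w. v \<in> carr V \<Longrightarrow> w \<in> carr W \<Longrightarrow> h (tens V W v w) = h' (tens V W v w)"
  shows "\<forall>x\<in>carr (tspace V W). h x = h' x"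
  using tens_eqI[OF assms(1,2) _ assms(3)] by blast

lemma tens_ballI2:
  assumes l: "\<And>y. y \<in> carr (tspace V' W') \<Longrightarrow> lin (tspace V W) X (\<lambda>x. F x y)"
     "\<And>y. y \<in> carr (tspace V' W') \<Longrightarrow> lin (tspace V W) X (\<lambda>x. G x y)"
     "\<And>x. x \<in> carr (tspace V W) \<Longrightarrow> lin (tspace V' W') X (\<lambda>y. F x y)"
     "\<And>x. x \<in> carr (tspace V W) \<Longrightarrow> lin (tspace V' W') X (\<lambda>y. G x y)"
    and eq: "\<And>a b a' b'. a \<in> carr V \<Longrightarrow> b \<in> carr W \<Longrightarrow> a' \<in> carr V' \<Longrightarrow> b' \<in> carr W'
      \<Longrightarrow> F (tens V W a b) (tens V' W' a' b') = G (tens V W a b) (tens V' W' a' b')"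
  shows "\<forall>x\<in>carr (tspace V W). \<forall>y\<in>carr (tspace V' W'). F x y = G x y"
proof (intro ballI)
  fix x y assume x: "x \<in> carr (tspace V W)" and y: "y \<in> carr (tspace V' W')"
  have "F (tens V W a b) y = G (tens V W a b) y" if "a \<in> carr V" "b \<in> carr W" for a b
    by (rule tens_eqI[OF l(3,4) y]) (intro that mem_intros eq | assumption)+
  then show "F x y = G x y"
    by (intro tens_eqI[OF l(1,2) x] y)
qed

lemma tens_ballI3:
  assumes "\<And>y z. y \<in> carr (tspace V' W') \<Longrightarrow> z \<in> carr (tspace V'' W'') \<Longrightarrow> lin (tspace V W) X (\<lambda>x. F x y
      z)"
    and "\<And>y z. y \<in> carr (tspace V' W') \<Longrightarrow> z \<in> carr (tspace V'' W'') \<Longrightarrow> lin (tspace V W) X (\<lambda>x. G x y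
        z)"
    and "\<And>x z. x \<in> carr (tspace V W) \<Longrightarrow> z \<in> carr (tspace V'' W'') \<Longrightarrow> lin (tspace V' W') X (\<lambda>y. F x y
        z)"
    and "\<And>x z. x \<in> carr (tspace V W) \<Longrightarrow> z \<in> carr (tspace V'' W'') \<Longrightarrow> lin (tspace V' W') X (\<lambda>y. G x y
        z)"
    and "\<And>x y. x \<in> carr (tspace V W) \<Longrightarrow> y \<in> carr (tspace V' W') \<Longrightarrow> lin (tspace V'' W'') X (\<lambda>z. F x y
        z)"
    and "\<And>x y. x \<in> carr (tspace V W) \<Longrightarrow> y \<in> carr (tspace V' W') \<Longrightarrow> lin (tspace V'' W'') X (\<lambda>z. G x y
        z)"
    and eq: "\<And>a b a' b' a'' b''. a \<in> carr V \<Longrightarrow> b \<in> carr W \<Longrightarrow> a' \<in> carr V' \<Longrightarrow> b' \<in> carr W' \<Longrightarrow> a'' \<in> carr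
        V'' \<Longrightarrow> b'' \<in> carr W''
      \<Longrightarrow> F (tens V W a b) (tens V' W' a' b') (tens V'' W'' a'' b'')
        = G (tens V W a b) (tens V' W' a' b') (tens V'' W'' a'' b'')"
  shows "\<forall>x\<in>carr (tspace V W). \<forall>y\<in>carr (tspace V' W'). \<forall>z\<in>carr (tspace V'' W''). F x y z = G x y z"
proof (intro ballI)
  fix x y z
  assume x: "x \<in> carr (tspace V W)" and y: "y \<in> carr (tspace V' W')" and z: "z \<in> carr (tspace V''
      W'')"
  have "\<forall>x\<in>carr (tspace V W). \<forall>y\<in>carr (tspace V' W'). F x y z = G x y z"
  proof (rule tens_ballI2[OF assms(1,2)[OF _ z] assms(3,4)[OF _ z]])
    fix a b a' b' assume "a \<in> carr V" "b \<in> carr W" "a' \<in> carr V'" "b' \<in> carr W'"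
    then show "F (tens V W a b) (tens V' W' a' b') z = G (tens V W a b) (tens V' W' a' b') z"
      by (intro tens_eqI[OF assms(5,6) z] tens_in_tspace eq)
  qed
  then show "F x y z = G x y z" using x y by blast
qed


section \<open>Bialgebra axioms as identities of Sweedler sums\<close>

abbreviation sw ::
    "('k::field, 'v::ab_group_add, 'm) kbialg_scheme \<Rightarrow> 'v \<Rightarrow> ('v \<Rightarrow> 'v \<Rightarrow> 'x::ab_group_add) \<Rightarrow> 'x" where
  "sw C c \<equiv> tsum C C (comul C c)"

lemma algebra_vect: "algebra A \<Longrightarrow> vect A"
  and algebra_mul: "algebra A \<Longrightarrow> bilin A A A (mul A)"
  and algebra_unit [mem_intros]: "algebra A \<Longrightarrow> unit A \<in> carr A"
  and algebra_assoc: "algebra A \<Longrightarrow> x \<in> carr A \<Longrightarrow> y \<in> carr A \<Longrightarrow> z \<in> carr A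
     \<Longrightarrow> mul A (mul A x y) z = mul A x (mul A y z)"
  and algebra_unit_left: "algebra A \<Longrightarrow> x \<in> carr A \<Longrightarrow> mul A (unit A) x = x"
  and algebra_unit_right: "algebra A \<Longrightarrow> x \<in> carr A \<Longrightarrow> mul A x (unit A) = x"
  unfolding algebra_def by auto

lemma algebraI:
  assumes "vect A" "bilin A A A (mul A)" "unit A \<in> carr A"
    and "\<And>x y z. x \<in> carr A \<Longrightarrow> y \<in> carr A \<Longrightarrow> z \<in> carr A
     \<Longrightarrow> mul A (mul A x y) z = mul A x (mul A y z)"
    and "\<And>x. x \<in> carr A \<Longrightarrow> mul A (unit A) x = x"
    and "\<And>x. x \<in> carr A \<Longrightarrow> mul A x (unit A) = x"
  shows "algebra A"
  using assms unfolding algebra_def by blast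

lemma algebra_mul_mem [mem_intros]:
  "algebra A \<Longrightarrow> x \<in> carr A \<Longrightarrow> y \<in> carr A \<Longrightarrow> mul A x y \<in> carr A"
  by (rule bilin_mem[OF algebra_mul])

lemma lin_mul1 [lin_intros]:
  "algebra A \<Longrightarrow> lin U A f \<Longrightarrow> y \<in> carr A \<Longrightarrow> lin U A (\<lambda>u. mul A (f u) y)"
  by (rule lin_bilin1[OF algebra_mul])

lemma lin_mul2 [lin_intros]:
  "algebra A \<Longrightarrow> lin U A f \<Longrightarrow> x \<in> carr A \<Longrightarrow> lin U A (\<lambda>u. mul A x (f u))"
  by (rule lin_bilin2[OF algebra_mul])

lemma comm_algebra_algebra: "comm_algebra A \<Longrightarrow> algebra A"
  unfolding comm_algebra_def by blast

lemma comm_algebra_interchange: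
  assumes A: "comm_algebra A" and x: "a \<in> carr A" "b \<in> carr A" "c \<in> carr A" "d \<in> carr A"
  shows "mul A (mul A a b) (mul A c d) = mul A (mul A a c) (mul A b d)"
proof -
  note al = comm_algebra_algebra[OF A]
  have bc: "mul A b c = mul A c b" using A x unfolding comm_algebra_def by blast
  have "mul A (mul A a b) (mul A c d) = mul A a (mul A (mul A b c) d)"
    by (simp add: algebra_assoc[OF al] algebra_mul_mem[OF al] x)
  also have "\<dots> = mul A (mul A a c) (mul A b d)"
    unfolding bc by (simp add: algebra_assoc[OF al] algebra_mul_mem[OF al] x)
  finally show ?thesis .
qed

lemma coalgebra_vect: "coalgebra C \<Longrightarrow> vect C"
  and coalgebra_comul: "coalgebra C \<Longrightarrow> lin C (tspace C C) (comul C)"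
  and coalgebra_counit: "coalgebra C \<Longrightarrow> lin C ground (counit C)"
  unfolding coalgebra_def by auto

lemma comul_mem [mem_intros]: "coalgebra C \<Longrightarrow> c \<in> carr C \<Longrightarrow> comul C c \<in> carr (tspace C C)"
  by (rule lin_mem[OF coalgebra_comul])

lemma lin_comul [lin_intros]:
  "coalgebra C \<Longrightarrow> lin U C f \<Longrightarrow> lin U (tspace C C) (\<lambda>u. comul C (f u))"
  by (rule lin_comp[OF coalgebra_comul])

lemma lin_counit [lin_intros]: "coalgebra C \<Longrightarrow> lin U C f \<Longrightarrow> lin U ground (\<lambda>u. counit C (f u))"
  by (rule lin_comp[OF coalgebra_counit])

lemma counit_left:
  assumes "coalgebra C" "c \<in> carr C"
  shows "sw C c (\<lambda>a b. scl C (counit C a) b) = c"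
proof -
  note C = assms coalgebra_vect[OF assms(1)]
  have "sw C c (\<lambda>a b. scl C (counit C a) b)
      = tlift C C C (\<lambda>a b. scl C (counit C a) b) (comul C c)"
    by (intro tlift_eq_tsum[symmetric] C bilinI lin_intros mem_intros)
  then show ?thesis using assms unfolding coalgebra_def by simp
qed

lemma counit_right:
  assumes "coalgebra C" "c \<in> carr C"
  shows "sw C c (\<lambda>a b. scl C (counit C b) a) = c"
proof -
  note C = assms coalgebra_vect[OF assms(1)]
  have "sw C c (\<lambda>a b. scl C (counit C b) a)
      = tlift C C C (\<lambda>a b. scl C (counit C b) a) (comul C c)"
    by (intro tlift_eq_tsum[symmetric] C bilinI lin_intros mem_intros)
  then show ?thesis using assms unfolding coalgebra_def by simp
qed

text \<open>
  The inner \<open>tlift\<close> is replaced by a sum first: that it is bilinear in the outer variables, as the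
  outer \<open>tlift\<close> requires, is evident only in this form.
\<close>

lemma coassoc_tlift_eq:
  assumes "vect C" "lin C (tspace C C) (comul C)" "c \<in> carr C"
  shows "tlift C C (tspace C (tspace C C))
            (\<lambda>c1 c2. tlift C C (tspace C (tspace C C))
               (\<lambda>x y. tens C (tspace C C) x (tens C C y c2)) (comul C c1)) (comul C c)
       = sw C c (\<lambda>a b. sw C a
           (\<lambda>x y. tens C (tspace C C) x (tens C C y b)))" (is "?L = ?R")
    and "tlift C C (tspace C (tspace C C))
            (\<lambda>c1 c2. tens C (tspace C C) c1 (comul C c2)) (comul C c)
       = sw C c (\<lambda>a b. sw C b
           (\<lambda>x y. tens C (tspace C C) a (tens C C x y)))" (is "?L' = ?R'")
proof -
  let ?X = "tspace C (tspace C C)"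
  let ?F = "\<lambda>c1 c2. tlift C C ?X (\<lambda>x y. tens C (tspace C C) x (tens C C y c2)) (comul C c1)"
  let ?G = "\<lambda>c1 c2. sw C c1 (\<lambda>x y. tens C (tspace C C) x (tens C C y c2))"
  note C = assms(1,3) vect_tspace lin_mem[OF assms(2)] lin_comp[OF assms(2)]
  have FG: "?F a b = ?G a b" if "a \<in> carr C" "b \<in> carr C" for a b
    by (intro tlift_eq_tsum C that bilinI lin_intros mem_intros)
  have G: "bilin C C ?X ?G"
    by (intro bilinI lin_intros C mem_intros)
  have F: "bilin C C ?X ?F"
  proof (rule bilinI)
    show "lin C ?X (\<lambda>v. ?F v w)" if "w \<in> carr C" for w
      by (rule lin_cong[OF bilin_lin1[OF G that]]) (simp_all add: C FG that)
    show "lin C ?X (?F v)" if "v \<in> carr C" for v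
      by (rule lin_cong[OF bilin_lin2[OF G that]]) (simp_all add: C FG that)
  qed
  have "?L = sw C c ?F"
    by (rule tlift_eq_tsum) (intro C F)+
  also have "\<dots> = ?R"
    by (intro tsum_cong FG C)
  finally show "?L = ?R" .
  have "?L' = sw C c (\<lambda>c1 c2. tens C (tspace C C) c1 (comul C c2))"
    by (intro tlift_eq_tsum C bilinI lin_intros mem_intros)
  also have "\<dots> = sw C c (\<lambda>c1 c2. tens C (tspace C C) c1 (sw C c2 (tens C C)))"
    by (intro tsum_cong C arg_cong2[where f="tens C (tspace C C)"] refl tsum_tens_id[symmetric])
  also have "\<dots> = ?R'"
    by (intro tsum_cong C tsum_lin[where X="tspace C C" and Y="?X"] lin_intros mem_intros)
  finally show "?L' = ?R'" .
qed

lemma coassoc_tens: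
  assumes "coalgebra C" "c \<in> carr C"
  shows "sw C c (\<lambda>a b. sw C a
           (\<lambda>x y. tens C (tspace C C) x (tens C C y b)))
       = sw C c (\<lambda>a b. sw C b
           (\<lambda>x y. tens C (tspace C C) a (tens C C x y)))"
  using assms coassoc_tlift_eq[OF coalgebra_vect[OF assms(1)] coalgebra_comul[OF assms(1)] assms(2)]
  unfolding coalgebra_def by simp

text \<open>
  Trilinear maps factor through \<open>C \<otimes> (C \<otimes> C)\<close>, so coassociativity in the tensor product yields it
  under every trilinear expression.
\<close>

lemma coassoc:
  assumes C: "coalgebra C" "c \<in> carr C" and X: "vect X"
    and F: "\<And>y z. y \<in> carr C \<Longrightarrow> z \<in> carr C \<Longrightarrow> lin C X (\<lambda>x. F x y z)"
      "\<And>x z. x \<in> carr C \<Longrightarrow> z \<in> carr C \<Longrightarrow> lin C X (\<lambda>y. F x y z)"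
      "\<And>x y. x \<in> carr C \<Longrightarrow> y \<in> carr C \<Longrightarrow> lin C X (\<lambda>z. F x y z)"
  shows "sw C c (\<lambda>a b. sw C a (\<lambda>x y. F x y b))
       = sw C c (\<lambda>a b. sw C b (\<lambda>x y. F a x y))"
proof -
  note V = coalgebra_vect[OF C(1)]
  let ?Y = "tspace C (tspace C C)"
  let ?G = "\<lambda>x p. tsum C C p (F x)"
  let ?L = "\<lambda>t. tsum C (tspace C C) t ?G"
  have G: "bilin C (tspace C C) X ?G"
    by (intro bilinI lin_intros V X F vect_tspace)
  have L: "lin ?Y X ?L"
    by (intro lin_tsum V X vect_tspace G)
  have ev: "?L (tens C (tspace C C) x (tens C C y z)) = F x y z"
    if "x \<in> carr C" "y \<in> carr C" "z \<in> carr C" for x y z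
  proof -
    have "?L (tens C (tspace C C) x (tens C C y z)) = ?G x (tens C C y z)"
      by (intro tsum_tens[OF V vect_tspace X G] mem_intros that)
    also have "\<dots> = F x y z"
      by (intro tsum_tens[OF V V X] bilinI F that)
    finally show ?thesis .
  qed
  have "sw C c (\<lambda>a b. sw C a (\<lambda>x y. F x y b))
      = sw C c (\<lambda>a b. sw C a
           (\<lambda>x y. ?L (tens C (tspace C C) x (tens C C y b))))"
    by (intro tsum_cong V C mem_intros ev[symmetric])
  also have "\<dots> = sw C c (\<lambda>a b. ?L (sw C a
           (\<lambda>x y. tens C (tspace C C) x (tens C C y b))))"
    by (intro tsum_cong V C mem_intros tsum_lin[OF V vect_tspace _ L, symmetric] vect_tspace)
  also have "\<dots> = ?L (sw C c (\<lambda>a b. sw C a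
           (\<lambda>x y. tens C (tspace C C) x (tens C C y b))))"
    by (intro V C mem_intros tsum_lin[OF V vect_tspace _ L, symmetric] vect_tspace)
  also have "\<dots> = ?L (sw C c (\<lambda>a b. sw C b
           (\<lambda>x y. tens C (tspace C C) a (tens C C x y))))"
    by (simp only: coassoc_tens[OF C])
  also have "\<dots> = sw C c (\<lambda>a b. ?L (sw C b
           (\<lambda>x y. tens C (tspace C C) a (tens C C x y))))"
    by (intro V C mem_intros tsum_lin[OF V vect_tspace _ L] vect_tspace)
  also have "\<dots> = sw C c (\<lambda>a b. sw C b
           (\<lambda>x y. ?L (tens C (tspace C C) a (tens C C x y))))"
    by (intro tsum_cong V C mem_intros tsum_lin[OF V vect_tspace _ L] vect_tspace)
  also have "\<dots> = sw C c (\<lambda>a b. sw C b (\<lambda>x y. F a x y))"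
    by (intro tsum_cong V C mem_intros ev)
  finally show ?thesis .
qed

lemma coalgebraI:
  assumes V: "vect C" and c: "lin C (tspace C C) (comul C)" and e: "lin C ground (counit C)"
    and "\<And>c. c \<in> carr C \<Longrightarrow> sw C c (\<lambda>a b. sw C a
           (\<lambda>x y. tens C (tspace C C) x (tens C C y b)))
       = sw C c (\<lambda>a b. sw C b
           (\<lambda>x y. tens C (tspace C C) a (tens C C x y)))"
    and l: "\<And>c. c \<in> carr C \<Longrightarrow> sw C c (\<lambda>a b. scl C (counit C a) b) = c"
    and r: "\<And>c. c \<in> carr C \<Longrightarrow> sw C c (\<lambda>a b. scl C (counit C b) a) = c"
  shows "coalgebra C"
proof -
  have "tlift C C C (\<lambda>a b. scl C (counit C a) b) (comul C x) = x" if x: "x \<in> carr C" for x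
    by (intro trans[OF tlift_eq_tsum l] V bilinI lin_scl1 lin_scl2 lin_id e vect_scl lin_mem[OF c]
        x)
  moreover have "tlift C C C (\<lambda>a b. scl C (counit C b) a) (comul C x) = x" if x: "x \<in> carr C" for x
    by (intro trans[OF tlift_eq_tsum r] V bilinI lin_scl1 lin_scl2 lin_id e vect_scl lin_mem[OF c]
        x)
  ultimately show ?thesis
    unfolding coalgebra_def using assms coassoc_tlift_eq[OF V c] by simp
qed

lemma bialgebra_algebra: "bialgebra B \<Longrightarrow> algebra B"
  and bialgebra_coalgebra: "bialgebra B \<Longrightarrow> coalgebra B"
  and comul_unit: "bialgebra B \<Longrightarrow> comul B (unit B) = tens B B (unit B) (unit B)"
  and counit_mul: "bialgebra B \<Longrightarrow> x \<in> carr B \<Longrightarrow> y \<in> carr B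
    \<Longrightarrow> counit B (mul B x y) = counit B x * counit B y"
  and counit_unit: "bialgebra B \<Longrightarrow> counit B (unit B) = 1"
  unfolding bialgebra_def by auto

lemma bialgebra_vect: "bialgebra B \<Longrightarrow> vect B"
  by (rule algebra_vect[OF bialgebra_algebra])

lemma tmul_eq_tsum:
  assumes A: "algebra A" "algebra B" and xy: "x \<in> carr (tspace A B)" "y \<in> carr (tspace A B)"
  shows "tmul A B x y = tsum A B x (\<lambda>a b. tsum A B y (\<lambda>a' b'. tens A B (mul A a a') (mul B b b')))"
proof -
  note V = algebra_vect[OF A(1)] algebra_vect[OF A(2)] vect_tspace
  let ?X = "tspace A B"
  let ?F = "\<lambda>a b. tlift A B ?X (\<lambda>a' b'. tens A B (mul A a a') (mul B b b')) y"
  let ?G = "\<lambda>a b. tsum A B y (\<lambda>a' b'. tens A B (mul A a a') (mul B b b'))"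
  have FG: "?F a b = ?G a b" if "a \<in> carr A" "b \<in> carr B" for a b
    by (intro tlift_eq_tsum V that A xy bilinI lin_intros mem_intros)
  have G: "bilin A B ?X ?G"
    by (intro bilinI lin_intros V A xy mem_intros)
  have F: "bilin A B ?X ?F"
  proof (rule bilinI)
    show "lin A ?X (\<lambda>v. ?F v w)" if "w \<in> carr B" for w
      by (rule lin_cong[OF bilin_lin1[OF G that]]) (simp_all add: V FG that)
    show "lin B ?X (?F v)" if "v \<in> carr A" for v
      by (rule lin_cong[OF bilin_lin2[OF G that]]) (simp_all add: V FG that)
  qed
  have "tmul A B x y = tsum A B x ?F"
    unfolding tmul_def by (rule tlift_eq_tsum[OF V F xy(1)])
  also have "\<dots> = tsum A B x ?G"
    by (intro tsum_cong FG V xy)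
  finally show ?thesis .
qed

lemma bilin_tmul:
  assumes A: "algebra A" "algebra B"
  shows "bilin (tspace A B) (tspace A B) (tspace A B) (tmul A B)"
proof -
  note V = algebra_vect[OF A(1)] algebra_vect[OF A(2)] vect_tspace
  let ?X = "tspace A B"
  let ?G = "\<lambda>x y. tsum A B x (\<lambda>a b. tsum A B y (\<lambda>a' b'. tens A B (mul A a a') (mul B b b')))"
  show ?thesis
  proof (rule bilinI)
    show "lin ?X ?X (\<lambda>v. tmul A B v w)" if w: "w \<in> carr ?X" for w
    proof (rule lin_cong[OF _ V(3)])
      show "lin ?X ?X (\<lambda>v. ?G v w)"
        by (intro bilinI lin_intros V A w mem_intros)
    qed (simp add: tmul_eq_tsum A w)
    show "lin ?X ?X (tmul A B v)" if w: "v \<in> carr ?X" for v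
    proof (rule lin_cong[OF _ V(3)])
      show "lin ?X ?X (?G v)"
        by (intro bilinI lin_intros V A w mem_intros)
    qed (simp add: tmul_eq_tsum A w)
  qed
qed

lemma tmul_tens:
  assumes A: "algebra A" "algebra B" and m: "a \<in> carr A" "a' \<in> carr A" "b \<in> carr B" "b' \<in> carr B"
  shows "tmul A B (tens A B a b) (tens A B a' b') = tens A B (mul A a a') (mul B b b')"
proof -
  note V = algebra_vect[OF A(1)] algebra_vect[OF A(2)] vect_tspace
  have "tmul A B (tens A B a b) (tens A B a' b')
      = tsum A B (tens A B a b) (\<lambda>a b. tsum A B (tens A B a' b') (\<lambda>a' b'. tens A B (mul A a a') (mul
          B b b')))"
    by (intro tmul_eq_tsum A m mem_intros)
  also have "\<dots> = tsum A B (tens A B a' b') (\<lambda>a' b'. tens A B (mul A a a') (mul B b b'))"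
    by (intro tsum_tens[where X="tspace A B"] bilinI lin_intros V A m mem_intros)
  also have "\<dots> = tens A B (mul A a a') (mul B b b')"
    by (intro tsum_tens[where X="tspace A B"] bilinI lin_intros V A m mem_intros)
  finally show ?thesis .
qed

lemma comul_mul:
  assumes B: "bialgebra B" and xy: "x \<in> carr B" "y \<in> carr B"
  shows "comul B (mul B x y) = sw B x (\<lambda>x1 x2. sw B y (\<lambda>y1 y2.
     tens B B (mul B x1 y1) (mul B x2 y2)))"
proof -
  note C = bialgebra_algebra[OF B] bialgebra_coalgebra[OF B]
  have "comul B (mul B x y) = tmul B B (comul B x) (comul B y)"
    using assms unfolding bialgebra_def by blast
  also have "\<dots> = sw B x (\<lambda>x1 x2. sw B y (\<lambda>y1 y2.
     tens B B (mul B x1 y1) (mul B x2 y2)))"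
    by (intro tmul_eq_tsum C mem_intros xy)
  finally show ?thesis .
qed

text \<open>
  A Sweedler sum over a tensor that is itself given as a sum of pure tensors is evaluated on these
  pure tensors. The version with two nested sums fits the comultiplication of a product and that
  of a pure tensor in \<open>B \<otimes> C\<close>.
\<close>

lemma tsum_tsum_tens:
  assumes V: "vect V" "vect W" "vect V'" "vect W'" "vect X" and x: "x \<in> carr (tspace V W)"
    and F: "bilin V' W' X F"
    and fg: "\<And>v w. v \<in> carr V \<Longrightarrow> w \<in> carr W \<Longrightarrow> f v w \<in> carr V'"
     "\<And>v w. v \<in> carr V \<Longrightarrow> w \<in> carr W \<Longrightarrow> g v w \<in> carr W'"
  shows "tsum V' W' (tsum V W x (\<lambda>v w. tens V' W' (f v w) (g v w))) F
    = tsum V W x (\<lambda>v w. F (f v w) (g v w))"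
proof -
  have "tsum V' W' (tsum V W x (\<lambda>v w. tens V' W' (f v w) (g v w))) F
      = tsum V W x (\<lambda>v w. tsum V' W' (tens V' W' (f v w) (g v w)) F)"
    by (intro tsum_tsum[where X=X] V x F mem_intros fg)
  also have "\<dots> = tsum V W x (\<lambda>v w. F (f v w) (g v w))"
    by (intro tsum_cong V x F tsum_tens[where X=X] fg)
  finally show ?thesis .
qed

lemma tsum_tsum_tens2:
  assumes V: "vect V" "vect W" "vect V1" "vect W1" "vect V'" "vect W'" "vect X"
    and xy: "x \<in> carr (tspace V W)" "y \<in> carr (tspace V1 W1)"
    and F: "bilin V' W' X F"
    and fg: "\<And>v w v1 w1. v \<in> carr V \<Longrightarrow> w \<in> carr W \<Longrightarrow> v1 \<in> carr V1 \<Longrightarrow> w1 \<in> carr W1 \<Longrightarrow> f v w v1 w1 \<in> carr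
        V'"
     "\<And>v w v1 w1. v \<in> carr V \<Longrightarrow> w \<in> carr W \<Longrightarrow> v1 \<in> carr V1 \<Longrightarrow> w1 \<in> carr W1 \<Longrightarrow> g v w v1 w1 \<in> carr W'"
  shows "tsum V' W' (tsum V W x (\<lambda>v w. tsum V1 W1 y (\<lambda>v1 w1. tens V' W' (f v w v1 w1) (g v w v1
      w1)))) F
    = tsum V W x (\<lambda>v w. tsum V1 W1 y (\<lambda>v1 w1. F (f v w v1 w1) (g v w v1 w1)))"
proof -
  have "tsum V' W' (tsum V W x (\<lambda>v w. tsum V1 W1 y (\<lambda>v1 w1. tens V' W' (f v w v1 w1) (g v w v1
      w1)))) F
      = tsum V W x (\<lambda>v w. tsum V' W' (tsum V1 W1 y (\<lambda>v1 w1. tens V' W' (f v w v1 w1) (g v w v1 w1)))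
          F)"
    by (intro tsum_tsum[where X=X] V xy F mem_intros fg vect_tspace)
  also have "\<dots> = tsum V W x (\<lambda>v w. tsum V1 W1 y (\<lambda>v1 w1. F (f v w v1 w1) (g v w v1 w1)))"
    by (intro tsum_cong tsum_tsum_tens[where X=X] V xy F fg)
  finally show ?thesis .
qed

lemma tsum_comul_mul:
  assumes B: "bialgebra B" and xy: "x \<in> carr B" "y \<in> carr B" and X: "vect X" and F: "bilin B B X F"
  shows "sw B (mul B x y) F = sw B x (\<lambda>x1 x2. sw B y
    (\<lambda>y1 y2. F (mul B x1 y1) (mul B x2 y2)))"
proof -
  note C = bialgebra_algebra[OF B] bialgebra_coalgebra[OF B] bialgebra_vect[OF B]
  show ?thesis unfolding comul_mul[OF B xy]
    by (intro tsum_tsum_tens2[where X=X] C X F mem_intros xy)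
qed

lemma tsum_comul_unit:
  assumes B: "bialgebra B" and X: "vect X" and F: "bilin B B X F"
  shows "sw B (unit B) F = F (unit B) (unit B)"
proof -
  note C = bialgebra_algebra[OF B] bialgebra_coalgebra[OF B] bialgebra_vect[OF B]
  show ?thesis unfolding comul_unit[OF B]
    by (intro tsum_tens[where X=X] C X F mem_intros)
qed

lemma bialgebraI:
  assumes "algebra B" "coalgebra B"
    and "\<And>x y. x \<in> carr B \<Longrightarrow> y \<in> carr B \<Longrightarrow> comul B (mul B x y)
      = sw B x (\<lambda>x1 x2. sw B y (\<lambda>y1 y2. tens B B (mul B x1 y1) (mul B x2 y2)))"
    and "comul B (unit B) = tens B B (unit B) (unit B)"
    and "\<And>x y. x \<in> carr B \<Longrightarrow> y \<in> carr B \<Longrightarrow> counit B (mul B x y) = counit B x * counit B y"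
    and "counit B (unit B) = 1"
  shows "bialgebra B"
  using assms tmul_eq_tsum[OF assms(1) assms(1)] comul_mem[OF assms(2)] unfolding bialgebra_def by
      simp

lemma tlift_flip:
  assumes "coalgebra C" "c \<in> carr C"
  shows "tlift C C (tspace C C) (\<lambda>c1 c2. tens C C c2 c1) (comul C c)
    = sw C c (\<lambda>a b. tens C C b a)"
  by (intro tlift_eq_tsum assms coalgebra_vect[OF assms(1)] vect_tspace mem_intros bilinI
      lin_intros)

lemma cocommutative_tens:
  assumes "coalgebra C"
  shows "cocommutative C \<longleftrightarrow> (\<forall>c\<in>carr C. sw C c (\<lambda>a b. tens C C b a) = comul C c)"
  unfolding cocommutative_def using tlift_flip[OF assms] by simp

lemma tsum_cocommutative:
  assumes C: "coalgebra C" and co: "cocommutative C" and c: "c \<in> carr C" and X: "vect X" and F: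
      "bilin C C X F"
  shows "sw C c (\<lambda>a b. F b a) = sw C c F"
proof -
  have "sw C c F = tsum C C (sw C c (\<lambda>a b. tens C C b a)) F"
    using co c unfolding cocommutative_tens[OF C] by simp
  also have "\<dots> = sw C c (\<lambda>a b. F b a)"
    by (intro tsum_tsum_tens[where X=X] coalgebra_vect[OF C] X F mem_intros C c)
  finally show ?thesis ..
qed


section \<open>The tensor product of two bialgebras\<close>

lemma carr_tensor_bialg: "carr (tensor_bialg B C) = carr (tspace B C)"
  and scl_tensor_bialg: "scl (tensor_bialg B C) = scl (tspace B C)"
  and mul_tensor_bialg: "mul (tensor_bialg B C) = tmul B C"
  and unit_tensor_bialg: "unit (tensor_bialg B C) = tens B C (unit B) (unit C)"
  by (simp_all add: tensor_bialg_def)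

lemma tens_tensor_bialg:
  "tens (tensor_bialg B C) W = tens (tspace B C) W"
  "tens V (tensor_bialg B C) = tens V (tspace B C)"
  by (intro tens_scl_cong refl scl_tensor_bialg)+

lemma tspace_tensor_bialg:
  "tspace (tensor_bialg B C) W = tspace (tspace B C) W"
  "tspace V (tensor_bialg B C) = tspace V (tspace B C)"
  by (intro tspace_cong refl scl_tensor_bialg carr_tensor_bialg)+

lemma tsum_tensor_bialg:
  "tsum (tensor_bialg B C) W = tsum (tspace B C) W"
  "tsum V (tensor_bialg B C) = tsum V (tspace B C)"
  by (intro tsum_carr_cong refl scl_tensor_bialg carr_tensor_bialg)+

lemma lin_tensor_bialg:
  "lin (tensor_bialg B C) W = lin (tspace B C) W"
  "lin V (tensor_bialg B C) = lin V (tspace B C)"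
  by (intro lin_carr_cong refl scl_tensor_bialg carr_tensor_bialg)+

lemma bilin_tensor_bialg:
  "bilin (tensor_bialg B C) W X = bilin (tspace B C) W X"
  "bilin V (tensor_bialg B C) X = bilin V (tspace B C) X"
  "bilin V W (tensor_bialg B C) = bilin V W (tspace B C)"
  unfolding bilin_def by (simp_all add: lin_tensor_bialg carr_tensor_bialg fun_eq_iff)

lemma vect_tensor_bialg: "vect (tensor_bialg B C)"
  using vect_tspace[of B C] unfolding vect_def by (simp add: carr_tensor_bialg scl_tensor_bialg)

text \<open>
  These equations replace \<open>tensor_bialg B C\<close> by \<open>tspace B C\<close> wherever only the vector space
  matters; the calculations use the latter form.
\<close>

lemmas tensor_bialg_simps = carr_tensor_bialg scl_tensor_bialg mul_tensor_bialg unit_tensor_bialg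
  tens_tensor_bialg tspace_tensor_bialg tsum_tensor_bialg lin_tensor_bialg bilin_tensor_bialg

lemma algebra_tensor:
  assumes A: "algebra A" and B: "algebra B"
  shows "algebra (tensor_bialg A B)"
proof (rule algebraI; (unfold tensor_bialg_simps)?)
  note V = algebra_vect[OF A] algebra_vect[OF B] vect_tspace
  note t = bilin_tmul[OF A B]
  note m = bilin_mem[OF t] lin_bilin1[OF t] lin_bilin2[OF t]
  show "vect (tensor_bialg A B)" by (rule vect_tensor_bialg)
  show "bilin (tspace A B) (tspace A B) (tspace A B) (tmul A B)" by (rule t)
  show "tens A B (unit A) (unit B) \<in> carr (tspace A B)" by (intro mem_intros A B)
  have "\<forall>x\<in>carr (tspace A B). \<forall>y\<in>carr (tspace A B). \<forall>z\<in>carr (tspace A B).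
      tmul A B (tmul A B x y) z = tmul A B x (tmul A B y z)"
    by (rule tens_ballI3[where X="tspace A B"])
      (intro m lin_intros | simp add: tmul_tens A B algebra_mul_mem algebra_assoc)+
  then show "tmul A B (tmul A B x y) z = tmul A B x (tmul A B y z)"
    if "x \<in> carr (tspace A B)" "y \<in> carr (tspace A B)" "z \<in> carr (tspace A B)" for x y z
    using that by blast
  show "tmul A B (tens A B (unit A) (unit B)) x = x" if x: "x \<in> carr (tspace A B)" for x
    by (rule tens_eqI[OF _ _ x, where X="tspace A B"])
      (intro m lin_intros mem_intros A B | simp add: tmul_tens A B algebra_unit algebra_unit_left)+
  show "tmul A B x (tens A B (unit A) (unit B)) = x" if x: "x \<in> carr (tspace A B)" for x
    by (rule tens_eqI[OF _ _ x, where X="tspace A B"])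
      (intro m lin_intros mem_intros A B | simp add: tmul_tens A B algebra_unit algebra_unit_right)+
qed

lemma comul_tensor_bilin:
  assumes B: "coalgebra B" and C: "coalgebra C"
  defines "X \<equiv> tspace (tspace B C) (tspace B C)"
  shows "lin (tspace B C) X (comul (tensor_bialg B C))"
    and "b \<in> carr B \<Longrightarrow> c \<in> carr C \<Longrightarrow> comul (tensor_bialg B C) (tens B C b c)
      = sw B b (\<lambda>b1 b2. sw C c (\<lambda>c1 c2.
          tens (tspace B C) (tspace B C) (tens B C b1 c1) (tens B C b2 c2)))"
proof -
  note V = coalgebra_vect[OF B] coalgebra_vect[OF C] vect_tspace
  let ?t = "\<lambda>b1 b2 c1 c2. tens (tspace B C) (tspace B C) (tens B C b1 c1) (tens B C b2 c2)"
  let ?Fc = "\<lambda>c b1 b2. tlift C C X (?t b1 b2) (comul C c)"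
  let ?Gc = "\<lambda>c b1 b2. sw C c (?t b1 b2)"
  let ?F = "\<lambda>b c. tlift B B X (?Fc c) (comul B b)"
  let ?G = "\<lambda>b c. sw B b (?Gc c)"
  have VX: "vect X" unfolding X_def by (rule vect_tspace)
  have F0: "?Fc c b1 b2 = ?Gc c b1 b2" if "c \<in> carr C" "b1 \<in> carr B" "b2 \<in> carr B" for b1 b2 c
    unfolding X_def by (intro tlift_eq_tsum V that bilinI lin_intros mem_intros C)
  have G0: "bilin B B X (?Gc c)" if "c \<in> carr C" for c
    unfolding X_def by (intro bilinI lin_intros V that mem_intros C)
  have F0b: "bilin B B X (?Fc c)" if c: "c \<in> carr C" for c
  proof (rule bilinI)
    show "lin B X (\<lambda>v. ?Fc c v w)" if "w \<in> carr B" for w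
      by (rule lin_cong[OF bilin_lin1[OF G0[OF c] that]]) (simp_all add: V F0 that c)
    show "lin B X (?Fc c v)" if "v \<in> carr B" for v
      by (rule lin_cong[OF bilin_lin2[OF G0[OF c] that]]) (simp_all add: V F0 that c)
  qed
  have FG: "?F b c = ?G b c" if bc: "b \<in> carr B" "c \<in> carr C" for b c
  proof -
    have "?F b c = sw B b (?Fc c)"
      by (intro tlift_eq_tsum V VX F0b bc mem_intros B)
    also have "\<dots> = ?G b c"
      by (intro tsum_cong F0 V bc mem_intros B)
    finally show ?thesis .
  qed
  have G: "bilin B C X ?G"
    unfolding X_def by (intro bilinI lin_intros V mem_intros B C)
  have F: "bilin B C X ?F"
  proof (rule bilinI)
    show "lin B X (\<lambda>v. ?F v w)" if "w \<in> carr C" for w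
      by (rule lin_cong[OF bilin_lin1[OF G that]]) (simp_all add: V FG that)
    show "lin C X (?F v)" if "v \<in> carr B" for v
      by (rule lin_cong[OF bilin_lin2[OF G that]]) (simp_all add: V FG that)
  qed
  have eq: "comul (tensor_bialg B C) = tlift B C X ?F"
    unfolding tensor_bialg_def X_def by simp
  show "lin (tspace B C) X (comul (tensor_bialg B C))"
    unfolding eq by (rule tlift(1)[OF V(1,2) VX F])
  show "comul (tensor_bialg B C) (tens B C b c) = ?G b c" if "b \<in> carr B" "c \<in> carr C"
    unfolding eq tlift(2)[OF V(1,2) VX F that] by (rule FG[OF that])
qed

lemma tsum_comul_tensor:
  assumes B: "coalgebra B" and C: "coalgebra C" and bc: "b \<in> carr B" "c \<in> carr C"
    and X: "vect X" and F: "bilin (tspace B C) (tspace B C) X F"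
  shows "tsum (tspace B C) (tspace B C) (comul (tensor_bialg B C) (tens B C b c)) F
    = sw B b (\<lambda>b1 b2. sw C c (\<lambda>c1 c2. F (tens B C b1 c1) (tens B C b2 c2)))"
  unfolding comul_tensor_bilin(2)[OF B C bc]
  by (intro tsum_tsum_tens2[where X=X] coalgebra_vect[OF B] coalgebra_vect[OF C] X F vect_tspace
      mem_intros B C bc)

lemma counit_tensor:
  assumes B: "coalgebra B" and C: "coalgebra C"
  shows "lin (tspace B C) ground (counit (tensor_bialg B C))"
    and "b \<in> carr B \<Longrightarrow> c \<in> carr C \<Longrightarrow> counit (tensor_bialg B C) (tens B C b c) = counit B b * counit C
        c"
proof -
  note V = coalgebra_vect[OF B] coalgebra_vect[OF C] vect_tspace vect_ground
  have eq: "counit (tensor_bialg B C) = tlift B C ground (\<lambda>b c. counit B b * counit C c)"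
    unfolding tensor_bialg_def by simp
  have b: "bilin B C ground (\<lambda>b c. counit B b * counit C c)"
    by (intro bilinI lin_intros B C)
  show "lin (tspace B C) ground (counit (tensor_bialg B C))"
    unfolding eq by (rule tlift(1)[OF V(1,2,4) b])
  show "counit (tensor_bialg B C) (tens B C b c) = counit B b * counit C c" if "b \<in> carr B" "c \<in>
      carr C"
    unfolding eq by (rule tlift(2)[OF V(1,2,4) b that])
qed

lemma tens_scl_scl: "vect V \<Longrightarrow> vect W \<Longrightarrow> v \<in> carr V \<Longrightarrow> w \<in> carr W \<Longrightarrow>
    tens V W (scl V a v) (scl W b w) = scl (tspace V W) (a * b) (tens V W v w)"
  by (simp add: lin_scl[OF bilin_lin1[OF bilin_tens]] lin_scl[OF bilin_lin2[OF bilin_tens]]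
      vect_scl vect_scl_scl[OF vect_tspace] mult.commute)

lemma tsum_tens_tens:
  assumes V: "vect V" "vect W" "vect V'" "vect W'" "vect X" "vect Y"
    and xy: "x \<in> carr (tspace V W)" "y \<in> carr (tspace V' W')"
    and fg: "\<And>v w. v \<in> carr V \<Longrightarrow> w \<in> carr W \<Longrightarrow> f v w \<in> carr X"
      "\<And>v w. v \<in> carr V' \<Longrightarrow> w \<in> carr W' \<Longrightarrow> g v w \<in> carr Y"
  shows "tsum V W x (\<lambda>v w. tsum V' W' y (\<lambda>v' w'. tens X Y (f v w) (g v' w')))
    = tens X Y (tsum V W x f) (tsum V' W' y g)"
proof -
  have "tens X Y (tsum V W x f) (tsum V' W' y g) = tsum V W x (\<lambda>v w. tens X Y (f v w) (tsum V' W' y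
      g))"
    by (intro tsum_lin[where X=X and Y="tspace X Y" and L="\<lambda>z. tens X Y z _"] V xy fg lin_intros
        mem_intros)
  also have "\<dots> = tsum V W x (\<lambda>v w. tsum V' W' y (\<lambda>v' w'. tens X Y (f v w) (g v' w')))"
    by (intro tsum_cong tsum_lin[where X=Y and Y="tspace X Y"] V xy fg lin_intros mem_intros)
  finally show ?thesis ..
qed

text \<open>
  Coassociativity is checked on pure tensors \<open>b \<otimes> c\<close>. After the sums belonging to \<open>b\<close> have been
  separated from those belonging to \<open>c\<close>, it is coassociativity in \<open>C\<close> followed by coassociativity
  in \<open>B\<close>.
\<close>

lemma coalgebra_tensor:
  assumes B: "coalgebra B" and C: "coalgebra C"
  shows "coalgebra (tensor_bialg B C)"
proof (rule coalgebraI; (unfold tensor_bialg_simps)?)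
  let ?W = "tspace B C" and ?P = "tensor_bialg B C"
  let ?X = "tspace ?W (tspace ?W ?W)"
  note V = coalgebra_vect[OF B] coalgebra_vect[OF C] vect_tspace
  note d = comul_tensor_bilin(1)[OF B C] and e = counit_tensor(1)[OF B C]
  note m = lin_comp[OF d] lin_mem[OF d] lin_comp[OF e] d
  note T = tsum_comul_tensor[OF B C, where X="?X"] and Tw = tsum_comul_tensor[OF B C, where X="?W"]
  show "vect ?P" by (rule vect_tensor_bialg)
  show "lin ?W (tspace ?W ?W) (comul ?P)" by (rule d)
  show "lin ?W ground (counit ?P)" by (rule e)
  have "\<forall>x\<in>carr ?W. tsum ?W ?W (comul ?P x) (\<lambda>a b. tsum ?W ?W (comul ?P a)
           (\<lambda>u v. tens ?W (tspace ?W ?W) u (tens ?W ?W v b)))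
       = tsum ?W ?W (comul ?P x) (\<lambda>a b. tsum ?W ?W (comul ?P b)
           (\<lambda>u v. tens ?W (tspace ?W ?W) a (tens ?W ?W u v)))"
  proof (rule tens_ballI[where X="?X"])
    fix b c assume bc: "b \<in> carr B" "c \<in> carr C"
    let ?t = "\<lambda>b1 c1 b2 c2 b3 c3. tens ?W (tspace ?W ?W) (tens B C b1 c1) (tens ?W ?W (tens B C b2
        c2) (tens B C b3 c3))"
    have "tsum ?W ?W (comul ?P (tens B C b c)) (\<lambda>a b. tsum ?W ?W (comul ?P a)
           (\<lambda>u v. tens ?W (tspace ?W ?W) u (tens ?W ?W v b)))
      = sw B b (\<lambda>b1 b2. sw C c (\<lambda>c1 c2.
         tsum ?W ?W (comul ?P (tens B C b1 c1)) (\<lambda>u v. tens ?W (tspace ?W ?W) u (tens ?W ?W v (tens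
             B C b2 c2)))))"
      by (intro T bc bilinI lin_intros m mem_intros V)
    also have "\<dots> = sw B b (\<lambda>b1 b2. sw C c (\<lambda>c1 c2.
         sw B b1 (\<lambda>x1 x2. sw C c1 (\<lambda>y1 y2. ?t x1 y1 x2 y2 b2 c2))))"
      by (intro tsum_cong V T bc mem_intros B C bilinI lin_intros)
    also have "\<dots> = sw B b (\<lambda>b1 b2. sw B b1 (\<lambda>x1 x2.
         sw C c (\<lambda>c1 c2. sw C c1 (\<lambda>y1 y2. ?t x1 y1 x2 y2 b2 c2))))"
      by (intro tsum_cong V bc mem_intros B C tsum_swap)
    also have "\<dots> = sw B b (\<lambda>b1 b2. sw B b1 (\<lambda>x1 x2.
         sw C c (\<lambda>c1 c2. sw C c2 (\<lambda>y1 y2. ?t x1 c1 x2 y1 b2 y2))))"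
      by (intro tsum_cong V bc mem_intros B C coassoc[where X="?X"] lin_intros)
    also have "\<dots> = sw B b (\<lambda>b1 b2. sw B b2 (\<lambda>x1 x2.
         sw C c (\<lambda>c1 c2. sw C c2 (\<lambda>y1 y2. ?t b1 c1 x1 y1 x2 y2))))"
      by (intro coassoc[where X="?X"] V bc mem_intros B C lin_intros)
    also have "\<dots> = sw B b (\<lambda>b1 b2. sw C c (\<lambda>c1 c2.
         sw B b2 (\<lambda>x1 x2. sw C c2 (\<lambda>y1 y2. ?t b1 c1 x1 y1 x2 y2))))"
      by (intro tsum_cong V bc mem_intros B C tsum_swap)
    also have "\<dots> = sw B b (\<lambda>b1 b2. sw C c (\<lambda>c1 c2.
         tsum ?W ?W (comul ?P (tens B C b2 c2)) (\<lambda>u v. tens ?W (tspace ?W ?W) (tens B C b1 c1) (tens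
             ?W ?W u v))))"
      by (intro tsum_cong V T[symmetric] bc mem_intros B C bilinI lin_intros)
    also have "\<dots> = tsum ?W ?W (comul ?P (tens B C b c)) (\<lambda>a b. tsum ?W ?W (comul ?P b)
           (\<lambda>u v. tens ?W (tspace ?W ?W) a (tens ?W ?W u v)))"
      by (intro T[symmetric] bc bilinI lin_intros m mem_intros V)
    finally show "tsum ?W ?W (comul ?P (tens B C b c)) (\<lambda>a b. tsum ?W ?W (comul ?P a)
           (\<lambda>u v. tens ?W (tspace ?W ?W) u (tens ?W ?W v b))) = \<dots>" .
  qed (intro lin_intros m V bilinI mem_intros | assumption)+
  then show "tsum ?W ?W (comul ?P x) (\<lambda>a b. tsum ?W ?W (comul ?P a)
           (\<lambda>u v. tens ?W (tspace ?W ?W) u (tens ?W ?W v b)))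
       = tsum ?W ?W (comul ?P x) (\<lambda>a b. tsum ?W ?W (comul ?P b)
           (\<lambda>u v. tens ?W (tspace ?W ?W) a (tens ?W ?W u v)))" if "x \<in> carr ?W" for x
    using that by blast
  note pull = tsum_tens_tens[OF V(1,1,2,2,1,2)]
  note eps = counit_tensor(2)[OF B C]
  have "\<forall>x\<in>carr ?W. tsum ?W ?W (comul ?P x) (\<lambda>a b. scl ?W (counit ?P a) b) = x"
  proof (rule tens_ballI[where X="?W"])
    fix b c assume bc: "b \<in> carr B" "c \<in> carr C"
    have "tsum ?W ?W (comul ?P (tens B C b c)) (\<lambda>a b. scl ?W (counit ?P a) b)
      = sw B b (\<lambda>b1 b2. sw C c (\<lambda>c1 c2.
         scl ?W (counit ?P (tens B C b1 c1)) (tens B C b2 c2)))"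
      by (intro Tw bc bilinI lin_intros m mem_intros V)
    also have "\<dots> = sw B b (\<lambda>b1 b2. sw C c (\<lambda>c1 c2.
         tens B C (scl B (counit B b1) b2) (scl C (counit C c1) c2)))"
      by (intro tsum_cong V bc mem_intros B C) (simp add: eps tens_scl_scl V)
    also have "\<dots> = tens B C b c"
      by (subst pull[OF comul_mem[OF B bc(1)] comul_mem[OF C bc(2)]]) (intro mem_intros V | simp
          add: counit_left[OF B] counit_left[OF C] bc)+
    finally show "tsum ?W ?W (comul ?P (tens B C b c)) (\<lambda>a b. scl ?W (counit ?P a) b) = tens B C b
        c" .
  qed (intro lin_intros m V bilinI mem_intros | assumption)+
  then show "tsum ?W ?W (comul ?P x) (\<lambda>a b. scl ?W (counit ?P a) b) = x" if "x \<in> carr ?W" for x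
    using that by blast
  have "\<forall>x\<in>carr ?W. tsum ?W ?W (comul ?P x) (\<lambda>a b. scl ?W (counit ?P b) a) = x"
  proof (rule tens_ballI[where X="?W"])
    fix b c assume bc: "b \<in> carr B" "c \<in> carr C"
    have "tsum ?W ?W (comul ?P (tens B C b c)) (\<lambda>a b. scl ?W (counit ?P b) a)
      = sw B b (\<lambda>b1 b2. sw C c (\<lambda>c1 c2.
         scl ?W (counit ?P (tens B C b2 c2)) (tens B C b1 c1)))"
      by (intro Tw bc bilinI lin_intros m mem_intros V)
    also have "\<dots> = sw B b (\<lambda>b1 b2. sw C c (\<lambda>c1 c2.
         tens B C (scl B (counit B b2) b1) (scl C (counit C c2) c1)))"
      by (intro tsum_cong V bc mem_intros B C) (simp add: eps tens_scl_scl V)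
    also have "\<dots> = tens B C b c"
      by (subst pull[OF comul_mem[OF B bc(1)] comul_mem[OF C bc(2)]]) (intro mem_intros V | simp
          add: counit_right[OF B] counit_right[OF C] bc)+
    finally show "tsum ?W ?W (comul ?P (tens B C b c)) (\<lambda>a b. scl ?W (counit ?P b) a) = tens B C b
        c" .
  qed (intro lin_intros m V bilinI mem_intros | assumption)+
  then show "tsum ?W ?W (comul ?P x) (\<lambda>a b. scl ?W (counit ?P b) a) = x" if "x \<in> carr ?W" for x
    using that by blast
qed

lemma bialgebra_tensor:
  assumes B: "bialgebra B" and C: "bialgebra C"
  shows "bialgebra (tensor_bialg B C)"
proof (rule bialgebraI; (unfold tensor_bialg_simps)?)
  let ?W = "tspace B C" and ?P = "tensor_bialg B C"
  let ?X = "tspace ?W ?W"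
  note S = bialgebra_algebra[OF B] bialgebra_algebra[OF C] bialgebra_coalgebra[OF B]
      bialgebra_coalgebra[OF C]
  note V = bialgebra_vect[OF B] bialgebra_vect[OF C] vect_tspace
  note d = comul_tensor_bilin(1)[OF S(3,4)] and e = counit_tensor(1)[OF S(3,4)]
  note t = bilin_tmul[OF S(1,2)]
  note m = lin_comp[OF d] lin_mem[OF d] lin_comp[OF e] d e bilin_mem[OF t] lin_bilin1[OF t]
      lin_bilin2[OF t]
  note T = tsum_comul_tensor[OF S(3,4), where X="?X"]
  show "algebra ?P" by (rule algebra_tensor[OF S(1,2)])
  show "coalgebra ?P" by (rule coalgebra_tensor[OF S(3,4)])
  have "\<forall>x\<in>carr ?W. \<forall>y\<in>carr ?W. comul ?P (tmul B C x y) = tsum ?W ?W (comul ?P x) (\<lambda>x1 x2. tsum ?W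
      ?W (comul ?P y)
      (\<lambda>y1 y2. tens ?W ?W (tmul B C x1 y1) (tmul B C x2 y2)))"
  proof (rule tens_ballI2[where X="?X"])
    fix b c b' c' assume bc: "b \<in> carr B" "c \<in> carr C" "b' \<in> carr B" "c' \<in> carr C"
    let ?t = "\<lambda>b1 c1 b2 c2. tens ?W ?W (tens B C b1 c1) (tens B C b2 c2)"
    have "comul ?P (tmul B C (tens B C b c) (tens B C b' c')) = comul ?P (tens B C (mul B b b') (mul
        C c c'))"
      by (simp add: tmul_tens S bc)
    also have "\<dots> = sw B (mul B b b') (\<lambda>b1 b2. sw C (mul C c c') (\<lambda>c1 c2. ?t b1 c1 b2 c2))"
      by (intro comul_tensor_bilin(2) S mem_intros bc)
    also have "\<dots> = sw B b (\<lambda>b1 b2. sw B b' (\<lambda>b1' b2'.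
        sw C (mul C c c') (\<lambda>c1 c2. ?t (mul B b1 b1') c1 (mul B b2 b2') c2)))"
      by (intro tsum_comul_mul[where X="?X"] B V bc bilinI lin_intros mem_intros S)
    also have "\<dots> = sw B b (\<lambda>b1 b2. sw B b' (\<lambda>b1' b2'.
        sw C c (\<lambda>c1 c2. sw C c' (\<lambda>c1' c2'.
          ?t (mul B b1 b1') (mul C c1 c1') (mul B b2 b2') (mul C c2 c2')))))"
      by (intro tsum_cong tsum_comul_mul[where X="?X"] C V bc bilinI lin_intros mem_intros S)
    also have "\<dots> = sw B b (\<lambda>b1 b2. sw C c (\<lambda>c1 c2. sw B b' (\<lambda>b1' b2'.
        sw C c' (\<lambda>c1' c2'.
          ?t (mul B b1 b1') (mul C c1 c1') (mul B b2 b2') (mul C c2 c2')))))"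
      by (intro tsum_cong V bc mem_intros S tsum_swap)
    also have "\<dots> = sw B b (\<lambda>b1 b2. sw C c (\<lambda>c1 c2. sw B b' (\<lambda>b1' b2'.
        sw C c' (\<lambda>c1' c2'.
          tens ?W ?W (tmul B C (tens B C b1 c1) (tens B C b1' c1')) (tmul B C (tens B C b2 c2) (tens
              B C b2' c2'))))))"
      by (intro tsum_cong V bc mem_intros S) (simp add: tmul_tens S)
    also have "\<dots> = sw B b (\<lambda>b1 b2. sw C c (\<lambda>c1 c2.
        tsum ?W ?W (comul ?P (tens B C b' c')) (\<lambda>y1 y2.
          tens ?W ?W (tmul B C (tens B C b1 c1) y1) (tmul B C (tens B C b2 c2) y2))))"
      by (intro tsum_cong V bc mem_intros S T[symmetric] bilinI lin_intros m)
    also have "\<dots> = tsum ?W ?W (comul ?P (tens B C b c)) (\<lambda>x1 x2.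
        tsum ?W ?W (comul ?P (tens B C b' c')) (\<lambda>y1 y2. tens ?W ?W (tmul B C x1 y1) (tmul B C x2
            y2)))"
      by (intro V bc mem_intros S T[symmetric] bilinI lin_intros m)
    finally show "comul ?P (tmul B C (tens B C b c) (tens B C b' c')) = \<dots>" .
  qed (intro lin_intros m V bilinI mem_intros | assumption)+
  then show "comul ?P (tmul B C x y) = tsum ?W ?W (comul ?P x) (\<lambda>x1 x2. tsum ?W ?W (comul ?P y)
      (\<lambda>y1 y2. tens ?W ?W (tmul B C x1 y1) (tmul B C x2 y2)))" if "x \<in> carr ?W" "y \<in> carr ?W" for x
          y
    using that by blast
  show "comul ?P (tens B C (unit B) (unit C)) = tens ?W ?W (tens B C (unit B) (unit C)) (tens B C
      (unit B) (unit C))"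
  proof -
    have "comul ?P (tens B C (unit B) (unit C)) = sw B (unit B) (\<lambda>b1 b2. sw C (unit C) (\<lambda>c1 c2.
        tens ?W ?W (tens B C b1 c1) (tens B C b2 c2)))"
      by (intro comul_tensor_bilin(2) S mem_intros)
    also have "\<dots> = sw C (unit C) (\<lambda>c1 c2. tens ?W ?W (tens B C (unit B) c1) (tens B C (unit B) c2))"
      by (intro tsum_comul_unit[where X="?X"] V B bilinI lin_intros mem_intros S)
    also have "\<dots> = tens ?W ?W (tens B C (unit B) (unit C)) (tens B C (unit B) (unit C))"
      by (intro tsum_comul_unit[where X="?X"] V C bilinI lin_intros mem_intros S)
    finally show ?thesis .
  qed
  have "\<forall>x\<in>carr ?W. \<forall>y\<in>carr ?W. counit ?P (tmul B C x y) = counit ?P x * counit ?P y"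
  proof (rule tens_ballI2[where X="ground"])
    fix b c b' c' assume bc: "b \<in> carr B" "c \<in> carr C" "b' \<in> carr B" "c' \<in> carr C"
    show "counit ?P (tmul B C (tens B C b c) (tens B C b' c')) = counit ?P (tens B C b c) * counit
        ?P (tens B C b' c')"
      by (simp add: tmul_tens S bc counit_tensor(2) algebra_mul_mem counit_mul B C)
  qed (intro lin_intros m V bilinI mem_intros | assumption)+
  then show "counit ?P (tmul B C x y) = counit ?P x * counit ?P y" if "x \<in> carr ?W" "y \<in> carr ?W"
      for x y
    using that by blast
  show "counit ?P (tens B C (unit B) (unit C)) = 1"
    by (simp add: counit_tensor(2) S algebra_unit counit_unit B C)
qed

lemma cocommutative_tensor:
  assumes B: "coalgebra B" "cocommutative B" and C: "coalgebra C" "cocommutative C"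
  shows "cocommutative (tensor_bialg B C)"
  unfolding cocommutative_tens[OF coalgebra_tensor[OF B(1) C(1)]] tensor_bialg_simps
proof -
  let ?W = "tspace B C" and ?P = "tensor_bialg B C"
  let ?X = "tspace ?W ?W"
  note S = B(1) C(1)
  note V = coalgebra_vect[OF S(1)] coalgebra_vect[OF S(2)] vect_tspace
  note d = comul_tensor_bilin(1)[OF S]
  note m = lin_comp[OF d] lin_mem[OF d] d
  show "\<forall>x\<in>carr ?W. tsum ?W ?W (comul ?P x) (\<lambda>a b. tens ?W ?W b a) = comul ?P x"
  proof (rule tens_ballI[where X="?X"])
    fix b c assume bc: "b \<in> carr B" "c \<in> carr C"
    let ?t = "\<lambda>b1 c1 b2 c2. tens ?W ?W (tens B C b1 c1) (tens B C b2 c2)"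
    have "tsum ?W ?W (comul ?P (tens B C b c)) (\<lambda>a b. tens ?W ?W b a)
        = sw B b (\<lambda>b1 b2. sw C c (\<lambda>c1 c2. ?t b2 c2 b1 c1))"
      by (intro tsum_comul_tensor[where X="?X"] S V bc bilinI lin_intros)
    also have "\<dots> = sw B b (\<lambda>b1 b2. sw C c (\<lambda>c1 c2. ?t b1 c2 b2 c1))"
      by (rule tsum_cocommutative[where X="?X" and F="\<lambda>b2 b1. sw C c (\<lambda>c1 c2. ?t b2 c2 b1 c1)"])
        (intro B V bc bilinI lin_intros mem_intros S)+
    also have "\<dots> = sw B b (\<lambda>b1 b2. sw C c (\<lambda>c1 c2. ?t b1 c1 b2 c2))"
      by (intro tsum_cong tsum_cocommutative[where X="?X"] C V bc bilinI lin_intros mem_intros S)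
    also have "\<dots> = comul ?P (tens B C b c)"
      by (rule comul_tensor_bilin(2)[OF S bc, symmetric])
    finally show "tsum ?W ?W (comul ?P (tens B C b c)) (\<lambda>a b. tens ?W ?W b a) = comul ?P (tens B C b
        c)" .
  qed (intro lin_intros m V bilinI mem_intros | assumption)+
qed


section \<open>Maps of bialgebras\<close>

lemma coalgebra_map_lin: "coalgebra_map C D f \<Longrightarrow> lin C D f"
  and coalgebra_map_counit: "coalgebra_map C D f \<Longrightarrow> c \<in> carr C \<Longrightarrow> counit D (f c) = counit C c"
  unfolding coalgebra_map_def by auto

lemma coalgebra_map_comul:
  assumes C: "coalgebra C" and f: "coalgebra_map C D f" and c: "c \<in> carr C"
  shows "comul D (f c) = sw C c (\<lambda>a b. tens D D (f a) (f b))"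
proof -
  have "comul D (f c) = tmap C C D D f f (comul C c)"
    using f c unfolding coalgebra_map_def by blast
  also have "\<dots> = sw C c (\<lambda>a b. tens D D (f a) (f b))"
    by (intro tmap_eq_tsum coalgebra_vect C coalgebra_map_lin[OF f] mem_intros c)
  finally show ?thesis .
qed

lemma tsum_coalgebra_map:
  assumes C: "coalgebra C" and D: "vect D" and f: "coalgebra_map C D f" and c: "c \<in> carr C"
    and X: "vect X" and F: "bilin D D X F"
  shows "sw D (f c) F = sw C c (\<lambda>a b. F (f a) (f b))"
  unfolding coalgebra_map_comul[OF C f c]
  by (intro tsum_tsum_tens[where X=X] coalgebra_vect[OF C] C D X F mem_intros c
      lin_mem[OF coalgebra_map_lin[OF f]])

lemma coalgebra_mapI:
  assumes C: "coalgebra C" and f: "lin C D f"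
    and "\<And>c. c \<in> carr C \<Longrightarrow> comul D (f c) = sw C c (\<lambda>a b. tens D D (f a) (f b))"
    and "\<And>c. c \<in> carr C \<Longrightarrow> counit D (f c) = counit C c"
  shows "coalgebra_map C D f"
  unfolding coalgebra_map_def
  using assms tmap_eq_tsum[OF coalgebra_vect[OF C] coalgebra_vect[OF C] f f comul_mem[OF C]] by simp

lemma bialgebra_map_coalgebra_map: "bialgebra_map B C f \<Longrightarrow> coalgebra_map B C f"
  and bialgebra_map_lin: "bialgebra_map B C f \<Longrightarrow> lin B C f"
  and bialgebra_map_mul: "bialgebra_map B C f \<Longrightarrow> x \<in> carr B \<Longrightarrow> y \<in> carr B \<Longrightarrow>
    f (mul B x y) = mul C (f x) (f y)"
  and bialgebra_map_unit: "bialgebra_map B C f \<Longrightarrow> f (unit B) = unit C"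
  and bialgebra_map_counit: "bialgebra_map B C f \<Longrightarrow> x \<in> carr B \<Longrightarrow> counit C (f x) = counit B x"
  unfolding bialgebra_map_def algebra_map_def coalgebra_map_def by auto

lemma bialgebra_map_mem: "bialgebra_map B C f \<Longrightarrow> x \<in> carr B \<Longrightarrow> f x \<in> carr C"
  by (rule lin_mem[OF bialgebra_map_lin])

lemma bialgebra_mapI:
  assumes B: "bialgebra B" and f: "lin B C f"
    and "\<And>x y. x \<in> carr B \<Longrightarrow> y \<in> carr B \<Longrightarrow> f (mul B x y) = mul C (f x) (f y)"
    and "f (unit B) = unit C"
    and "\<And>c. c \<in> carr B \<Longrightarrow> comul C (f c) = sw B c (\<lambda>a b. tens C C (f a) (f b))"
    and "\<And>c. c \<in> carr B \<Longrightarrow> counit C (f c) = counit B c"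
  shows "bialgebra_map B C f"
  unfolding bialgebra_map_def algebra_map_def
  using assms coalgebra_mapI[OF bialgebra_coalgebra[OF B] f] by blast

lemma coalgebra_map_comp:
  assumes B: "coalgebra B" "vect C" "vect D" and f: "coalgebra_map B C f" and g: "coalgebra_map C D
      g"
  shows "coalgebra_map B D (\<lambda>x. g (f x))"
proof (rule coalgebra_mapI[OF B(1)])
  note l = coalgebra_map_lin[OF f] coalgebra_map_lin[OF g]
  show "lin B D (\<lambda>x. g (f x))" by (rule lin_comp[OF l(2) l(1)])
  show "comul D (g (f c)) = sw B c (\<lambda>a b. tens D D (g (f a)) (g (f b)))"
    if c: "c \<in> carr B" for c
  proof -
    have "comul D (g (f c)) = tmap C C D D g g (comul C (f c))"
      using g lin_mem[OF l(1) c] unfolding coalgebra_map_def by blast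
    also have "\<dots> = sw C (f c) (\<lambda>a b. tens D D (g a) (g b))"
    proof (rule tmap_eq_tsum[OF B(2,2) l(2,2)])
      show "comul C (f c) \<in> carr (tspace C C)"
        unfolding coalgebra_map_comul[OF B(1) f c]
        by (intro mem_intros coalgebra_vect B vect_tspace lin_mem[OF l(1)] c)
    qed
    also have "\<dots> = sw B c (\<lambda>a b. tens D D (g (f a)) (g (f b)))"
      by (rule tsum_coalgebra_map[OF B(1,2) f c, where X="tspace D D"])
        (intro vect_tspace bilinI lin_intros l lin_mem[OF l(2)] | assumption)+
    finally show ?thesis .
  qed
  show "counit D (g (f c)) = counit B c" if "c \<in> carr B" for c
    using that lin_mem[OF l(1) that] coalgebra_map_counit[OF f] coalgebra_map_counit[OF g] by simp
qed

lemma bialgebra_map_comp: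
  assumes B: "bialgebra B" "vect C" "vect D" and f: "bialgebra_map B C f" and g: "bialgebra_map C D
      g"
  shows "bialgebra_map B D (\<lambda>x. g (f x))"
  using coalgebra_map_comp[OF bialgebra_coalgebra[OF B(1)] B(2,3) bialgebra_map_coalgebra_map[OF f]
      bialgebra_map_coalgebra_map[OF g]] bialgebra_map_mem[OF f] f g
  unfolding bialgebra_map_def algebra_map_def coalgebra_map_def by auto

lemma bialgebra_map_id: assumes B: "bialgebra B" shows "bialgebra_map B B (\<lambda>x. x)"
  by (rule bialgebra_mapI[OF B lin_id])
    (simp_all add: tsum_tens_id bialgebra_vect[OF B] comul_mem bialgebra_coalgebra[OF B])

lemma bialgebra_map_cong:
  assumes B: "bialgebra B" and f: "bialgebra_map B C f" and fg: "\<And>x. x \<in> carr B \<Longrightarrow> f x = g x"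
  shows "bialgebra_map B C g"
proof (rule bialgebra_mapI[OF B])
  note S = bialgebra_algebra[OF B] bialgebra_coalgebra[OF B]
  note V = bialgebra_vect[OF B]
  show "lin B C g" by (rule lin_cong[OF bialgebra_map_lin[OF f] V fg])
  show "g (mul B x y) = mul C (g x) (g y)" if "x \<in> carr B" "y \<in> carr B" for x y
    using bialgebra_map_mul[OF f that] that algebra_mul_mem[OF S(1) that] by (simp add:
        fg[symmetric])
  show "g (unit B) = unit C"
    using bialgebra_map_unit[OF f] algebra_unit[OF S(1)] by (simp add: fg[symmetric])
  fix c assume c: "c \<in> carr B"
  show "counit C (g c) = counit B c"
    using bialgebra_map_counit[OF f c] c by (simp add: fg[symmetric])
  have "comul C (g c) = sw B c (\<lambda>a b. tens C C (f a) (f b))"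
    using coalgebra_map_comul[OF S(2) bialgebra_map_coalgebra_map[OF f] c] by (simp add: fg c)
  also have "\<dots> = sw B c (\<lambda>a b. tens C C (g a) (g b))"
    by (intro tsum_cong V mem_intros S c) (simp add: fg)
  finally show "comul C (g c) = \<dots>" .
qed

text \<open>
  All structure maps are linear, so compatibility with them may be tested on pure tensors.
\<close>

lemma bialgebra_map_tensorI:
  assumes B: "bialgebra B" and C: "bialgebra C" and D: "bialgebra D" and h: "lin (tspace B C) D h"
    and mul: "\<And>b c b' c'. b \<in> carr B \<Longrightarrow> c \<in> carr C \<Longrightarrow> b' \<in> carr B \<Longrightarrow> c' \<in> carr C \<Longrightarrow>
      h (tens B C (mul B b b') (mul C c c')) = mul D (h (tens B C b c)) (h (tens B C b' c'))"
    and unit: "h (tens B C (unit B) (unit C)) = unit D"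
    and comul: "\<And>b c. b \<in> carr B \<Longrightarrow> c \<in> carr C \<Longrightarrow> comul D (h (tens B C b c))
      = sw B b (\<lambda>b1 b2. sw C c (\<lambda>c1 c2. tens D D (h (tens B C b1 c1)) (h (tens B C b2 c2))))"
    and counit: "\<And>b c. b \<in> carr B \<Longrightarrow> c \<in> carr C \<Longrightarrow> counit D (h (tens B C b c)) = counit B b * counit C
        c"
  shows "bialgebra_map (tensor_bialg B C) D h"
proof (rule bialgebra_mapI[OF bialgebra_tensor[OF B C]]; (unfold tensor_bialg_simps)?)
  let ?W = "tspace B C" and ?P = "tensor_bialg B C"
  note S = bialgebra_algebra[OF B] bialgebra_algebra[OF C] bialgebra_coalgebra[OF B]
      bialgebra_coalgebra[OF C]
    bialgebra_algebra[OF D] bialgebra_coalgebra[OF D]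
  note V = bialgebra_vect[OF B] bialgebra_vect[OF C] bialgebra_vect[OF D] vect_tspace
  note d = comul_tensor_bilin(1)[OF S(3,4)] and e = counit_tensor(1)[OF S(3,4)]
  note t = bilin_tmul[OF S(1,2)]
  note m = lin_comp[OF d] lin_mem[OF d] lin_comp[OF e] d e bilin_mem[OF t] lin_bilin1[OF t]
      lin_bilin2[OF t]
    lin_comp[OF h] lin_mem[OF h] h
  show "lin ?W D h" by (rule h)
  have "\<forall>x\<in>carr ?W. \<forall>y\<in>carr ?W. h (tmul B C x y) = mul D (h x) (h y)"
    by (rule tens_ballI2[where X=D]) (intro m lin_intros S | simp add: tmul_tens S mul)+
  then show "h (tmul B C x y) = mul D (h x) (h y)" if "x \<in> carr ?W" "y \<in> carr ?W" for x y
    using that by blast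
  show "h (tens B C (unit B) (unit C)) = unit D" by (rule unit)
  have "\<forall>x\<in>carr ?W. comul D (h x) = tsum ?W ?W (comul ?P x) (\<lambda>a b. tens D D (h a) (h b))"
  proof (rule tens_ballI[where X="tspace D D"])
    fix b c assume bc: "b \<in> carr B" "c \<in> carr C"
    show "comul D (h (tens B C b c)) = tsum ?W ?W (comul ?P (tens B C b c)) (\<lambda>a b. tens D D (h a) (h
        b))"
      unfolding comul[OF bc]
      by (intro tsum_comul_tensor[symmetric, where X="tspace D D"] S V bc bilinI lin_intros m)
  qed (intro lin_intros m V bilinI S | assumption)+
  then show "comul D (h x) = tsum ?W ?W (comul ?P x) (\<lambda>a b. tens D D (h a) (h b))" if "x \<in> carr ?W"
      for x
    using that by blast
  have "\<forall>x\<in>carr ?W. counit D (h x) = counit ?P x"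
    by (rule tens_ballI[where X="ground"]) (intro lin_intros m S | simp add: counit counit_tensor(2)
        S)+
  then show "counit D (h x) = counit ?P x" if "x \<in> carr ?W" for x
    using that by blast
qed

lemma bialgebra_map_tmap:
  assumes B: "bialgebra B" "bialgebra B'" and C: "bialgebra C" "bialgebra C'"
    and f: "bialgebra_map B B' f" and g: "bialgebra_map C C' g"
  shows "bialgebra_map (tensor_bialg B C) (tensor_bialg B' C') (tmap B C B' C' f g)"
proof (rule bialgebra_map_tensorI[OF B(1) C(1) bialgebra_tensor[OF B(2) C(2)]]; (unfold
    tensor_bialg_simps)?)
  let ?W' = "tspace B' C'"
  let ?X = "tspace ?W' ?W'" and ?h = "tmap B C B' C' f g"
  note S = bialgebra_algebra[OF B(1)] bialgebra_algebra[OF C(1)] bialgebra_algebra[OF B(2)]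
      bialgebra_algebra[OF C(2)]
    bialgebra_coalgebra[OF B(1)] bialgebra_coalgebra[OF C(1)] bialgebra_coalgebra[OF B(2)]
        bialgebra_coalgebra[OF C(2)]
  note V = bialgebra_vect[OF B(1)] bialgebra_vect[OF C(1)] bialgebra_vect[OF B(2)] bialgebra_vect[OF
      C(2)] vect_tspace
  note lf = bialgebra_map_lin[OF f] and lg = bialgebra_map_lin[OF g]
  note th = tmap_tens[OF V(1,2) lf lg]
  note m = lin_comp[OF lf] lin_comp[OF lg] lin_mem[OF lf] lin_mem[OF lg]
  show "lin (tspace B C) ?W' ?h" by (rule lin_tmap[OF V(1,2) lf lg])
  show "?h (tens B C (unit B) (unit C)) = tens B' C' (unit B') (unit C')"
    by (simp add: th algebra_unit S bialgebra_map_unit[OF f] bialgebra_map_unit[OF g])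
  fix b c assume bc: "b \<in> carr B" "c \<in> carr C"
  show "counit (tensor_bialg B' C') (?h (tens B C b c)) = counit B b * counit C c"
    by (simp add: th bc counit_tensor(2) S m bialgebra_map_counit[OF f] bialgebra_map_counit[OF g])
  let ?t = "\<lambda>b1 c1 b2 c2. tens ?W' ?W' (tens B' C' b1 c1) (tens B' C' b2 c2)"
  have "comul (tensor_bialg B' C') (?h (tens B C b c))
      = sw B' (f b) (\<lambda>b1 b2. sw C' (g c) (\<lambda>c1 c2. ?t b1 c1 b2 c2))"
    unfolding th[OF bc] by (intro comul_tensor_bilin(2) S m bc)
  also have "\<dots> = sw B b (\<lambda>b1 b2. sw C' (g c) (\<lambda>c1 c2. ?t (f b1) c1 (f b2) c2))"
    by (intro tsum_coalgebra_map[where X="?X"] S V bialgebra_map_coalgebra_map f bc bilinI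
        lin_intros mem_intros m)
  also have "\<dots> = sw B b (\<lambda>b1 b2. sw C c (\<lambda>c1 c2. ?t (f b1) (g c1) (f b2) (g c2)))"
    by (intro tsum_cong tsum_coalgebra_map[where X="?X"] S V bialgebra_map_coalgebra_map g bc bilinI
        lin_intros mem_intros m)
  also have "\<dots> = sw B b (\<lambda>b1 b2. sw C c (\<lambda>c1 c2. tens ?W' ?W' (?h (tens B C b1 c1)) (?h (tens B C b2
      c2))))"
    by (intro tsum_cong V bc mem_intros S) (simp add: th)
  finally show "comul (tensor_bialg B' C') (?h (tens B C b c)) = \<dots>" .
  fix b' c' assume bc': "b' \<in> carr B" "c' \<in> carr C"
  show "?h (tens B C (mul B b b') (mul C c c')) = tmul B' C' (?h (tens B C b c)) (?h (tens B C b'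
      c'))"
    by (simp add: tmul_tens S bc bc' th algebra_mul_mem bialgebra_map_mul[OF f] bialgebra_map_mul[OF
        g] m)
qed

lemma tsum_counit_counit:
  assumes C: "coalgebra C" and c: "c \<in> carr C"
  shows "sw C c (\<lambda>a b. counit C a * counit C b) = counit C c"
proof -
  note V = coalgebra_vect[OF C]
  note e = coalgebra_counit[OF C]
  have "sw C c (\<lambda>a b. counit C a * counit C b)
      = sw C c (\<lambda>a b. counit C (scl C (counit C a) b))"
    by (intro tsum_cong V mem_intros C c) (simp add: lin_scl[OF e])
  also have "\<dots> = counit C (sw C c (\<lambda>a b. scl C (counit C a) b))"
    by (intro tsum_lin[symmetric, where X=C and Y=ground] e V mem_intros C c)
  finally show ?thesis by (simp add: counit_left[OF C c])
qed

lemma tsum_scl_left: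
  assumes "vect V" "vect X" "x \<in> carr (tspace V W)" "y \<in> carr X"
  shows "tsum V W x (\<lambda>a b. scl X (f a b) y) = scl X (tsum V W x f) y"
  by (rule tsum_lin[symmetric, where L="\<lambda>c. scl X c y" and X=ground and Y=X])
    (intro assms vect_ground lin_intros | simp)+

text \<open>
  The projection \<open>id \<otimes> \<epsilon>\<close>. It is compatible with comultiplication since \<open>\<epsilon>(c\<^sub>1) \<epsilon>(c\<^sub>2) = \<epsilon>(c)\<close>.
\<close>

lemma bialgebra_map_proj1:
  assumes B: "bialgebra B" and C: "bialgebra C"
  shows "bialgebra_map (tensor_bialg B C) B (\<lambda>x. tsum B C x (\<lambda>b c. scl B (counit C c) b))"
proof (rule bialgebra_map_tensorI[OF B C B])
  let ?h = "\<lambda>x. tsum B C x (\<lambda>b c. scl B (counit C c) b)"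
  note S = bialgebra_algebra[OF B] bialgebra_algebra[OF C] bialgebra_coalgebra[OF B]
      bialgebra_coalgebra[OF C]
  note V = bialgebra_vect[OF B] bialgebra_vect[OF C] vect_tspace
  have th: "?h (tens B C b c) = scl B (counit C c) b" if "b \<in> carr B" "c \<in> carr C" for b c
    by (intro tsum_tens[where X=B] lin_intros V bilinI mem_intros S that)
  show "lin (tspace B C) B ?h" by (intro lin_intros V bilinI mem_intros S)
  show "?h (tens B C (unit B) (unit C)) = unit B"
    by (simp add: th algebra_unit S counit_unit[OF C] vect_scl_one V)
  fix b c assume bc: "b \<in> carr B" "c \<in> carr C"
  show "counit B (?h (tens B C b c)) = counit B b * counit C c"
    by (simp add: th bc S lin_scl[OF coalgebra_counit] mult.commute)
  have "sw B b (\<lambda>b1 b2. sw C c (\<lambda>c1 c2. tens B B (?h (tens B C b1 c1)) (?h (tens B C b2 c2))))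
     = sw B b (\<lambda>b1 b2. sw C c (\<lambda>c1 c2.
       scl (tspace B B) (counit C c1 * counit C c2) (tens B B b1 b2)))"
    by (intro tsum_cong V bc mem_intros S) (simp add: th tens_scl_scl V)
  also have "\<dots> = sw B b (\<lambda>b1 b2. scl (tspace B B) (counit C c) (tens B B b1 b2))"
    by (intro tsum_cong trans[OF tsum_scl_left] V bc mem_intros S arg_cong2[where f="scl (tspace B
        B)"] tsum_counit_counit refl)
  also have "\<dots> = scl (tspace B B) (counit C c) (sw B b (tens B B))"
    by (intro tsum_lin[symmetric, where X="tspace B B" and Y="tspace B B"] lin_intros V bc S
        mem_intros)
  also have "\<dots> = comul B (?h (tens B C b c))"
    by (simp add: th bc lin_scl[OF coalgebra_comul[OF S(3)]] tsum_tens_id V comul_mem S)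
  finally show "comul B (?h (tens B C b c)) = sw B b (\<lambda>b1 b2. sw C c (\<lambda>c1 c2.
      tens B B (?h (tens B C b1 c1)) (?h (tens B C b2 c2))))" ..
  fix b' c' assume bc': "b' \<in> carr B" "c' \<in> carr C"
  show "?h (tens B C (mul B b b') (mul C c c')) = mul B (?h (tens B C b c)) (?h (tens B C b' c'))"
    by (simp add: th bc bc' S algebra_mul_mem counit_mul[OF C] lin_scl[OF bilin_lin1[OF
        algebra_mul[OF S(1)]]]
      lin_scl[OF bilin_lin2[OF algebra_mul[OF S(1)]]] vect_scl V vect_scl_scl mult.commute)
qed

text \<open>
  The symmetry of the tensor product transfers the statements on the first factor to the second
  one.
\<close>

lemma bialgebra_map_flip:
  assumes B: "bialgebra B" and C: "bialgebra C"
  shows "bialgebra_map (tensor_bialg B C) (tensor_bialg C B) (\<lambda>x. tsum B C x (\<lambda>b c. tens C B c b))"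
proof (rule bialgebra_map_tensorI[OF B C bialgebra_tensor[OF C B]]; (unfold tensor_bialg_simps)?)
  let ?W' = "tspace C B"
  let ?h = "\<lambda>x. tsum B C x (\<lambda>b c. tens C B c b)"
  note S = bialgebra_algebra[OF B] bialgebra_algebra[OF C] bialgebra_coalgebra[OF B]
      bialgebra_coalgebra[OF C]
  note V = bialgebra_vect[OF B] bialgebra_vect[OF C] vect_tspace
  have th: "?h (tens B C b c) = tens C B c b" if "b \<in> carr B" "c \<in> carr C" for b c
    by (intro tsum_tens[where X="?W'"] lin_intros V bilinI mem_intros S that)
  show "lin (tspace B C) ?W' ?h" by (intro lin_intros V bilinI mem_intros S)
  show "?h (tens B C (unit B) (unit C)) = tens C B (unit C) (unit B)"
    by (simp add: th algebra_unit S)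
  fix b c assume bc: "b \<in> carr B" "c \<in> carr C"
  show "counit (tensor_bialg C B) (?h (tens B C b c)) = counit B b * counit C c"
    by (simp add: th bc counit_tensor(2) S mult.commute)
  have "sw B b (\<lambda>b1 b2. sw C c (\<lambda>c1 c2. tens ?W' ?W' (?h (tens B C b1 c1)) (?h (tens B C b2 c2))))
     = sw B b (\<lambda>b1 b2. sw C c (\<lambda>c1 c2. tens ?W' ?W' (tens C B c1 b1) (tens C B c2 b2)))"
    by (intro tsum_cong V bc mem_intros S) (simp add: th)
  also have "\<dots> = sw C c (\<lambda>c1 c2. sw B b (\<lambda>b1 b2. tens ?W' ?W' (tens C B c1 b1) (tens C B c2 b2)))"
    by (rule tsum_swap)
  also have "\<dots> = comul (tensor_bialg C B) (?h (tens B C b c))"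
    by (simp add: th bc comul_tensor_bilin(2) S)
  finally show "comul (tensor_bialg C B) (?h (tens B C b c)) = sw B b (\<lambda>b1 b2. sw C c (\<lambda>c1 c2.
      tens ?W' ?W' (?h (tens B C b1 c1)) (?h (tens B C b2 c2))))" ..
  fix b' c' assume bc': "b' \<in> carr B" "c' \<in> carr C"
  show "?h (tens B C (mul B b b') (mul C c c')) = tmul C B (?h (tens B C b c)) (?h (tens B C b'
      c'))"
    by (simp add: tmul_tens S bc bc' th algebra_mul_mem)
qed

lemma bialgebra_map_proj2:
  assumes B: "bialgebra B" and C: "bialgebra C"
  obtains h where "bialgebra_map (tensor_bialg B C) C h"
    "\<And>b c. b \<in> carr B \<Longrightarrow> c \<in> carr C \<Longrightarrow> h (tens B C b c) = scl C (counit B b) c"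
proof -
  note S = bialgebra_coalgebra[OF B]
  note V = bialgebra_vect[OF B] bialgebra_vect[OF C] vect_tspace
  let ?f = "\<lambda>x. tsum B C x (\<lambda>b c. tens C B c b)" and ?g = "\<lambda>x. tsum C B x (\<lambda>c b. scl C (counit B b)
      c)"
  have "bialgebra_map (tensor_bialg B C) C (\<lambda>x. ?g (?f x))"
    by (rule bialgebra_map_comp[OF bialgebra_tensor[OF B C] vect_tensor_bialg V(2)
        bialgebra_map_flip[OF B C]
        bialgebra_map_proj1[OF C B]])
  moreover have "?g (?f (tens B C b c)) = scl C (counit B b) c" if bc: "b \<in> carr B" "c \<in> carr C" for
      b c
  proof -
    have "?f (tens B C b c) = tens C B c b"
      by (intro tsum_tens[where X="tspace C B"] V bc bilinI lin_intros)
    moreover have "?g (tens C B c b) = scl C (counit B b) c"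
      by (intro tsum_tens[where X=C] V bc bilinI lin_intros mem_intros S)
    ultimately show ?thesis by simp
  qed
  ultimately show thesis by (rule that)
qed

text \<open>
  With \<open>p = id \<otimes> \<epsilon>\<close> and \<open>q = \<epsilon> \<otimes> id\<close>, the map \<open>(p \<otimes> q) \<circ> \<Delta>\<close> is the identity of \<open>B \<otimes> C\<close>, by the
  counit laws. This is why \<open>\<alpha>\<close> has a left inverse.
\<close>

lemma tmap_projections_comul:
  assumes B: "bialgebra B" and C: "bialgebra C" and x: "x \<in> carr (tspace B C)"
    and p: "lin (tspace B C) B p" "\<And>b c. b \<in> carr B \<Longrightarrow> c \<in> carr C \<Longrightarrow> p (tens B C b c) = scl B (counit
        C c) b"
    and q: "lin (tspace B C) C q" "\<And>b c. b \<in> carr B \<Longrightarrow> c \<in> carr C \<Longrightarrow> q (tens B C b c) = scl C (counit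
        B b) c"
  shows "tsum (tspace B C) (tspace B C) (comul (tensor_bialg B C) x) (\<lambda>u v. tens B C (p u) (q v)) =
      x"
proof -
  let ?W = "tspace B C" and ?P = "tensor_bialg B C"
  note S = bialgebra_coalgebra[OF B] bialgebra_coalgebra[OF C]
  note V = bialgebra_vect[OF B] bialgebra_vect[OF C] vect_tspace
  note l = lin_comp[OF p(1)] lin_mem[OF p(1)] lin_comp[OF q(1)] lin_mem[OF q(1)] p(1) q(1)
  note d = comul_tensor_bilin(1)[OF S]
  have "\<forall>x\<in>carr ?W. tsum ?W ?W (comul ?P x) (\<lambda>u v. tens B C (p u) (q v)) = x"
  proof (rule tens_ballI[where X="?W"])
    fix b c assume bc: "b \<in> carr B" "c \<in> carr C"
    have "tsum ?W ?W (comul ?P (tens B C b c)) (\<lambda>u v. tens B C (p u) (q v))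
      = sw B b (\<lambda>b1 b2. sw C c (\<lambda>c1 c2. tens B C (p (tens B C b1 c1)) (q (tens B C b2 c2))))"
      by (intro tsum_comul_tensor[where X="?W"] S V bc bilinI lin_intros l)
    also have "\<dots> = sw B b (\<lambda>b1 b2. sw C c (\<lambda>c1 c2.
        tens B C (scl B (counit B b2) b1) (scl C (counit C c1) c2)))"
      by (intro tsum_cong V mem_intros S bc) (simp add: p q tens_scl_scl V mult.commute)
    also have "\<dots> = tens B C b c"
      by (subst tsum_tens_tens[OF V(1,1,2,2,1,2) comul_mem[OF S(1) bc(1)] comul_mem[OF S(2) bc(2)]])
        (intro mem_intros V | simp add: counit_left[OF S(2)] counit_right[OF S(1)] bc)+
    finally show "tsum ?W ?W (comul ?P (tens B C b c)) (\<lambda>u v. tens B C (p u) (q v)) = tens B C b c"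
        .
  qed (intro lin_intros V bilinI l lin_comp[OF d] d | assumption)+
  then show ?thesis using x by blast
qed

lemma bialgebra_map_incl1:
  assumes B: "bialgebra B" and C: "bialgebra C"
  shows "bialgebra_map B (tensor_bialg B C) (\<lambda>b. tens B C b (unit C))"
proof (rule bialgebra_mapI[OF B]; (unfold tensor_bialg_simps)?)
  let ?W = "tspace B C" and ?P = "tensor_bialg B C"
  let ?h = "\<lambda>b. tens B C b (unit C)"
  note S = bialgebra_algebra[OF B] bialgebra_algebra[OF C] bialgebra_coalgebra[OF B]
      bialgebra_coalgebra[OF C]
  note V = bialgebra_vect[OF B] bialgebra_vect[OF C] vect_tspace vect_ground
  show "lin B ?W ?h" by (intro lin_intros mem_intros S)
  show "?h (mul B x y) = tmul B C (?h x) (?h y)" if "x \<in> carr B" "y \<in> carr B" for x y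
    using that by (simp add: tmul_tens S algebra_unit algebra_unit_left)
  show "tens B C (unit B) (unit C) = tens B C (unit B) (unit C)" ..
  show "comul ?P (?h c) = sw B c (\<lambda>a b. tens ?W ?W (?h a) (?h b))" if c: "c \<in> carr B" for c
  proof -
    have "comul ?P (?h c) = sw B c (\<lambda>b1 b2. sw C (unit C) (\<lambda>c1 c2.
        tens ?W ?W (tens B C b1 c1) (tens B C b2 c2)))"
      by (intro comul_tensor_bilin(2) S mem_intros c)
    also have "\<dots> = sw B c (\<lambda>a b. tens ?W ?W (?h a) (?h b))"
      by (intro tsum_cong tsum_comul_unit[where X="tspace ?W ?W"] V C S mem_intros c bilinI
          lin_intros)
    finally show ?thesis .
  qed
  show "counit ?P (?h c) = counit B c" if "c \<in> carr B" for c
    using that by (simp add: counit_tensor(2) S algebra_unit counit_unit C)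
qed

lemma bialgebra_map_incl2:
  assumes B: "bialgebra B" and C: "bialgebra C"
  shows "bialgebra_map C (tensor_bialg B C) (\<lambda>c. tens B C (unit B) c)"
proof -
  note S = bialgebra_algebra[OF B]
  note V = bialgebra_vect[OF B] bialgebra_vect[OF C] vect_tspace
  show ?thesis
  proof (rule bialgebra_map_cong[OF C bialgebra_map_comp[OF C vect_tensor_bialg vect_tensor_bialg
          bialgebra_map_incl1[OF C B] bialgebra_map_flip[OF C B]]])
    show "tsum C B (tens C B c (unit B)) (\<lambda>c b. tens B C b c) = tens B C (unit B) c" if "c \<in> carr C"
        for c
      by (intro tsum_tens[where X="tspace B C"] V that bilinI lin_intros mem_intros S)
  qed
qed

text \<open>
  By coassociativity both sides run over \<open>c\<^sub>1, c\<^sub>2, c\<^sub>3, c\<^sub>4\<close> with \<open>c\<^sub>2\<close> and \<open>c\<^sub>3\<close> arising from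
  the comultiplication of one element, where they may be exchanged.
\<close>

lemma tsum_interchange:
  assumes C: "coalgebra C" and co: "cocommutative C" and c: "c \<in> carr C" and X: "vect X"
    and F: "\<And>y z w. y \<in> carr C \<Longrightarrow> z \<in> carr C \<Longrightarrow> w \<in> carr C \<Longrightarrow> lin C X (\<lambda>x. F x y z w)"
      "\<And>x z w. x \<in> carr C \<Longrightarrow> z \<in> carr C \<Longrightarrow> w \<in> carr C \<Longrightarrow> lin C X (\<lambda>y. F x y z w)"
      "\<And>x y w. x \<in> carr C \<Longrightarrow> y \<in> carr C \<Longrightarrow> w \<in> carr C \<Longrightarrow> lin C X (\<lambda>z. F x y z w)"
      "\<And>x y z. x \<in> carr C \<Longrightarrow> y \<in> carr C \<Longrightarrow> z \<in> carr C \<Longrightarrow> lin C X (\<lambda>w. F x y z w)"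
  shows "sw C c (\<lambda>a b. sw C a (\<lambda>x y. sw C b (\<lambda>z w. F x y z w)))
       = sw C c (\<lambda>a b. sw C a (\<lambda>x y. sw C b (\<lambda>z w. F x z y w)))"
proof -
  note V = coalgebra_vect[OF C] vect_tspace
  have re: "sw C c (\<lambda>a b. sw C a (\<lambda>x y. sw C b (\<lambda>z w. G x y z w)))
     = sw C c (\<lambda>a b. sw C b (\<lambda>p w. sw C p (\<lambda>y z. G a y z w)))"
    if G: "\<And>y z w. y \<in> carr C \<Longrightarrow> z \<in> carr C \<Longrightarrow> w \<in> carr C \<Longrightarrow> lin C X (\<lambda>x. G x y z w)"
      "\<And>x z w. x \<in> carr C \<Longrightarrow> z \<in> carr C \<Longrightarrow> w \<in> carr C \<Longrightarrow> lin C X (\<lambda>y. G x y z w)"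
      "\<And>x y w. x \<in> carr C \<Longrightarrow> y \<in> carr C \<Longrightarrow> w \<in> carr C \<Longrightarrow> lin C X (\<lambda>z. G x y z w)"
      "\<And>x y z. x \<in> carr C \<Longrightarrow> y \<in> carr C \<Longrightarrow> z \<in> carr C \<Longrightarrow> lin C X (\<lambda>w. G x y z w)" for G
  proof -
    have "sw C c (\<lambda>a b. sw C a (\<lambda>x y. sw C b (\<lambda>z w. G x y z w)))
       = sw C c (\<lambda>a b. sw C b (\<lambda>y q. sw C q (\<lambda>z w. G a y z w)))"
      by (intro coassoc[where X=X and F="\<lambda>x y b. sw C b (\<lambda>z w. G x y z w)"]
          C c X lin_intros bilinI V G mem_intros)
    also have "\<dots> = sw C c (\<lambda>a b. sw C b (\<lambda>p w. sw C p (\<lambda>y z. G a y z w)))"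
      by (intro tsum_cong coassoc[symmetric, where X=X] C c X V G mem_intros)
    finally show ?thesis .
  qed
  have "sw C c (\<lambda>a b. sw C a (\<lambda>x y. sw C b (\<lambda>z w. F x y z w)))
     = sw C c (\<lambda>a b. sw C b (\<lambda>p w. sw C p (\<lambda>y z. F a y z w)))"
    by (rule re[OF F])
  also have "\<dots> = sw C c (\<lambda>a b. sw C b (\<lambda>p w. sw C p (\<lambda>y z. F a z y w)))"
    by (intro tsum_cong tsum_cocommutative[symmetric, where X=X] C co c X V bilinI F mem_intros)
  also have "\<dots> = sw C c (\<lambda>a b. sw C a (\<lambda>x y. sw C b (\<lambda>z w. F x z y w)))"
    by (rule re[OF F(1,3,2,4), symmetric])
  finally show ?thesis .
qed

text \<open>
  Cocommutativity enters through \<open>tsum_interchange\<close>: the comultiplication of \<open>c\<^sub>1 \<otimes> c\<^sub>2\<close> in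
  \<open>B \<otimes> B\<close> pairs the four parts of \<open>c\<close> in the order \<open>1, 3, 2, 4\<close>, whereas \<open>\<Delta> \<otimes> \<Delta>\<close> pairs them in the
  order \<open>1, 2, 3, 4\<close>.
\<close>

lemma bialgebra_map_comul:
  assumes B: "bialgebra B" and co: "cocommutative B"
  shows "bialgebra_map B (tensor_bialg B B) (comul B)"
proof (rule bialgebra_mapI[OF B]; (unfold tensor_bialg_simps)?)
  let ?W = "tspace B B" and ?P = "tensor_bialg B B"
  let ?X = "tspace ?W ?W"
  note S = bialgebra_algebra[OF B] bialgebra_coalgebra[OF B]
  note V = bialgebra_vect[OF B] vect_tspace vect_ground
  note d = comul_tensor_bilin(1)[OF S(2,2)] and e = counit_tensor(1)[OF S(2,2)]
  show "lin B ?W (comul B)" by (rule coalgebra_comul[OF S(2)])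
  show "comul B (mul B x y) = tmul B B (comul B x) (comul B y)" if "x \<in> carr B" "y \<in> carr B" for x y
    using that B unfolding bialgebra_def by blast
  show "comul B (unit B) = tens B B (unit B) (unit B)" by (rule comul_unit[OF B])
  show "counit ?P (comul B c) = counit B c" if c: "c \<in> carr B" for c
  proof -
    have "counit ?P (comul B c) = counit ?P (sw B c (tens B B))"
      by (simp add: tsum_tens_id V comul_mem S c)
    also have "\<dots> = sw B c (\<lambda>a b. counit ?P (tens B B a b))"
      by (intro tsum_lin[where X="?W" and Y=ground] e V S mem_intros c)
    also have "\<dots> = sw B c (\<lambda>a b. counit B a * counit B b)"
      by (intro tsum_cong counit_tensor(2) V S mem_intros c)
    finally show ?thesis by (simp add: tsum_counit_counit S c)
  qed
  show "comul ?P (comul B c) = sw B c (\<lambda>a b. tens ?W ?W (comul B a) (comul B b))"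
    if c: "c \<in> carr B" for c
  proof -
    let ?t = "\<lambda>b1 c1 b2 c2. tens ?W ?W (tens B B b1 c1) (tens B B b2 c2)"
    have "comul ?P (comul B c) = comul ?P (sw B c (tens B B))"
      by (simp add: tsum_tens_id V comul_mem S c)
    also have "\<dots> = sw B c (\<lambda>a b. comul ?P (tens B B a b))"
      by (intro tsum_lin[where X="?W" and Y="?X"] d V S mem_intros c)
    also have "\<dots> = sw B c (\<lambda>a b. sw B a (\<lambda>x y. sw B b (\<lambda>z w. ?t x z y w)))"
      by (intro tsum_cong comul_tensor_bilin(2) V S mem_intros c)
    also have "\<dots> = sw B c (\<lambda>a b. sw B a (\<lambda>x y. sw B b (\<lambda>z w. ?t x y z w)))"
      by (intro tsum_interchange[symmetric, where X="?X"] S co c V lin_intros mem_intros)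
    also have "\<dots> = sw B c (\<lambda>a b. sw B a (\<lambda>x y. tens ?W ?W (tens B B x y) (comul B b)))"
    proof (intro tsum_cong V S mem_intros c)
      fix a b x y assume h: "a \<in> carr B" "b \<in> carr B" "x \<in> carr B" "y \<in> carr B"
      have "sw B b (\<lambda>z w. ?t x y z w) = tens ?W ?W (tens B B x y) (sw B b (tens B B))"
        by (intro tsum_lin[symmetric, where X="?W" and Y="?X"] V S mem_intros lin_intros h)
      then show "sw B b (\<lambda>z w. ?t x y z w) = tens ?W ?W (tens B B x y) (comul B b)"
        by (simp add: tsum_tens_id V comul_mem S h)
    qed
    also have "\<dots> = sw B c (\<lambda>a b. tens ?W ?W (comul B a) (comul B b))"
    proof (intro tsum_cong V S mem_intros c)
      fix a b assume h: "a \<in> carr B" "b \<in> carr B"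
      have "sw B a (\<lambda>x y. tens ?W ?W (tens B B x y) (comul B b))
         = tens ?W ?W (sw B a (tens B B)) (comul B b)"
        by (rule tsum_lin[symmetric, where X="?W" and Y="?X" and L="\<lambda>p. tens ?W ?W p (comul B b)"])
          (intro V S mem_intros lin_intros h | assumption)+
      then show "sw B a (\<lambda>x y. tens ?W ?W (tens B B x y) (comul B b)) = tens ?W ?W (comul B a)
          (comul B b)"
        by (simp add: tsum_tens_id V comul_mem S h)
    qed
    finally show ?thesis .
  qed
qed


section \<open>Subbialgebras and images of bialgebras\<close>

lemma tens_carr_update [simp]:
  "tens (B\<lparr>carr := D\<rparr>) W = tens B W" "tens V (B\<lparr>carr := D\<rparr>) = tens V B"
  by (intro tens_scl_cong; simp)+

lemma tsum_update:
  assumes "vect B" "vect (B\<lparr>carr := D\<rparr>)" "D \<subseteq> carr B" "vect X" "bilin B B X F"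
    and "x \<in> carr (tspace (B\<lparr>carr := D\<rparr>) (B\<lparr>carr := D\<rparr>))"
  shows "tsum (B\<lparr>carr := D\<rparr>) (B\<lparr>carr := D\<rparr>) x F = tsum B B x F"
  by (rule tsum_subset[where X=X]) (use assms in auto)

text \<open>
  The axioms are inherited since sums over tensors in \<open>D \<otimes> D\<close> may be taken in \<open>B \<otimes> B\<close>.
\<close>

lemma sub_bialgebraI:
  assumes B: "bialgebra B" and D: "D \<subseteq> carr B" and V: "vect (B\<lparr>carr := D\<rparr>)" and u: "unit B \<in> D"
    and m: "\<And>x y. x \<in> D \<Longrightarrow> y \<in> D \<Longrightarrow> mul B x y \<in> D"
    and c: "\<And>x. x \<in> D \<Longrightarrow> comul B x \<in> carr (tspace (B\<lparr>carr := D\<rparr>) (B\<lparr>carr := D\<rparr>))"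
  shows "bialgebra (B\<lparr>carr := D\<rparr>)"
proof -
  let ?D = "B\<lparr>carr := D\<rparr>"
  note S = bialgebra_algebra[OF B] bialgebra_coalgebra[OF B]
  note VB = bialgebra_vect[OF B]
  have in_B: "x \<in> carr B" if "x \<in> D" for x using that D by blast
  note U = tsum_update[OF VB V D]
  have alg: "algebra ?D"
  proof (rule algebraI)
    show "vect ?D" by (rule V)
    show "bilin ?D ?D ?D (mul ?D)"
      using algebra_mul[OF S(1)] m in_B unfolding bilin_def lin_def by (auto simp: image_subset_iff)
  qed (use u in_B S(1) in \<open>auto simp: algebra_assoc algebra_unit_left algebra_unit_right\<close>)
  have linc: "lin ?D (tspace ?D ?D) (comul ?D)"
    using coalgebra_comul[OF S(2)] c in_B unfolding lin_def by (auto simp: scl_tspace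
        image_subset_iff simp del: plus_fun_apply)
  have coal: "coalgebra ?D"
  proof (rule coalgebraI[OF V linc])
    show "lin ?D ground (counit ?D)"
      using coalgebra_counit[OF S(2)] in_B unfolding lin_def by auto
    fix x assume "x \<in> carr ?D"
    then have x: "x \<in> D" "x \<in> carr B" using in_B by auto
    let ?X = "tspace B (tspace B B)"
    have XD: "tens ?D (tspace ?D ?D) = tens B (tspace B B)"
      by (rule tens_scl_cong) (simp_all add: scl_tspace)
    let ?t = "\<lambda>u v b. tens B (tspace B B) u (tens B B v b)"
    have "tsum ?D ?D (comul B x) (\<lambda>a b. tsum ?D ?D (comul B a) (\<lambda>u v. ?t u v b))
       = tsum ?D ?D (comul B x) (\<lambda>a b. sw B a (\<lambda>u v. ?t u v b))"
      by (intro tsum_cong V c x U[where X="?X"] bilinI lin_intros vect_tspace mem_intros | simp add: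
          in_B c x)+
    also have "\<dots> = sw B x (\<lambda>a b. sw B a (\<lambda>u v. ?t u v b))"
      by (intro c x U[where X="?X"] bilinI lin_intros VB S vect_tspace mem_intros)
    also have "\<dots> = sw B x (\<lambda>a b. sw B b (\<lambda>u v. ?t a u v))"
      by (rule coassoc_tens[OF S(2) x(2)])
    also have "\<dots> = tsum ?D ?D (comul B x) (\<lambda>a b. sw B b (\<lambda>u v. ?t a u v))"
      by (intro c x U[symmetric, where X="?X"] bilinI lin_intros VB S vect_tspace mem_intros)
    also have "\<dots> = tsum ?D ?D (comul B x) (\<lambda>a b. tsum ?D ?D (comul B b) (\<lambda>u v. ?t a u v))"
      by (intro tsum_cong V c x U[symmetric, where X="?X"] bilinI lin_intros vect_tspace mem_intros
          | simp add: in_B c x)+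
    finally show "sw ?D x (\<lambda>a b. sw ?D a
           (\<lambda>x y. tens ?D (tspace ?D ?D) x (tens ?D ?D y b)))
       = sw ?D x (\<lambda>a b. sw ?D b
           (\<lambda>x y. tens ?D (tspace ?D ?D) a (tens ?D ?D x y)))"
      unfolding XD by simp
    have "tsum ?D ?D (comul B x) (\<lambda>a b. scl B (counit B a) b) = sw B x (\<lambda>a b. scl B (counit B a) b)"
      by (rule tsum_update[OF VB V D VB _ c[OF x(1)]]) (intro bilinI lin_intros VB S mem_intros |
          assumption)+
    then show "sw ?D x (\<lambda>a b. scl ?D (counit ?D a) b) = x"
      by (simp add: counit_left[OF S(2) x(2)])
    have "tsum ?D ?D (comul B x) (\<lambda>a b. scl B (counit B b) a) = sw B x (\<lambda>a b. scl B (counit B b) a)"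
      by (rule tsum_update[OF VB V D VB _ c[OF x(1)]]) (intro bilinI lin_intros VB S mem_intros |
          assumption)+
    then show "sw ?D x (\<lambda>a b. scl ?D (counit ?D b) a) = x"
      by (simp add: counit_right[OF S(2) x(2)])
  qed
  show ?thesis
  proof (rule bialgebraI[OF alg coal])
    fix x y assume "x \<in> carr ?D" "y \<in> carr ?D"
    then have x: "x \<in> D" "x \<in> carr B" and y: "y \<in> D" "y \<in> carr B" using in_B by auto
    let ?t = "\<lambda>x1 x2 y1 y2. tens B B (mul B x1 y1) (mul B x2 y2)"
    have "tsum ?D ?D (comul B x) (\<lambda>x1 x2. tsum ?D ?D (comul B y) (?t x1 x2))
        = tsum ?D ?D (comul B x) (\<lambda>x1 x2. sw B y (?t x1 x2))"
      by (intro tsum_cong V c x y U[where X="tspace B B"] bilinI lin_intros vect_tspace mem_intros S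
          | simp add: in_B c)+
    also have "\<dots> = sw B x (\<lambda>x1 x2. sw B y (?t x1 x2))"
      by (intro c x y U[where X="tspace B B"] bilinI lin_intros VB S vect_tspace mem_intros)
    finally show "comul ?D (mul ?D x y) = sw ?D x (\<lambda>x1 x2. sw ?D y
       (\<lambda>y1 y2. tens ?D ?D (mul ?D x1 y1) (mul ?D x2 y2)))"
      by (simp add: comul_mul[OF B x(2) y(2)])
  qed (use in_B in \<open>auto simp: comul_unit[OF B] counit_unit[OF B] counit_mul[OF B]\<close>)
qed

text \<open>
  A map into a subbialgebra and the same map into the whole bialgebra satisfy literally the same
  equations.
\<close>

lemma bialgebra_map_codom:
  assumes N: "bialgebra N"
  shows "bialgebra_map N (B\<lparr>carr := D\<rparr>) h \<Longrightarrow> D \<subseteq> carr B \<Longrightarrow> bialgebra_map N B h"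
    and "bialgebra_map N B h \<Longrightarrow> h ` carr N \<subseteq> D \<Longrightarrow> bialgebra_map N (B\<lparr>carr := D\<rparr>) h"
proof -
  note C = bialgebra_coalgebra[OF N]
  show "bialgebra_map N B h" if h: "bialgebra_map N (B\<lparr>carr := D\<rparr>) h" and D: "D \<subseteq> carr B"
  proof (rule bialgebra_mapI[OF N])
    show "lin N B h" by (rule lin_subset2[OF bialgebra_map_lin[OF h]]) (use D in auto)
    show "comul B (h c) = sw N c (\<lambda>a b. tens B B (h a) (h b))" if "c \<in> carr N" for c
      using coalgebra_map_comul[OF C bialgebra_map_coalgebra_map[OF h] that] by simp
  qed (use bialgebra_map_mul[OF h] bialgebra_map_unit[OF h] bialgebra_map_counit[OF h] in auto)
  show "bialgebra_map N (B\<lparr>carr := D\<rparr>) h" if h: "bialgebra_map N B h" and D: "h ` carr N \<subseteq> D"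
  proof (rule bialgebra_mapI[OF N])
    show "lin N (B\<lparr>carr := D\<rparr>) h" using bialgebra_map_lin[OF h] D unfolding lin_def by auto
    show "comul (B\<lparr>carr := D\<rparr>) (h c) = sw N c (\<lambda>a b. tens (B\<lparr>carr := D\<rparr>) (B\<lparr>carr := D\<rparr>) (h a) (h
        b))"
      if "c \<in> carr N" for c
      using coalgebra_map_comul[OF C bialgebra_map_coalgebra_map[OF h] that] by simp
  qed (use bialgebra_map_mul[OF h] bialgebra_map_unit[OF h] bialgebra_map_counit[OF h] in auto)
qed

lemma bialgebra_map_incl:
  assumes "bialgebra (B\<lparr>carr := D\<rparr>)" "D \<subseteq> carr B"
  shows "bialgebra_map (B\<lparr>carr := D\<rparr>) B (\<lambda>x. x)"
  by (rule bialgebra_map_codom(1)[OF assms(1) bialgebra_map_id[OF assms(1)] assms(2)])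

lemma bialgebra_map_restrict:
  assumes B: "bialgebra B" "bialgebra (B\<lparr>carr := D\<rparr>)" "D \<subseteq> carr B" and C: "vect C" and f:
      "bialgebra_map B C f"
  shows "bialgebra_map (B\<lparr>carr := D\<rparr>) C f"
  using bialgebra_map_comp[OF B(2) bialgebra_vect[OF B(1)] C bialgebra_map_incl[OF B(2,3)] f] by
      simp

lemma cocommutative_sub:
  assumes B: "bialgebra B" "cocommutative B" and D: "bialgebra (B\<lparr>carr := D\<rparr>)" "D \<subseteq> carr B"
  shows "cocommutative (B\<lparr>carr := D\<rparr>)"
proof -
  let ?D = "B\<lparr>carr := D\<rparr>"
  note V = bialgebra_vect[OF B(1)] bialgebra_vect[OF D(1)]
  have "sw ?D c (\<lambda>a b. tens ?D ?D b a) = comul ?D c" if c: "c \<in> carr ?D" for c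
  proof -
    have cB: "c \<in> carr B" using c D(2) by auto
    have "comul B c \<in> carr (tspace ?D ?D)" using comul_mem[OF bialgebra_coalgebra[OF D(1)] c] by
        simp
    then have "tsum ?D ?D (comul B c) (\<lambda>a b. tens B B b a) = sw B c (\<lambda>a b. tens B B b a)"
      by (intro tsum_update[OF V D(2), where X="tspace B B"] vect_tspace bilinI lin_intros)
    then show ?thesis
      using B(2) cB unfolding cocommutative_tens[OF bialgebra_coalgebra[OF B(1)]] by simp
  qed
  then show ?thesis unfolding cocommutative_tens[OF bialgebra_coalgebra[OF D(1)]] by blast
qed

lemma bialgebra_map_tensor_sub:
  assumes B: "bialgebra B" "bialgebra (B\<lparr>carr := D\<rparr>)" "D \<subseteq> carr B"
    and C: "bialgebra C" "bialgebra (C\<lparr>carr := E\<rparr>)" "E \<subseteq> carr C"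
  shows "bialgebra_map (tensor_bialg (B\<lparr>carr := D\<rparr>) (C\<lparr>carr := E\<rparr>)) (tensor_bialg B C) (\<lambda>x. x)"
proof (rule bialgebra_map_cong[OF bialgebra_tensor[OF B(2) C(2)]
      bialgebra_map_tmap[OF B(2,1) C(2,1) bialgebra_map_incl[OF B(2,3)] bialgebra_map_incl[OF
          C(2,3)]]])
  let ?B = "B\<lparr>carr := D\<rparr>" and ?C = "C\<lparr>carr := E\<rparr>"
  fix x assume "x \<in> carr (tensor_bialg ?B ?C)"
  then have x: "x \<in> carr (tspace ?B ?C)" by (simp add: tensor_bialg_simps)
  have "tmap ?B ?C B C (\<lambda>x. x) (\<lambda>x. x) x = tsum ?B ?C x (tens B C)"
    by (rule tmap_eq_tsum[OF bialgebra_vect[OF B(2)] bialgebra_vect[OF C(2)] bialgebra_map_lin[OF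
        bialgebra_map_incl[OF B(2,3)]]
      bialgebra_map_lin[OF bialgebra_map_incl[OF C(2,3)]] x])
  also have "\<dots> = x" using tsum_tens_id[OF bialgebra_vect[OF B(2)] x] by simp
  finally show "tmap ?B ?C B C (\<lambda>x. x) (\<lambda>x. x) x = x" .
qed

lemma lin_surj:
  assumes N: "vect N" and p: "lin N N' p" "p ` carr N = carr N'" and h: "lin N X (\<lambda>x. h (p x))"
  shows "lin N' X h"
proof (rule linI)
  fix x assume "x \<in> carr N'"
  then obtain a where a: "a \<in> carr N" "x = p a" using p(2) by blast
  show "h x \<in> carr X" using lin_mem[OF h a(1)] a by simp
  show "h (scl N' c x) = scl X c (h x)" for c
    using lin_scl[OF h a(1)] lin_scl[OF p(1) a(1)] a(2) by metis
  fix y assume "y \<in> carr N'"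
  then obtain b where b: "b \<in> carr N" "y = p b" using p(2) by blast
  show "h (x + y) = h x + h y"
    using lin_add[OF h a(1) b(1)] lin_add[OF p(1) a(1) b(1)] a(2) b(2) by metis
qed

text \<open>
  All bialgebra axioms pass from \<open>N\<close> to a surjective image, since they are identities of
  multilinear expressions. This serves both for copies of bialgebras on other types and for
  quotients.
\<close>

lemma bialgebra_transport:
  assumes N: "bialgebra N" and V': "vect N'" and p: "lin N N' p" and sur: "p ` carr N = carr N'"
    and m: "\<And>x y. x \<in> carr N \<Longrightarrow> y \<in> carr N \<Longrightarrow> mul N' (p x) (p y) = p (mul N x y)"
    and u: "unit N' = p (unit N)"
    and c: "\<And>x. x \<in> carr N \<Longrightarrow> comul N' (p x) = sw N x (\<lambda>a b. tens N' N' (p a) (p b))"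
    and e: "\<And>x. x \<in> carr N \<Longrightarrow> counit N' (p x) = counit N x"
  shows "bialgebra N'" and "bialgebra_map N N' p"
proof -
  note S = bialgebra_algebra[OF N] bialgebra_coalgebra[OF N]
  note V = bialgebra_vect[OF N] V' vect_tspace vect_ground
  note lp = lin_comp[OF p] lin_mem[OF p] p
  show bm: "bialgebra_map N N' p"
    by (rule bialgebra_mapI[OF N p]) (simp_all add: m u c e)
  note cm = bialgebra_map_coalgebra_map[OF bm]
  have obt: "\<exists>a. a \<in> carr N \<and> x = p a" if "x \<in> carr N'" for x using that sur by blast
  have lm1: "lin N' N' (\<lambda>x. mul N' x (p b))" if "b \<in> carr N" for b
  proof (rule lin_surj[OF V(1) p sur], rule lin_cong[OF _ V(1)])
    show "lin N N' (\<lambda>x. p (mul N x b))" by (intro lp lin_intros S that)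
  qed (simp add: m that)
  have lm2: "lin N' N' (\<lambda>x. mul N' (p b) x)" if "b \<in> carr N" for b
  proof (rule lin_surj[OF V(1) p sur], rule lin_cong[OF _ V(1)])
    show "lin N N' (\<lambda>x. p (mul N b x))" by (intro lp lin_intros S that)
  qed (simp add: m that)
  have alg: "algebra N'"
  proof (rule algebraI[OF V'])
    show "bilin N' N' N' (mul N')"
    proof (rule bilinI)
      show "lin N' N' (\<lambda>v. mul N' v w)" if "w \<in> carr N'" for w using obt[OF that] lm1 by blast
      show "lin N' N' (mul N' w)" if "w \<in> carr N'" for w using obt[OF that] lm2 by blast
    qed
    show "unit N' \<in> carr N'" unfolding u by (intro lp mem_intros S)
    show "mul N' (mul N' x y) z = mul N' x (mul N' y z)" if "x \<in> carr N'" "y \<in> carr N'" "z \<in> carr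
        N'" for x y z
      using obt[OF that(1)] obt[OF that(2)] obt[OF that(3)]
      by (auto simp: m algebra_mul_mem S algebra_assoc[OF S(1)])
    show "mul N' (unit N') x = x" if "x \<in> carr N'" for x
      using obt[OF that] by (auto simp: u m algebra_unit S algebra_unit_left)
    show "mul N' x (unit N') = x" if "x \<in> carr N'" for x
      using obt[OF that] by (auto simp: u m algebra_unit S algebra_unit_right)
  qed
  have linc: "lin N' (tspace N' N') (comul N')"
  proof (rule lin_surj[OF V(1) p sur], rule lin_cong[OF _ V(1)])
    show "lin N (tspace N' N') (\<lambda>x. sw N x (\<lambda>a b. tens N' N' (p a) (p b)))"
      by (intro lin_intros lp V S mem_intros bilinI)
  qed (simp add: c)
  have line: "lin N' ground (counit N')"
  proof (rule lin_surj[OF V(1) p sur], rule lin_cong[OF _ V(1)])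
    show "lin N ground (counit N)" by (rule coalgebra_counit[OF S(2)])
  qed (simp add: e)
  note T = tsum_coalgebra_map[OF S(2) V' cm]
  have coal: "coalgebra N'"
  proof (rule coalgebraI[OF V' linc line])
    fix x' assume "x' \<in> carr N'"
    then obtain x where x: "x \<in> carr N" and x': "x' = p x" using obt by blast
    let ?X = "tspace N' (tspace N' N')"
    let ?t = "\<lambda>u v w. tens N' (tspace N' N') u (tens N' N' v w)"
    note ll = lin_comp[OF linc] lin_mem[OF linc] lin_comp[OF line]
    have "sw N' (p x) (\<lambda>a b. sw N' a (\<lambda>u v. ?t u v b))
       = sw N x (\<lambda>a b. sw N' (p a) (\<lambda>u v. ?t u v (p b)))"
      by (intro T[where X="?X"] x V bilinI lin_intros ll mem_intros)
    also have "\<dots> = sw N x (\<lambda>a b. sw N a (\<lambda>u v. ?t (p u) (p v) (p b)))"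
      by (intro tsum_cong T[where X="?X"] x V bilinI lin_intros mem_intros S lp)
    also have "\<dots> = sw N x (\<lambda>a b. sw N b (\<lambda>u v. ?t (p a) (p u) (p v)))"
      by (intro coassoc[where X="?X"] S x V lin_intros lp mem_intros)
    also have "\<dots> = sw N x (\<lambda>a b. sw N' (p b) (\<lambda>u v. ?t (p a) u v))"
      by (intro tsum_cong T[symmetric, where X="?X"] x V bilinI lin_intros mem_intros S lp)
    also have "\<dots> = sw N' (p x) (\<lambda>a b. sw N' b (\<lambda>u v. ?t a u v))"
      by (intro T[symmetric, where X="?X"] x V bilinI lin_intros ll mem_intros)
    finally show "sw N' x' (\<lambda>a b. sw N' a (\<lambda>u v. ?t u v b))
        = sw N' x' (\<lambda>a b. sw N' b (\<lambda>u v. ?t a u v))"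
      unfolding x' .
    have "sw N' (p x) (\<lambda>a b. scl N' (counit N' a) b)
        = sw N x (\<lambda>a b. scl N' (counit N' (p a)) (p b))"
      by (intro T[where X=N'] x V bilinI lin_intros ll mem_intros)
    also have "\<dots> = sw N x (\<lambda>a b. p (scl N (counit N a) b))"
      by (intro tsum_cong V mem_intros S x) (simp add: e lin_scl[OF p])
    also have "\<dots> = p (sw N x (\<lambda>a b. scl N (counit N a) b))"
      by (intro tsum_lin[symmetric, OF V(1) V(1) _ p] V mem_intros S x)
    finally show "sw N' x' (\<lambda>a b. scl N' (counit N' a) b) = x'"
      by (simp add: x' counit_left[OF S(2) x])
    have "sw N' (p x) (\<lambda>a b. scl N' (counit N' b) a)
        = sw N x (\<lambda>a b. scl N' (counit N' (p b)) (p a))"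
      by (intro T[where X=N'] x V bilinI lin_intros ll mem_intros)
    also have "\<dots> = sw N x (\<lambda>a b. p (scl N (counit N b) a))"
      by (intro tsum_cong V mem_intros S x) (simp add: e lin_scl[OF p])
    also have "\<dots> = p (sw N x (\<lambda>a b. scl N (counit N b) a))"
      by (intro tsum_lin[symmetric, OF V(1) V(1) _ p] V mem_intros S x)
    finally show "sw N' x' (\<lambda>a b. scl N' (counit N' b) a) = x'"
      by (simp add: x' counit_right[OF S(2) x])
  qed
  show "bialgebra N'"
  proof (rule bialgebraI[OF alg coal])
    fix x' y' assume "x' \<in> carr N'" "y' \<in> carr N'"
    then obtain x y where x: "x \<in> carr N" "y \<in> carr N" and x': "x' = p x" "y' = p y" using obt by
        blast
    let ?t = "\<lambda>x1 x2 y1 y2. tens N' N' (mul N' x1 y1) (mul N' x2 y2)"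
    have "comul N' (mul N' (p x) (p y)) = sw N (mul N x y) (\<lambda>a b. tens N' N' (p a) (p b))"
      by (simp add: m x c algebra_mul_mem S)
    also have "\<dots> = sw N x (\<lambda>x1 x2. sw N y (\<lambda>y1 y2.
        tens N' N' (p (mul N x1 y1)) (p (mul N x2 y2))))"
      by (intro tsum_comul_mul[where X="tspace N' N'"] N x V bilinI lin_intros lp)
    also have "\<dots> = sw N x (\<lambda>x1 x2. sw N y (\<lambda>y1 y2. ?t (p x1) (p x2) (p y1) (p y2)))"
      by (intro tsum_cong V mem_intros S x) (simp add: m)
    also have "\<dots> = sw N x (\<lambda>x1 x2. sw N' (p y) (\<lambda>y1 y2. ?t (p x1) (p x2) y1 y2))"
      by (intro tsum_cong T[symmetric, where X="tspace N' N'"] x V bilinI lin_intros mem_intros S lp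
          alg)
    also have "\<dots> = sw N' (p x) (\<lambda>x1 x2. sw N' (p y) (\<lambda>y1 y2. ?t x1 x2 y1 y2))"
      by (intro T[symmetric, where X="tspace N' N'"] x V bilinI lin_intros mem_intros coal alg lp)
    finally show "comul N' (mul N' x' y') = sw N' x' (\<lambda>x1 x2. sw N' y' (\<lambda>y1 y2. ?t x1 x2 y1 y2))"
      unfolding x' .
    show "counit N' (mul N' x' y') = counit N' x' * counit N' y'"
      by (simp add: x' m x e algebra_mul_mem S counit_mul[OF N])
  next
    have "comul N' (p (unit N)) = tens N' N' (p (unit N)) (p (unit N))"
      unfolding c[OF algebra_unit[OF S(1)]]
      by (intro tsum_comul_unit[where X="tspace N' N'"] N V bilinI lin_intros lp)
    then show "comul N' (unit N') = tens N' N' (unit N') (unit N')" by (simp add: u)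
    show "counit N' (unit N') = 1" by (simp add: u e algebra_unit S counit_unit[OF N])
  qed
qed

lemma cocommutative_image:
  assumes N: "bialgebra N" "cocommutative N" and N': "bialgebra N'" and p: "bialgebra_map N N' p" "p
      ` carr N = carr N'"
  shows "cocommutative N'"
  unfolding cocommutative_tens[OF bialgebra_coalgebra[OF N']]
proof
  note S = bialgebra_coalgebra[OF N(1)] bialgebra_coalgebra[OF N']
  note V = bialgebra_vect[OF N(1)] bialgebra_vect[OF N'] vect_tspace
  note lp = lin_comp[OF bialgebra_map_lin[OF p(1)]] lin_mem[OF bialgebra_map_lin[OF p(1)]]
  note cm = bialgebra_map_coalgebra_map[OF p(1)]
  fix x' assume "x' \<in> carr N'"
  then obtain x where x: "x \<in> carr N" and x': "x' = p x" using p(2) by blast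
  have "sw N' (p x) (\<lambda>a b. tens N' N' b a) = sw N x (\<lambda>a b. tens N' N' (p b) (p a))"
    by (intro tsum_coalgebra_map[where X="tspace N' N'"] S V cm x bilinI lin_intros)
  also have "\<dots> = sw N x (\<lambda>a b. tens N' N' (p a) (p b))"
    by (intro tsum_cocommutative[where X="tspace N' N'"] S N V x bilinI lin_intros lp)
  also have "\<dots> = comul N' (p x)"
    by (rule coalgebra_map_comul[OF S(1) cm x, symmetric])
  finally show "sw N' x' (\<lambda>a b. tens N' N' b a) = comul N' x'" unfolding x' .
qed

lemma bialgebra_map_descend:
  assumes N: "bialgebra N" and N': "bialgebra N'" and B: "vect B"
    and p: "bialgebra_map N N' p" "p ` carr N = carr N'"
    and h: "bialgebra_map N B h" and k: "\<And>x. x \<in> carr N \<Longrightarrow> k (p x) = h x"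
  shows "bialgebra_map N' B k"
proof (rule bialgebra_mapI[OF N'])
  note S = bialgebra_algebra[OF N] bialgebra_coalgebra[OF N]
  note V = bialgebra_vect[OF N] bialgebra_vect[OF N'] vect_tspace
  note lp = bialgebra_map_lin[OF p(1)] and lh = bialgebra_map_lin[OF h]
  have obt: "\<exists>a. a \<in> carr N \<and> x = p a" if "x \<in> carr N'" for x using that p(2) by blast
  show lk: "lin N' B k"
    by (rule lin_surj[OF V(1) lp p(2)], rule lin_cong[OF lh V(1)]) (simp add: k)
  show "k (mul N' x y) = mul B (k x) (k y)" if "x \<in> carr N'" "y \<in> carr N'" for x y
    using obt[OF that(1)] obt[OF that(2)]
    by (auto simp: k bialgebra_map_mul[OF p(1), symmetric] bialgebra_map_mul[OF h] algebra_mul_mem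
        S)
  show "k (unit N') = unit B"
    using bialgebra_map_unit[OF p(1)] bialgebra_map_unit[OF h] k algebra_unit[OF S(1)] by metis
  show "counit B (k x) = counit N' x" if "x \<in> carr N'" for x
    using obt[OF that] by (auto simp: k bialgebra_map_counit[OF p(1)] bialgebra_map_counit[OF h])
  fix x' assume "x' \<in> carr N'"
  then obtain x where x: "x \<in> carr N" and x': "x' = p x" using obt by blast
  have "sw N' (p x) (\<lambda>a b. tens B B (k a) (k b)) = sw N x (\<lambda>a b. tens B B (k (p a)) (k (p b)))"
    by (intro tsum_coalgebra_map[where X="tspace B B"] S V bialgebra_map_coalgebra_map p x bilinI
        lin_intros
      lin_comp[OF lk] lin_mem[OF lk])
  also have "\<dots> = sw N x (\<lambda>a b. tens B B (h a) (h b))"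
    by (intro tsum_cong V mem_intros S x) (simp add: k)
  also have "\<dots> = comul B (h x)"
    by (rule coalgebra_map_comul[OF S(2) bialgebra_map_coalgebra_map[OF h] x, symmetric])
  finally show "comul B (k x') = sw N' x' (\<lambda>a b. tens B B (k a) (k b))"
    by (simp add: x' k x)
qed


section \<open>Bimeasurings\<close>

lemma bimeasuring_tlift:
  assumes N: "bialgebra N" and T: "bialgebra T" and A: "algebra A" and f: "lin (tspace N T) A f"
  shows "n \<in> carr N \<Longrightarrow> m \<in> carr N \<Longrightarrow> t \<in> carr T \<Longrightarrow>
      tlift T T A (\<lambda>t1 t2. mul A (f (tens N T n t1)) (f (tens N T m t2))) (comul T t)
      = sw T t (\<lambda>t1 t2. mul A (f (tens N T n t1)) (f (tens N T m t2)))"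
    and "n \<in> carr N \<Longrightarrow> t \<in> carr T \<Longrightarrow> s \<in> carr T \<Longrightarrow>
      tlift N N A (\<lambda>n1 n2. mul A (f (tens N T n1 t)) (f (tens N T n2 s))) (comul N n)
      = sw N n (\<lambda>n1 n2. mul A (f (tens N T n1 t)) (f (tens N T n2 s)))"
  by (intro tlift_eq_tsum bialgebra_vect N T algebra_vect A bilinI lin_intros mem_intros
      bialgebra_coalgebra lin_comp[OF f] lin_mem[OF f] | assumption)+

lemma bimeasuring_lin: "bimeasuring N T A f \<Longrightarrow> lin (tspace N T) A f"
  and bimeasuring_unit_left: "bimeasuring N T A f \<Longrightarrow> t \<in> carr T \<Longrightarrow>
    f (tens N T (unit N) t) = scl A (counit T t) (unit A)"
  and bimeasuring_unit_right: "bimeasuring N T A f \<Longrightarrow> n \<in> carr N \<Longrightarrow>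
    f (tens N T n (unit T)) = scl A (counit N n) (unit A)"
  unfolding bimeasuring_def by auto

lemma bimeasuring_mul_left:
  assumes "bialgebra N" "bialgebra T" "algebra A" "bimeasuring N T A f"
    and "n \<in> carr N" "m \<in> carr N" "t \<in> carr T"
  shows "f (tens N T (mul N n m) t)
    = sw T t (\<lambda>t1 t2. mul A (f (tens N T n t1)) (f (tens N T m t2)))"
  using assms bimeasuring_tlift(1)[OF assms(1-3) bimeasuring_lin[OF assms(4)] assms(5-7)]
  unfolding bimeasuring_def by simp

lemma bimeasuring_mul_right:
  assumes "bialgebra N" "bialgebra T" "algebra A" "bimeasuring N T A f"
    and "n \<in> carr N" "t \<in> carr T" "s \<in> carr T"
  shows "f (tens N T n (mul T t s))
    = sw N n (\<lambda>n1 n2. mul A (f (tens N T n1 t)) (f (tens N T n2 s)))"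
  using assms bimeasuring_tlift(2)[OF assms(1-3) bimeasuring_lin[OF assms(4)] assms(5-7)]
  unfolding bimeasuring_def by simp

lemma bimeasuringI:
  assumes "bialgebra N" "bialgebra T" "algebra A" "lin (tspace N T) A f"
    and "\<And>n m t. n \<in> carr N \<Longrightarrow> m \<in> carr N \<Longrightarrow> t \<in> carr T \<Longrightarrow> f (tens N T (mul N n m) t)
      = sw T t (\<lambda>t1 t2. mul A (f (tens N T n t1)) (f (tens N T m t2)))"
    and "\<And>t. t \<in> carr T \<Longrightarrow> f (tens N T (unit N) t) = scl A (counit T t) (unit A)"
    and "\<And>n t s. n \<in> carr N \<Longrightarrow> t \<in> carr T \<Longrightarrow> s \<in> carr T \<Longrightarrow> f (tens N T n (mul T t s))
      = sw N n (\<lambda>n1 n2. mul A (f (tens N T n1 t)) (f (tens N T n2 s)))"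
    and "\<And>n. n \<in> carr N \<Longrightarrow> f (tens N T n (unit T)) = scl A (counit N n) (unit A)"
  shows "bimeasuring N T A f"
  unfolding bimeasuring_def using assms bimeasuring_tlift[OF assms(1-4)] by simp

text \<open>
  Bimeasurings may be pulled back along bialgebra maps in both arguments. The case of
  \<open>q : t \<mapsto> t \<otimes> 1\<close> is the restriction of bimeasurings of \<open>T \<otimes> S\<close> to \<open>T\<close>.
\<close>

lemma bimeasuring_pullback:
  assumes N: "bialgebra N" "bialgebra M" and T: "bialgebra T" "bialgebra T'" and A: "algebra A"
    and f: "bimeasuring N T A f" and p: "bialgebra_map M N p" and q: "bialgebra_map T' T q"
    and g: "lin (tspace M T') A g"
    and gf: "\<And>m t. m \<in> carr M \<Longrightarrow> t \<in> carr T' \<Longrightarrow> g (tens M T' m t) = f (tens N T (p m) (q t))"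
  shows "bimeasuring M T' A g"
proof (rule bimeasuringI[OF N(2) T(2) A g])
  note pm = bialgebra_map_mem[OF p] and qm = bialgebra_map_mem[OF q]
  note lf = lin_comp[OF bimeasuring_lin[OF f]] lin_mem[OF bimeasuring_lin[OF f]]
  note S = bialgebra_algebra[OF N(1)] bialgebra_algebra[OF N(2)] bialgebra_algebra[OF T(1)]
      bialgebra_algebra[OF T(2)]
    bialgebra_coalgebra[OF N(1)] bialgebra_coalgebra[OF N(2)] bialgebra_coalgebra[OF T(1)]
        bialgebra_coalgebra[OF T(2)]
  note V = bialgebra_vect[OF N(1)] bialgebra_vect[OF N(2)] bialgebra_vect[OF T(1)] bialgebra_vect[OF
      T(2)]
    algebra_vect[OF A]
  note maps = bialgebra_map_coalgebra_map[OF p] bialgebra_map_coalgebra_map[OF q]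
  fix n assume n: "n \<in> carr M"
  show "g (tens M T' n (unit T')) = scl A (counit M n) (unit A)"
    by (simp add: gf algebra_unit S n bialgebra_map_unit[OF q] bimeasuring_unit_right[OF f] pm
        bialgebra_map_counit[OF p])
  fix t assume t: "t \<in> carr T'"
  {
    fix m assume m: "m \<in> carr M"
    have "g (tens M T' (mul M n m) t) = f (tens N T (mul N (p n) (p m)) (q t))"
      by (simp add: gf n m t algebra_mul_mem S bialgebra_map_mul[OF p])
    also have "\<dots> = sw T (q t) (\<lambda>t1 t2. mul A (f (tens N T (p n) t1)) (f (tens N T (p m) t2)))"
      by (intro bimeasuring_mul_left[OF N(1) T(1) A f] pm qm n m t)
    also have "\<dots> = sw T' t (\<lambda>t1 t2. mul A (f (tens N T (p n) (q t1))) (f (tens N T (p m) (q t2))))"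
      by (intro tsum_coalgebra_map[where X=A] S V maps t bilinI lin_intros lf mem_intros pm n m A)
    also have "\<dots> = sw T' t (\<lambda>t1 t2. mul A (g (tens M T' n t1)) (g (tens M T' m t2)))"
      by (intro tsum_cong V mem_intros S t) (simp add: gf n m)
    finally show "g (tens M T' (mul M n m) t) = \<dots>" .
  }
  fix s assume s: "s \<in> carr T'"
  have "g (tens M T' n (mul T' t s)) = f (tens N T (p n) (mul T (q t) (q s)))"
    by (simp add: gf n s t algebra_mul_mem S bialgebra_map_mul[OF q])
  also have "\<dots> = sw N (p n) (\<lambda>n1 n2. mul A (f (tens N T n1 (q t))) (f (tens N T n2 (q s))))"
    by (intro bimeasuring_mul_right[OF N(1) T(1) A f] pm qm n s t)
  also have "\<dots> = sw M n (\<lambda>n1 n2. mul A (f (tens N T (p n1) (q t))) (f (tens N T (p n2) (q s))))"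
    by (intro tsum_coalgebra_map[where X=A] S V maps t bilinI lin_intros lf mem_intros qm n s A)
  also have "\<dots> = sw M n (\<lambda>n1 n2. mul A (g (tens M T' n1 t)) (g (tens M T' n2 s)))"
    by (intro tsum_cong V mem_intros S n) (simp add: gf s t)
  finally show "g (tens M T' n (mul T' t s)) = \<dots>" .
next
  show "g (tens M T' (unit M) t) = scl A (counit T' t) (unit A)" if t: "t \<in> carr T'" for t
    using algebra_unit[OF bialgebra_algebra[OF N(2)]] t
    by (simp add: gf bialgebra_map_unit[OF p] bimeasuring_unit_left[OF f] bialgebra_map_mem[OF q]
        bialgebra_map_counit[OF q])
qed

lemma bimeasuring_comp:
  assumes N: "bialgebra N" "bialgebra M" and T: "bialgebra T" "bialgebra T'" and A: "algebra A"
    and f: "bimeasuring N T A f" and p: "bialgebra_map M N p" and q: "bialgebra_map T' T q"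
  obtains g where "bimeasuring M T' A g"
    "\<forall>m\<in>carr M. \<forall>t\<in>carr T'. g (tens M T' m t) = f (tens N T (p m) (q t))"
proof -
  note l = bialgebra_map_lin[OF p] bialgebra_map_lin[OF q]
  note V = bialgebra_vect[OF N(2)] bialgebra_vect[OF T(2)]
  have eq: "f (tmap M T' N T p q (tens M T' m t)) = f (tens N T (p m) (q t))" if "m \<in> carr M" "t \<in>
      carr T'" for m t
    by (simp add: tmap_tens[OF V l that])
  have "bimeasuring M T' A (\<lambda>z. f (tmap M T' N T p q z))"
    by (rule bimeasuring_pullback[OF N T A f p q lin_comp[OF bimeasuring_lin[OF f] lin_tmap[OF V l]]
        eq])
  then show thesis by (rule that) (simp add: eq)
qed

lemma bimeasuring_sub:
  assumes N: "bialgebra N" "bialgebra (N\<lparr>carr := D\<rparr>)" "D \<subseteq> carr N" and T: "bialgebra T" and A: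
      "algebra A"
    and f: "bimeasuring N T A f"
  shows "bimeasuring (N\<lparr>carr := D\<rparr>) T A f"
proof (rule bimeasuring_pullback[OF N(1,2) T T A f bialgebra_map_incl[OF N(2,3)] bialgebra_map_id[OF
    T]])
  show "lin (tspace (N\<lparr>carr := D\<rparr>) T) A f"
    by (rule lin_subset[OF bimeasuring_lin[OF f]])
      (simp add: scl_tspace, rule tspace_mono, use N in auto)
qed simp

lemma bimeasuring_descend:
  assumes N: "bialgebra N" "bialgebra M" and T: "bialgebra T" and A: "algebra A"
    and g: "bimeasuring M T A g" and p: "bialgebra_map M N p" "p ` carr M = carr N"
    and f: "lin (tspace N T) A f"
    and fg: "\<And>m t. m \<in> carr M \<Longrightarrow> t \<in> carr T \<Longrightarrow> f (tens N T (p m) t) = g (tens M T m t)"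
  shows "bimeasuring N T A f"
proof (rule bimeasuringI[OF N(1) T A f])
  note lf = lin_comp[OF f] lin_mem[OF f]
  note S = bialgebra_algebra[OF N(1)] bialgebra_algebra[OF N(2)] bialgebra_algebra[OF T]
    bialgebra_coalgebra[OF N(1)] bialgebra_coalgebra[OF N(2)] bialgebra_coalgebra[OF T]
  note V = bialgebra_vect[OF N(1)] bialgebra_vect[OF N(2)] bialgebra_vect[OF T] algebra_vect[OF A]
  note cm = bialgebra_map_coalgebra_map[OF p(1)]
  have obt: "\<exists>a. a \<in> carr M \<and> x = p a" if "x \<in> carr N" for x using that p(2) by blast
  fix n' assume "n' \<in> carr N"
  then obtain n where n: "n \<in> carr M" and n': "n' = p n" using obt by blast
  show "f (tens N T n' (unit T)) = scl A (counit N n') (unit A)"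
    by (simp add: n' fg n algebra_unit S bimeasuring_unit_right[OF g] bialgebra_map_counit[OF p(1)])
  fix t assume t: "t \<in> carr T"
  {
    fix m' assume "m' \<in> carr N"
    then obtain m where m: "m \<in> carr M" and m': "m' = p m" using obt by blast
    have "f (tens N T (mul N n' m') t) = g (tens M T (mul M n m) t)"
      by (simp add: n' m' bialgebra_map_mul[OF p(1) n m, symmetric] fg algebra_mul_mem S n m t)
    also have "\<dots> = sw T t (\<lambda>t1 t2. mul A (g (tens M T n t1)) (g (tens M T m t2)))"
      by (intro bimeasuring_mul_left[OF N(2) T A g] n m t)
    also have "\<dots> = sw T t (\<lambda>t1 t2. mul A (f (tens N T n' t1)) (f (tens N T m' t2)))"
      by (intro tsum_cong V mem_intros S t) (simp add: fg n m n' m')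
    finally show "f (tens N T (mul N n' m') t) = \<dots>" .
  }
  fix s assume s: "s \<in> carr T"
  have "f (tens N T n' (mul T t s)) = g (tens M T n (mul T t s))"
    by (simp add: n' fg n algebra_mul_mem S s t)
  also have "\<dots> = sw M n (\<lambda>n1 n2. mul A (g (tens M T n1 t)) (g (tens M T n2 s)))"
    by (intro bimeasuring_mul_right[OF N(2) T A g] n s t)
  also have "\<dots> = sw M n (\<lambda>n1 n2. mul A (f (tens N T (p n1) t)) (f (tens N T (p n2) s)))"
    by (intro tsum_cong V mem_intros S n) (simp add: fg s t)
  also have "\<dots> = sw N n' (\<lambda>n1 n2. mul A (f (tens N T n1 t)) (f (tens N T n2 s)))"
    unfolding n' by (intro tsum_coalgebra_map[symmetric, where X=A] S V cm n bilinI lin_intros lf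
        mem_intros A s t)
  finally show "f (tens N T n' (mul T t s)) = \<dots>" .
next
  show "f (tens N T (unit N) t) = scl A (counit T t) (unit A)" if t: "t \<in> carr T" for t
    using fg[OF algebra_unit[OF bialgebra_algebra[OF N(2)]] t] bimeasuring_unit_left[OF g t]
      bialgebra_map_unit[OF p(1)] by simp
qed

lemma factors_through_iff:
  assumes V: "vect N" "vect T" "vect A" and f: "lin (tspace N T) A f" and h: "lin N B h" and g: "lin
      (tspace B T) A g"
  shows "factors_through N B T g f h \<longleftrightarrow>
    (\<forall>n\<in>carr N. \<forall>t\<in>carr T. f (tens N T n t) = g (tens B T (h n) t))"
proof
  note t = tmap_tens[OF V(1,2) h lin_id]
  show "\<forall>n\<in>carr N. \<forall>t\<in>carr T. f (tens N T n t) = g (tens B T (h n) t)" if "factors_through N B T g f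
      h"
    using that tens_in_tspace unfolding factors_through_def by (metis t)
  assume *: "\<forall>n\<in>carr N. \<forall>t\<in>carr T. f (tens N T n t) = g (tens B T (h n) t)"
  show "factors_through N B T g f h" unfolding factors_through_def
    by (rule tens_ballI[OF f lin_comp[OF g lin_tmap[OF V(1,2) h lin_id]]]) (simp add: t *)
qed

text \<open>
  Commutativity of \<open>A\<close> enters here: the two middle factors change places. Both multiplicativity
  laws of the product of two bimeasurings have this form.
\<close>

lemma mul_tsum_tsum:
  assumes A: "comm_algebra A" and V: "vect V" "vect V'" and x: "x \<in> carr (tspace V V)" "y \<in> carr
      (tspace V' V')"
    and m: "\<And>v. v \<in> carr V \<Longrightarrow> p v \<in> carr A" "\<And>v. v \<in> carr V \<Longrightarrow> q v \<in> carr A"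
      "\<And>v. v \<in> carr V' \<Longrightarrow> r v \<in> carr A" "\<And>v. v \<in> carr V' \<Longrightarrow> u v \<in> carr A"
  shows "mul A (tsum V V x (\<lambda>a b. mul A (p a) (q b))) (tsum V' V' y (\<lambda>c d. mul A (r c) (u d)))
    = tsum V V x (\<lambda>a b. tsum V' V' y (\<lambda>c d. mul A (mul A (p a) (r c)) (mul A (q b) (u d))))"
proof -
  note al = comm_algebra_algebra[OF A]
  note VA = algebra_vect[OF al]
  have "mul A (tsum V V x (\<lambda>a b. mul A (p a) (q b))) (tsum V' V' y (\<lambda>c d. mul A (r c) (u d)))
      = tsum V V x (\<lambda>a b. mul A (mul A (p a) (q b)) (tsum V' V' y (\<lambda>c d. mul A (r c) (u d))))"
    by (intro tsum_lin[where X=A and Y=A and L="\<lambda>z. mul A z _"] V VA x lin_intros al mem_intros m)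
  also have "\<dots> = tsum V V x (\<lambda>a b. tsum V' V' y (\<lambda>c d. mul A (mul A (p a) (q b)) (mul A (r c) (u
      d))))"
    by (intro tsum_cong tsum_lin[where X=A and Y=A] V VA x lin_intros al mem_intros m)
  also have "\<dots> = tsum V V x (\<lambda>a b. tsum V' V' y (\<lambda>c d. mul A (mul A (p a) (r c)) (mul A (q b) (u
      d))))"
    by (intro tsum_cong comm_algebra_interchange A V x m)
  finally show ?thesis .
qed

lemma scl_unit_mul:
  assumes A: "algebra A" and x: "x \<in> carr A"
  shows "mul A x (scl A c (unit A)) = scl A c x" and "mul A (scl A c (unit A)) x = scl A c x"
  using lin_scl[OF bilin_lin2[OF algebra_mul[OF A] x] algebra_unit[OF A], of c]
    lin_scl[OF bilin_lin1[OF algebra_mul[OF A] x] algebra_unit[OF A], of c]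
    algebra_unit_left[OF A x] algebra_unit_right[OF A x] by auto

lemma bimeasuring_tensor:
  assumes B: "bialgebra B" "bialgebra C" and T: "bialgebra T" "bialgebra S" and A: "comm_algebra A"
    and f: "bimeasuring B T A f" and g: "bimeasuring C S A g"
    and psi: "lin (tspace (tspace B C) (tspace T S)) A \<psi>"
    and eq: "\<And>b c t s. b \<in> carr B \<Longrightarrow> c \<in> carr C \<Longrightarrow> t \<in> carr T \<Longrightarrow> s \<in> carr S \<Longrightarrow>
      \<psi> (tens (tspace B C) (tspace T S) (tens B C b c) (tens T S t s)) = mul A (f (tens B T b t)) (g
          (tens C S c s))"
  shows "bimeasuring (tensor_bialg B C) (tensor_bialg T S) A \<psi>"
proof (rule bimeasuringI[OF bialgebra_tensor[OF B] bialgebra_tensor[OF T] comm_algebra_algebra[OF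
    A]];
    (unfold tensor_bialg_simps)?)
  let ?W = "tspace B C" and ?P = "tensor_bialg B C" and ?W' = "tspace T S" and ?P' = "tensor_bialg T
      S"
  note al = comm_algebra_algebra[OF A]
  note S = bialgebra_algebra[OF B(1)] bialgebra_algebra[OF B(2)] bialgebra_algebra[OF T(1)]
      bialgebra_algebra[OF T(2)]
    bialgebra_coalgebra[OF B(1)] bialgebra_coalgebra[OF B(2)] bialgebra_coalgebra[OF T(1)]
        bialgebra_coalgebra[OF T(2)] al
  note V = bialgebra_vect[OF B(1)] bialgebra_vect[OF B(2)] bialgebra_vect[OF T(1)] bialgebra_vect[OF
      T(2)]
    algebra_vect[OF al] vect_tspace
  note d = comul_tensor_bilin(1)[OF S(5,6)] and e = counit_tensor(1)[OF S(5,6)]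
  note d' = comul_tensor_bilin(1)[OF S(7,8)] and e' = counit_tensor(1)[OF S(7,8)]
  note t = bilin_tmul[OF S(1,2)] and t' = bilin_tmul[OF S(3,4)]
  note m = lin_comp[OF d] lin_mem[OF d] lin_comp[OF e] bilin_mem[OF t] lin_bilin1[OF t]
      lin_bilin2[OF t]
    lin_comp[OF d'] lin_mem[OF d'] lin_comp[OF e'] bilin_mem[OF t'] lin_bilin1[OF t'] lin_bilin2[OF
        t']
    lin_comp[OF psi] lin_mem[OF psi]
  note fm = lin_mem[OF bimeasuring_lin[OF f]] lin_mem[OF bimeasuring_lin[OF g]]
  let ?f = "\<lambda>b t. f (tens B T b t)" and ?g = "\<lambda>c s. g (tens C S c s)" and ?p = "\<lambda>x y. \<psi> (tens ?W ?W'
      x y)"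
  show "lin (tspace ?W ?W') A \<psi>" by (rule psi)
  have "\<forall>x\<in>carr ?W. \<forall>y\<in>carr ?W. \<forall>z\<in>carr ?W'. ?p (tmul B C x y) z
      = tsum ?W' ?W' (comul ?P' z) (\<lambda>z1 z2. mul A (?p x z1) (?p y z2))"
  proof (rule tens_ballI3[where X=A])
    fix b c b' c' t s assume h: "b \<in> carr B" "c \<in> carr C" "b' \<in> carr B" "c' \<in> carr C" "t \<in> carr T"
        "s \<in> carr S"
    have "?p (tmul B C (tens B C b c) (tens B C b' c')) (tens T S t s) = mul A (?f (mul B b b') t)
        (?g (mul C c c') s)"
      by (simp add: tmul_tens S h eq algebra_mul_mem)
    also have "\<dots> = mul A (sw T t (\<lambda>t1 t2. mul A (?f b t1) (?f b' t2)))
        (sw S s (\<lambda>s1 s2. mul A (?g c s1) (?g c' s2)))"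
      by (simp only: bimeasuring_mul_left[OF B(1) T(1) al f h(1,3,5)] bimeasuring_mul_left[OF B(2)
          T(2) al g h(2,4,6)])
    also have "\<dots> = sw T t (\<lambda>t1 t2. sw S s (\<lambda>s1 s2.
        mul A (mul A (?f b t1) (?g c s1)) (mul A (?f b' t2) (?g c' s2))))"
      by (intro mul_tsum_tsum A V mem_intros S h fm)
    also have "\<dots> = sw T t (\<lambda>t1 t2. sw S s (\<lambda>s1 s2.
        mul A (?p (tens B C b c) (tens T S t1 s1)) (?p (tens B C b' c') (tens T S t2 s2))))"
      by (intro tsum_cong V mem_intros S h) (simp add: eq h)
    also have "\<dots> = tsum ?W' ?W' (comul ?P' (tens T S t s)) (\<lambda>z1 z2. mul A (?p (tens B C b c) z1) (?p
        (tens B C b' c') z2))"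
      by (intro tsum_comul_tensor[symmetric, where X=A] S V h bilinI lin_intros mem_intros m)
    finally show "?p (tmul B C (tens B C b c) (tens B C b' c')) (tens T S t s) = \<dots>" .
  qed (intro lin_intros m V S bilinI mem_intros | assumption)+
  then show "?p (tmul B C x y) z = tsum ?W' ?W' (comul ?P' z) (\<lambda>z1 z2. mul A (?p x z1) (?p y z2))"
    if "x \<in> carr ?W" "y \<in> carr ?W" "z \<in> carr ?W'" for x y z
    using that by blast
  have "\<forall>x\<in>carr ?W. \<forall>y\<in>carr ?W'. \<forall>z\<in>carr ?W'. ?p x (tmul T S y z)
      = tsum ?W ?W (comul ?P x) (\<lambda>x1 x2. mul A (?p x1 y) (?p x2 z))"
  proof (rule tens_ballI3[where X=A])
    fix b c t s t' s' assume h: "b \<in> carr B" "c \<in> carr C" "t \<in> carr T" "s \<in> carr S" "t' \<in> carr T"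
        "s' \<in> carr S"
    have "?p (tens B C b c) (tmul T S (tens T S t s) (tens T S t' s')) = mul A (?f b (mul T t t'))
        (?g c (mul S s s'))"
      by (simp add: tmul_tens S h eq algebra_mul_mem)
    also have "\<dots> = mul A (sw B b (\<lambda>b1 b2. mul A (?f b1 t) (?f b2 t')))
        (sw C c (\<lambda>c1 c2. mul A (?g c1 s) (?g c2 s')))"
      by (simp only: bimeasuring_mul_right[OF B(1) T(1) al f h(1,3,5)] bimeasuring_mul_right[OF B(2)
          T(2) al g h(2,4,6)])
    also have "\<dots> = sw B b (\<lambda>b1 b2. sw C c (\<lambda>c1 c2.
        mul A (mul A (?f b1 t) (?g c1 s)) (mul A (?f b2 t') (?g c2 s'))))"
      by (intro mul_tsum_tsum A V mem_intros S h fm)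
    also have "\<dots> = sw B b (\<lambda>b1 b2. sw C c (\<lambda>c1 c2.
        mul A (?p (tens B C b1 c1) (tens T S t s)) (?p (tens B C b2 c2) (tens T S t' s'))))"
      by (intro tsum_cong V mem_intros S h) (simp add: eq h)
    also have "\<dots> = tsum ?W ?W (comul ?P (tens B C b c)) (\<lambda>x1 x2. mul A (?p x1 (tens T S t s)) (?p x2
        (tens T S t' s')))"
      by (intro tsum_comul_tensor[symmetric, where X=A] S V h bilinI lin_intros mem_intros m)
    finally show "?p (tens B C b c) (tmul T S (tens T S t s) (tens T S t' s')) = \<dots>" .
  qed (intro lin_intros m V S bilinI mem_intros | assumption)+
  then show "?p x (tmul T S y z) = tsum ?W ?W (comul ?P x) (\<lambda>x1 x2. mul A (?p x1 y) (?p x2 z))"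
    if "x \<in> carr ?W" "y \<in> carr ?W'" "z \<in> carr ?W'" for x y z
    using that by blast
  have "\<forall>z\<in>carr ?W'. ?p (tens B C (unit B) (unit C)) z = scl A (counit ?P' z) (unit A)"
  proof (rule tens_ballI[where X=A])
    fix t s assume h: "t \<in> carr T" "s \<in> carr S"
    show "?p (tens B C (unit B) (unit C)) (tens T S t s) = scl A (counit ?P' (tens T S t s)) (unit
        A)"
      by (simp add: eq h S algebra_unit bimeasuring_unit_left[OF f] bimeasuring_unit_left[OF g]
          counit_tensor(2) scl_unit_mul[OF al] vect_scl[OF V(5)] vect_scl_scl[OF V(5)] mult.commute)
  qed (intro lin_intros m V S bilinI mem_intros | assumption)+
  then show "?p (tens B C (unit B) (unit C)) z = scl A (counit ?P' z) (unit A)" if "z \<in> carr ?W'"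
      for z
    using that by blast
  have "\<forall>x\<in>carr ?W. ?p x (tens T S (unit T) (unit S)) = scl A (counit ?P x) (unit A)"
  proof (rule tens_ballI[where X=A])
    fix b c assume h: "b \<in> carr B" "c \<in> carr C"
    show "?p (tens B C b c) (tens T S (unit T) (unit S)) = scl A (counit ?P (tens B C b c)) (unit
        A)"
      by (simp add: eq h S algebra_unit bimeasuring_unit_right[OF f] bimeasuring_unit_right[OF g]
          counit_tensor(2) scl_unit_mul[OF al] vect_scl[OF V(5)] vect_scl_scl[OF V(5)] mult.commute)
  qed (intro lin_intros m V S bilinI mem_intros | assumption)+
  then show "?p x (tens T S (unit T) (unit S)) = scl A (counit ?P x) (unit A)" if "x \<in> carr ?W" for
      x
    using that by blast
qed


section \<open>Subbialgebras of countable dimension\<close>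

lemma span_subset_carr:
  assumes "vect V" "G \<subseteq> carr V" shows "module.span (scl V) G \<subseteq> carr V"
proof -
  interpret vector_space "scl V" using assms(1) by (simp add: vect_def)
  show ?thesis using assms by (intro span_minimal) (auto simp: vect_def)
qed

lemma lin_span_mem:
  assumes V: "vect V" and W: "vect W" and f: "lin V W f" and G: "G \<subseteq> carr V"
    and D: "module.subspace (scl W) D" and fG: "f ` G \<subseteq> D" and x: "x \<in> module.span (scl V) G"
  shows "f x \<in> D"
proof -
  interpret V: vector_space "scl V" using V by (simp add: vect_def)
  interpret W: vector_space "scl W" using W by (simp add: vect_def)
  have "x \<in> carr V \<and> f x \<in> D" using x
  proof (induction rule: V.span_induct_alt)
    case base
    then show ?case using lin_0[OF f V] W.subspace_0[OF D] vect_zero[OF V] by simp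
  next
    case (step c y z)
    have y: "y \<in> carr V" "f y \<in> D" using step G fG by auto
    have "f (scl V c y + z) = scl W c (f y) + f z"
      using lin_add[OF f vect_scl[OF V y(1)]] lin_scl[OF f y(1)] step by simp
    then show ?case
      using step y vect_add[OF V vect_scl[OF V y(1)]] W.subspace_add[OF D W.subspace_scale[OF D
          y(2)]] by simp
  qed
  then show ?thesis ..
qed

definition countable_sub :: "('k::field, 'v::ab_group_add, 'm) kbialg_scheme \<Rightarrow> 'v set \<Rightarrow> bool" where
  "countable_sub N D \<longleftrightarrow> D \<subseteq> carr N \<and> bialgebra (N\<lparr>carr := D\<rparr>)
     \<and> (\<exists>G. countable G \<and> D = module.span (scl N) G)"

text \<open>
  Closing \<open>X \<union> {1}\<close> under products and under the entries of one chosen decomposition of each \<open>\<Delta> x\<close>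
  gives a countable set \<open>G\<close>. By bilinearity the span of \<open>G\<close> is closed under products, and \<open>\<Delta>\<close> maps
  it into its tensor square.
\<close>

lemma countable_sub_exists:
  assumes N: "bialgebra N" and X: "countable X" "X \<subseteq> carr N"
  shows "\<exists>D. countable_sub N D \<and> X \<subseteq> D"
proof -
  note S = bialgebra_algebra[OF N] bialgebra_coalgebra[OF N]
  note V = bialgebra_vect[OF N]
  interpret V: vector_space "scl N" using V by (simp add: vect_def)
  define F where "F x = fst ` set (trep N N (comul N x)) \<union> snd ` set (trep N N (comul N x))" for x
  define step where "step Y = Y \<union> (\<lambda>(x, y). mul N x y) ` (Y \<times> Y) \<union> (\<Union>x\<in>Y. F x)" for Y
  define H where "H n = (step ^^ n) (insert (unit N) X)" for n
  define G where "G = (\<Union>n. H n)"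
  have H0: "H 0 = insert (unit N) X" and HS: "H (Suc n) = step (H n)" for n
    by (simp_all add: H_def)
  have FN: "F x \<subseteq> carr N" if "x \<in> carr N" for x
    using trep_set[OF V comul_mem[OF S(2) that]] unfolding F_def by auto
  have HN: "H n \<subseteq> carr N \<and> countable (H n)" for n
  proof (induction n)
    case 0
    then show ?case using X algebra_unit[OF S(1)] by (simp add: H0)
  next
    case (Suc n)
    moreover have "countable (F x)" for x unfolding F_def by (intro countable_Un countable_image
        countable_finite) auto
    ultimately show ?case
      using algebra_mul_mem[OF S(1)] FN unfolding HS step_def by (auto simp: subset_iff)
  qed
  have mono: "H m \<subseteq> H n" if "m \<le> n" for m n
    using that by (rule lift_Suc_mono_le[rotated]) (auto simp: HS step_def)
  have GN: "G \<subseteq> carr N" and cG: "countable G" using HN unfolding G_def by auto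
  have Gm: "mul N x y \<in> G" if xy: "x \<in> G" "y \<in> G" for x y
  proof -
    obtain m n where "x \<in> H m" "y \<in> H n" using xy unfolding G_def by blast
    then have "x \<in> H (max m n)" "y \<in> H (max m n)" using mono[of m "max m n"] mono[of n "max m n"] by
        auto
    then have "mul N x y \<in> H (Suc (max m n))" unfolding HS step_def by blast
    then show ?thesis unfolding G_def by blast
  qed
  have GF: "F x \<subseteq> G" if "x \<in> G" for x
  proof -
    from that have "\<exists>m. x \<in> H m" unfolding G_def by blast
    then obtain m where "x \<in> H m" ..
    then have "F x \<subseteq> H (Suc m)" unfolding HS step_def by blast
    then show ?thesis unfolding G_def by blast
  qed
  have uXG: "unit N \<in> G" "X \<subseteq> G" using H0 unfolding G_def by blast+
  define D where "D = V.span G"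
  let ?D = "N\<lparr>carr := D\<rparr>"
  have DN: "D \<subseteq> carr N" unfolding D_def by (rule span_subset_carr[OF V GN])
  have GD: "G \<subseteq> D" unfolding D_def by (rule V.span_superset)
  have sD: "V.subspace D" unfolding D_def by (rule V.subspace_span)
  have VD: "vect ?D" unfolding vect_def using sD by (simp add: V.vector_space_axioms)
  have m1: "mul N x y \<in> D" if "x \<in> D" "y \<in> G" for x y
    by (rule lin_span_mem[OF V V bilin_lin1[OF algebra_mul[OF S(1)]] GN sD])
      (use that GN GD Gm in \<open>auto simp: D_def\<close>)
  have m2: "mul N x y \<in> D" if "x \<in> D" "y \<in> D" for x y
    by (rule lin_span_mem[OF V V bilin_lin2[OF algebra_mul[OF S(1)]] GN sD])
      (use that m1 DN in \<open>auto simp: D_def\<close>)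
  have cG2: "comul N x \<in> carr (tspace ?D ?D)" if x: "x \<in> G" for x
  proof -
    have "comul N x = (\<Sum>(v, w)\<leftarrow>trep N N (comul N x). tens N N v w)"
      using x GN by (intro trep_eq[OF V] comul_mem S) auto
    moreover have "set (trep N N (comul N x)) \<subseteq> D \<times> D"
      using GF[OF x] GD unfolding F_def by force
    then have "(\<Sum>(v, w)\<leftarrow>trep N N (comul N x). tens N N v w) \<in> carr (tspace ?D ?D)"
      using tens_in_tspace[of _ ?D _ ?D] by (intro vect_sum_list vect_tspace) auto
    ultimately show ?thesis by simp
  qed
  have "bialgebra ?D"
  proof (rule sub_bialgebraI[OF N DN VD _ m2])
    show "unit N \<in> D" using uXG GD by blast
    show "comul N x \<in> carr (tspace ?D ?D)" if "x \<in> D" for x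
    proof (rule lin_span_mem[OF V vect_tspace coalgebra_comul[OF S(2)] GN])
      show "module.subspace (scl (tspace N N)) (carr (tspace ?D ?D))"
        using vect_tspace[of ?D ?D] unfolding vect_def by (simp add: scl_tspace)
    qed (use that cG2 in \<open>auto simp: D_def\<close>)
  qed
  then have "countable_sub N D" unfolding countable_sub_def using DN cG D_def by blast
  moreover have "X \<subseteq> D" using uXG GD by blast
  ultimately show ?thesis by blast
qed


section \<open>Quotients by biideals\<close>

text \<open>
  The span in the last condition is \<open>J \<otimes> M + M \<otimes> J\<close>.
\<close>

definition biideal :: "('k::field, 'v::ab_group_add, 'm) kbialg_scheme \<Rightarrow> 'v set \<Rightarrow> bool" where
  "biideal M J \<longleftrightarrow> J \<subseteq> carr M \<and> module.subspace (scl M) J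
     \<and> (\<forall>x\<in>J. \<forall>m\<in>carr M. mul M m x \<in> J \<and> mul M x m \<in> J)
     \<and> (\<forall>x\<in>J. counit M x = 0)
     \<and> (\<forall>x\<in>J. comul M x \<in> module.span pt_scale
          {tens M M a b | a b. a \<in> carr M \<and> b \<in> carr M \<and> (a \<in> J \<or> b \<in> J)})"

lemma biideal_zero:
  assumes M: "bialgebra M" shows "biideal M {0}"
proof -
  note S = bialgebra_algebra[OF M] bialgebra_coalgebra[OF M]
  note V = bialgebra_vect[OF M]
  interpret V: vector_space "scl M" using V by (simp add: vect_def)
  interpret P: vector_space pt_scale by (rule vector_space_pt_scale)
  have "comul M 0 = 0" "counit M 0 = 0" "mul M m 0 = 0" "mul M 0 m = 0" if "m \<in> carr M" for m
    using lin_0[OF coalgebra_comul[OF S(2)] V] lin_0[OF coalgebra_counit[OF S(2)] V]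
      lin_0[OF bilin_lin1[OF algebra_mul[OF S(1)] that] V] lin_0[OF bilin_lin2[OF algebra_mul[OF
          S(1)] that] V] by auto
  then show ?thesis
    unfolding biideal_def using vect_zero[OF V] V.subspace_single_0 by (auto simp: P.span_zero simp
        del: zero_fun_apply)
qed

text \<open>
  A basis of \<open>J\<close> is extended to a basis of \<open>M\<close> by elements of \<open>G\<close>. As \<open>G\<close> is countable, the
  additional elements inject into an infinite independent set of the universe, and the basis of
  \<open>J\<close> is sent to \<open>0\<close>.
\<close>

lemma linear_map_with_kernel:
  fixes M :: "('k::field, 'v::ab_group_add, 'm) vspace_scheme"
  assumes U: "large_universe TYPE('k) TYPE('u::ab_group_add)" and V: "vect M"
    and G: "countable G" "carr M = module.span (scl M) G"
    and J: "J \<subseteq> carr M" "module.subspace (scl M) J"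
  obtains s :: "'k \<Rightarrow> 'u::ab_group_add \<Rightarrow> 'u" and p where "vector_space s" "Vector_Spaces.linear (scl
      M) s p"
    "\<And>x. x \<in> carr M \<Longrightarrow> p x = 0 \<longleftrightarrow> x \<in> J"
proof -
  obtain s :: "'k \<Rightarrow> 'u \<Rightarrow> 'u" and X where s: "vector_space s" "infinite X" "\<not> module.dependent s X"
    using U unfolding large_universe_def by blast
  interpret V: vector_space "scl M" using V by (simp add: vect_def)
  interpret U: vector_space s by (rule s(1))
  interpret VU: vector_space_pair "scl M" s ..
  obtain E where E: "E \<subseteq> J" "V.independent E" "J \<subseteq> V.span E"
    by (rule V.basis_exists[of J]) blast
  have spE: "V.span E = J" using E V.span_minimal[OF E(1) J(2)] by blast
  obtain B where B: "E \<subseteq> B" "B \<subseteq> E \<union> G" "V.independent B" "E \<union> G \<subseteq> V.span B"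
    by (rule V.maximal_independent_subset_extend[of E "E \<union> G"]) (use E in auto)
  have "countable (B - E)" by (rule countable_subset[OF _ G(1)]) (use B in auto)
  moreover obtain e :: "nat \<Rightarrow> 'u" where e: "inj e" "range e \<subseteq> X"
    using infinite_countable_subset[OF s(2)] by blast
  ultimately obtain j where j: "inj_on j (B - E)" "j ` (B - E) \<subseteq> X"
  proof -
    assume c: "countable (B - E)" and th: "\<And>j. inj_on j (B - E) \<Longrightarrow> j ` (B - E) \<subseteq> X \<Longrightarrow> thesis"
    show thesis
      by (rule th[of "e \<circ> to_nat_on (B - E)"])
        (use e inj_on_to_nat_on[OF c] in \<open>auto intro!: comp_inj_on intro: inj_on_subset\<close>)
  qed
  obtain p where p: "Vector_Spaces.linear (scl M) s p" "\<forall>x\<in>B. p x = (if x \<in> E then 0 else j x)"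
    using VU.linear_independent_extend[OF B(3), of "\<lambda>x. if x \<in> E then 0 else j x"] by blast
  interpret p: Vector_Spaces.linear "scl M" s p by (rule p(1))
  have p0: "p x = 0" if "x \<in> V.span E" for x
  proof -
    have "p x = 0" if "x \<in> V.span E" for x
      using that
    proof (induction rule: V.span_induct_alt)
      case (step c y z)
      then have "p y = 0" using p(2) B(1) by auto
      with step show ?case by (simp add: p.add p.scale)
    qed (simp add: p.zero)
    then show ?thesis using that .
  qed
  have pj: "p x = j x" if "x \<in> B - E" for x using p(2) that by auto
  have "U.independent (p ` (B - E))"
    using U.independent_mono[OF s(3)] j(2) pj by (metis image_cong)
  moreover have "inj_on p (B - E)" using j(1) pj by (metis inj_on_cong)
  ultimately have inj: "inj_on p (V.span (B - E))"
    by (rule p.inj_on_span_independent_image)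
  have "p x = 0 \<longleftrightarrow> x \<in> J" if x: "x \<in> carr M" for x
  proof
    assume px: "p x = 0"
    have "G \<subseteq> V.span B" using B(4) by blast
    then have "V.span G \<subseteq> V.span B" by (rule V.span_minimal) (rule V.subspace_span)
    then have "x \<in> V.span (E \<union> (B - E))" using x G(2) B(1) by (auto simp: Un_absorb1)
    then obtain a b where ab: "x = a + b" "a \<in> V.span E" "b \<in> V.span (B - E)"
      unfolding V.span_Un by blast
    have "p b = p 0" using px ab(1) p0[OF ab(2)] by (simp add: p.add p.zero)
    then have "b = 0" using inj_onD[OF inj _ ab(3) V.span_zero] by blast
    then show "x \<in> J" using ab spE by simp
  next
    assume "x \<in> J"
    then show "p x = 0" using spE p0 by blast
  qed
  then show thesis using that[OF s(1) p(1)] by blast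
qed

text \<open>
  The quotient \<open>M / J\<close> is realized on the image of a linear map \<open>p\<close> with kernel \<open>J\<close>, its structure
  being defined through representatives. The case \<open>J = {0}\<close> gives a copy of \<open>M\<close> on the type \<open>'u\<close>.
\<close>

lemma quotient_bialgebra:
  fixes M :: "('k::field, 'v::ab_group_add, 'm) kbialg_scheme"
  assumes U: "large_universe TYPE('k) TYPE('u::ab_group_add)" and M: "bialgebra M"
    and G: "countable G" "carr M = module.span (scl M) G" and J: "biideal M J"
  obtains N :: "('k, 'u::ab_group_add) kbialg" and p where "bialgebra N" "bialgebra_map M N p" "p `
      carr M = carr N"
    "\<And>x. x \<in> carr M \<Longrightarrow> p x = 0 \<longleftrightarrow> x \<in> J"
proof -
  note S = bialgebra_algebra[OF M] bialgebra_coalgebra[OF M]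
  note V = bialgebra_vect[OF M]
  have J': "J \<subseteq> carr M" "module.subspace (scl M) J" using J unfolding biideal_def by auto
  obtain s :: "'k \<Rightarrow> 'u \<Rightarrow> 'u" and p where s: "vector_space s" "Vector_Spaces.linear (scl M) s p"
    and ker: "\<And>x. x \<in> carr M \<Longrightarrow> p x = 0 \<longleftrightarrow> x \<in> J"
    by (rule linear_map_with_kernel[OF U V G J']) blast
  interpret V: vector_space "scl M" using V by (simp add: vect_def)
  interpret U: vector_space s by (rule s(1))
  interpret p: Vector_Spaces.linear "scl M" s p by (rule s(2))
  interpret P: vector_space pt_scale by (rule vector_space_pt_scale)
  define W :: "('k, 'u) vspace" where "W = \<lparr>carr = p ` carr M, scl = s\<rparr>"
  define g where "g = inv_into (carr M) p"
  define L where "L z = tsum M M z (\<lambda>a b. tens W W (p a) (p b))" for z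
  define N :: "('k, 'u) kbialg" where "N = \<lparr>carr = p ` carr M, scl = s,
     mul = \<lambda>x y. p (mul M (g x) (g y)), unit = p (unit M),
     comul = \<lambda>x. L (comul M (g x)), counit = \<lambda>x. counit M (g x)\<rparr>"
  have tW: "tens N N = tens W W" by (rule tens_scl_cong) (simp_all add: N_def W_def)
  have "module.subspace s (p ` carr M)"
    by (rule p.subspace_image) (use V in \<open>simp add: vect_def\<close>)
  then have VW: "vect W" and VN: "vect N" unfolding vect_def W_def N_def by (simp_all add: s(1))
  have lp: "lin M N p" and lpW: "lin M W p" unfolding lin_def N_def W_def by (auto simp: p.add
      p.scale)
  have lL: "lin (tspace M M) (tspace W W) L"
    unfolding L_def by (intro lin_tsum V vect_tspace bilinI lin_intros lpW lin_mem[OF lpW])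
  have g: "g (p x) \<in> carr M" "p (g (p x)) = p x" if "x \<in> carr M" for x
    using that unfolding g_def by (auto intro: inv_into_into f_inv_into_f)
  have gJ: "g (p x) - x \<in> J" if x: "x \<in> carr M" for x
    using ker[OF vect_diff[OF V g(1)[OF x] x]] g(2)[OF x] by (simp add: p.diff)
  have eqp: "p x = p y" if "x \<in> carr M" "y \<in> carr M" "x - y \<in> J" for x y
    using ker[OF vect_diff[OF V that(1,2)]] that(3) by (simp add: p.diff)
  have sJ: "V.subspace J" using J' by blast
  have L0: "L z = 0" if z: "z \<in> P.span {tens M M a b | a b. a \<in> carr M \<and> b \<in> carr M \<and> (a \<in> J \<or> b \<in>
      J)}" for z
  proof -
    have "L z \<in> {0}"
    proof (rule lin_span_mem[OF vect_tspace vect_tspace lL])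
      show "z \<in> module.span (scl (tspace M M)) {tens M M a b | a b. a \<in> carr M \<and> b \<in> carr M \<and> (a \<in> J
          \<or> b \<in> J)}"
        using z by (simp add: scl_tspace)
      show "module.subspace (scl (tspace W W)) {0}" unfolding scl_tspace by (rule
          P.subspace_single_0)
      have "tens W W (p a) (p b) = 0" if "a \<in> carr M" "b \<in> carr M" "a \<in> J \<or> b \<in> J" for a b
        using that(3)
      proof
        assume "a \<in> J"
        then have "p a = 0" using ker[OF that(1)] by simp
        then show ?thesis
          using lin_0[OF bilin_lin1[OF bilin_tens lin_mem[OF lpW that(2)]] VW] by simp
      next
        assume "b \<in> J"
        then have "p b = 0" using ker[OF that(2)] by simp
        then show ?thesis
          using lin_0[OF bilin_lin2[OF bilin_tens lin_mem[OF lpW that(1)]] VW] by simp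
      qed
      moreover have "L (tens M M a b) = tens W W (p a) (p b)" if "a \<in> carr M" "b \<in> carr M" for a b
        unfolding L_def by (intro tsum_tens[where X="tspace W W"] V vect_tspace bilinI lin_intros
            lpW lin_mem[OF lpW] that)
      ultimately show "L ` {tens M M a b | a b. a \<in> carr M \<and> b \<in> carr M \<and> (a \<in> J \<or> b \<in> J)} \<subseteq> {0}"
        by (auto simp del: zero_fun_apply)
    qed (auto intro: tens_in_tspace)
    then show ?thesis by blast
  qed
  have mm: "mul N (p x) (p y) = p (mul M x y)" if xy: "x \<in> carr M" "y \<in> carr M" for x y
  proof -
    note b = algebra_mul[OF S(1)]
    have "mul M (g (p x)) (g (p y)) - mul M x y = mul M (g (p x) - x) (g (p y)) + mul M x (g (p y) -
        y)"
      by (simp add: lin_minus[OF bilin_lin1[OF b] V] lin_minus[OF bilin_lin2[OF b] V] g xy)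
    moreover have "mul M (g (p x) - x) (g (p y)) + mul M x (g (p y) - y) \<in> J"
      using J gJ[OF xy(1)] gJ[OF xy(2)] g[OF xy(2)] xy unfolding biideal_def by (intro
          V.subspace_add[OF sJ]) auto
    ultimately have "p (mul M (g (p x)) (g (p y))) = p (mul M x y)"
      by (intro eqp algebra_mul_mem S g xy) simp
    then show ?thesis by (simp add: N_def)
  qed
  have cc: "comul N (p x) = sw M x (\<lambda>a b. tens N N (p a) (p b))" if x: "x \<in> carr M" for x
  proof -
    have "L (comul M (g (p x))) - L (comul M x) = L (comul M (g (p x)) - comul M x)"
      by (rule lin_minus[OF lL vect_tspace, symmetric]) (intro comul_mem S g x)+
    also have "\<dots> = L (comul M (g (p x) - x))"
      by (simp add: lin_minus[OF coalgebra_comul[OF S(2)] V] g x)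
    also have "\<dots> = 0"
      by (rule L0) (use gJ[OF x] J in \<open>simp add: biideal_def\<close>)
    finally have "L (comul M (g (p x))) = L (comul M x)" by simp
    then show ?thesis unfolding tW by (simp add: N_def L_def)
  qed
  have ee: "counit N (p x) = counit M x" if x: "x \<in> carr M" for x
  proof -
    have "counit M (g (p x) - x) = 0" using gJ[OF x] J unfolding biideal_def by blast
    then show ?thesis by (simp add: N_def lin_minus[OF coalgebra_counit[OF S(2)] V] g x)
  qed
  have sur: "p ` carr M = carr N" by (simp add: N_def)
  have u: "unit N = p (unit M)" by (simp add: N_def)
  show thesis
    by (rule that[OF bialgebra_transport[OF M VN lp sur mm u cc ee] sur ker])
qed


section \<open>Universality among bialgebras on all types\<close>

text \<open>
  The flag \<open>cc\<close> restricts the test bialgebras to the cocommutative ones, so that both universal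
  properties are treated at once.
\<close>

definition universal_among ::
    "'u::ab_group_add itself \<Rightarrow> bool \<Rightarrow> ('k::field, 'b::ab_group_add, 'm) kbialg_scheme
      \<Rightarrow> ('k, 't::ab_group_add, 'n) kbialg_scheme \<Rightarrow> ('k, 'a::ab_group_add, 'o) kalg_scheme
      \<Rightarrow> (('k, 'b, 't) tensor \<Rightarrow> 'a) \<Rightarrow> bool" where
  "universal_among _ cc B T A \<theta> \<longleftrightarrow>
     bialgebra B \<and> bimeasuring B T A \<theta> \<and>
     (\<forall>(N :: ('k, 'u) kbialg) f. bialgebra N \<and> (cc \<longrightarrow> cocommutative N) \<and> bimeasuring N T A f \<longrightarrow>
        (\<exists>h. bialgebra_map N B h \<and> factors_through N B T \<theta> f h \<and>
          (\<forall>h'. bialgebra_map N B h' \<and> factors_through N B T \<theta> f h' \<longrightarrow>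
             (\<forall>n\<in>carr N. h' n = h n))))"

lemma universal_amongI:
  "universal_bimeasuring u B T A \<theta> \<Longrightarrow> universal_among u False B T A \<theta>"
  "universal_cocomm_bimeasuring u B T A \<theta> \<Longrightarrow> universal_among u True B T A \<theta>"
  unfolding universal_bimeasuring_def universal_cocomm_bimeasuring_def universal_among_def
  by simp_all

lemma universal_among_bialgebra: "universal_among u cc B T A \<theta> \<Longrightarrow> bialgebra B"
  and universal_among_bimeasuring: "universal_among u cc B T A \<theta> \<Longrightarrow> bimeasuring B T A \<theta>"
  unfolding universal_among_def by (rule conjunct1, assumption) (rule conjunct1, rule conjunct2,
      assumption)

lemma universal_amongE:
  fixes N :: "('k::field, 'u::ab_group_add) kbialg"
  assumes "universal_among TYPE('u) cc B T A \<theta>"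
    and "bialgebra N" "cc \<Longrightarrow> cocommutative N" "bimeasuring N T A f"
  obtains h where "bialgebra_map N B h" "factors_through N B T \<theta> f h"
    "\<forall>h'. bialgebra_map N B h' \<and> factors_through N B T \<theta> f h' \<longrightarrow> (\<forall>n\<in>carr N. h' n = h n)"
proof -
  have "\<forall>(N :: ('k, 'u) kbialg) f. bialgebra N \<and> (cc \<longrightarrow> cocommutative N) \<and> bimeasuring N T A f \<longrightarrow>
        (\<exists>h. bialgebra_map N B h \<and> factors_through N B T \<theta> f h \<and>
          (\<forall>h'. bialgebra_map N B h' \<and> factors_through N B T \<theta> f h' \<longrightarrow>
             (\<forall>n\<in>carr N. h' n = h n)))"
    using assms(1) unfolding universal_among_def by (elim conjE)
  from this[rule_format, of N f] assms(2-4)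
  obtain h where "bialgebra_map N B h \<and> factors_through N B T \<theta> f h \<and>
          (\<forall>h'. bialgebra_map N B h' \<and> factors_through N B T \<theta> f h' \<longrightarrow> (\<forall>n\<in>carr N. h' n = h n))"
    by auto
  then show thesis using that[of h] by simp
qed

text \<open>
  A bimeasuring of \<open>M\<close> that vanishes on \<open>J\<close> is one of \<open>M / J\<close>, which lives on the type \<open>'u\<close>. The
  biideal is included since the statement is needed both for \<open>J = {0}\<close> and, to prove uniqueness
  among coalgebra maps, for nontrivial candidates \<open>J\<close>.
\<close>

lemma universal_small_exists:
  fixes M :: "('k::field, 'v::ab_group_add, 'm) kbialg_scheme"
  assumes U: "large_universe TYPE('k) TYPE('u::ab_group_add)" and T: "bialgebra T" and A: "algebra
      A"
    and un: "universal_among TYPE('u) cc B T A \<theta>"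
    and M: "bialgebra M" "cc \<Longrightarrow> cocommutative M"
    and G: "countable G" "carr M = module.span (scl M) G" and J: "biideal M J"
    and f: "bimeasuring M T A f" and f0: "\<And>x t. x \<in> J \<Longrightarrow> t \<in> carr T \<Longrightarrow> f (tens M T x t) = 0"
  shows "\<exists>h. bialgebra_map M B h \<and> (\<forall>n\<in>carr M. \<forall>t\<in>carr T. \<theta> (tens B T (h n) t) = f (tens M T n t))
     \<and> (\<forall>x\<in>J. h x = 0)"
proof -
  note B = universal_among_bialgebra[OF un] and th = universal_among_bimeasuring[OF un]
  obtain N :: "('k, 'u) kbialg" and p where N: "bialgebra N" and p: "bialgebra_map M N p" "p ` carr
      M = carr N"
    and ker: "\<And>x. x \<in> carr M \<Longrightarrow> p x = 0 \<longleftrightarrow> x \<in> J"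
    by (rule quotient_bialgebra[OF U M(1) G J]) blast
  note V = bialgebra_vect[OF M(1)] bialgebra_vect[OF N] bialgebra_vect[OF T] algebra_vect[OF A]
      bialgebra_vect[OF B]
  note lf = bimeasuring_lin[OF f] and lp = bialgebra_map_lin[OF p(1)]
  have JM: "J \<subseteq> carr M" using J unfolding biideal_def by blast
  define g where "g = inv_into (carr M) p"
  have g: "g (p x) \<in> carr M" "p (g (p x)) = p x" if "x \<in> carr M" for x
    using that unfolding g_def by (auto intro: inv_into_into f_inv_into_f)
  define F where "F x t = f (tens M T (g x) t)" for x t
  have F: "F (p x) t = f (tens M T x t)" if x: "x \<in> carr M" and t: "t \<in> carr T" for x t
  proof -
    have l: "lin M A (\<lambda>x. f (tens M T x t))" by (rule lin_comp[OF lf]) (intro lin_intros t)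
    have "p (g (p x) - x) = 0" using lin_minus[OF lp V(1) g(1)[OF x] x] g(2)[OF x] by simp
    then have "g (p x) - x \<in> J" using ker[OF vect_diff[OF V(1) g(1)[OF x] x]] by simp
    then have "f (tens M T (g (p x) - x) t) = 0" by (rule f0[OF _ t])
    then show ?thesis using lin_minus[OF l V(1) g(1)[OF x] x] by (simp add: F_def)
  qed
  have bF: "bilin N T A F"
  proof (rule bilinI)
    show "lin N A (\<lambda>v. F v w)" if w: "w \<in> carr T" for w
    proof (rule lin_surj[OF V(1) lp p(2)], rule lin_cong[OF _ V(1)])
      show "lin M A (\<lambda>x. f (tens M T x w))" by (rule lin_comp[OF lf]) (intro lin_intros w)
    qed (simp add: F w)
    show "lin T A (F v)" if v: "v \<in> carr N" for v
    proof -
      obtain x where x: "x \<in> carr M" "v = p x" using v p(2) by blast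
      show ?thesis
      proof (rule lin_cong[OF _ V(3)])
        show "lin T A (\<lambda>t. f (tens M T x t))" by (rule lin_comp[OF lf]) (intro lin_intros x)
      qed (simp add: F x)
    qed
  qed
  define f' where "f' z = tsum N T z F" for z
  have lf': "lin (tspace N T) A f'" unfolding f'_def by (rule lin_tsum[OF V(2-4) bF])
  have f': "f' (tens N T (p x) t) = f (tens M T x t)" if "x \<in> carr M" "t \<in> carr T" for x t
    unfolding f'_def
    using tsum_tens[OF V(2-4) bF bialgebra_map_mem[OF p(1) that(1)] that(2)] F[OF that] by simp
  have bf': "bimeasuring N T A f'"
    by (rule bimeasuring_descend[OF N M(1) T A f p lf' f'])
  have co: "cocommutative N" if cc by (rule cocommutative_image[OF M(1) M(2)[OF that] N p])
  obtain h where h: "bialgebra_map N B h" "factors_through N B T \<theta> f' h"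
    by (rule universal_amongE[OF un N co bf'])
  have hf: "f' (tens N T n t) = \<theta> (tens B T (h n) t)" if "n \<in> carr N" "t \<in> carr T" for n t
    using h(2) that factors_through_iff[OF V(2-4) lf' bialgebra_map_lin[OF h(1)] bimeasuring_lin[OF
        th]] by blast
  have "bialgebra_map M B (\<lambda>x. h (p x))"
    by (rule bialgebra_map_comp[OF M(1) V(2,5) p(1) h(1)])
  moreover have "\<theta> (tens B T (h (p n)) t) = f (tens M T n t)" if "n \<in> carr M" "t \<in> carr T" for n t
    using hf[OF bialgebra_map_mem[OF p(1) that(1)] that(2)] f'[OF that] by simp
  moreover have "h (p x) = 0" if "x \<in> J" for x
  proof -
    have "p x = 0" using that ker[of x] JM by blast
    then show ?thesis using lin_0[OF bialgebra_map_lin[OF h(1)] V(2)] by simp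
  qed
  ultimately show ?thesis by blast
qed

lemma universal_small_unique:
  fixes M :: "('k::field, 'v::ab_group_add, 'm) kbialg_scheme"
  assumes U: "large_universe TYPE('k) TYPE('u::ab_group_add)" and T: "bialgebra T" and A: "algebra
      A"
    and un: "universal_among TYPE('u) cc B T A \<theta>"
    and M: "bialgebra M" "cc \<Longrightarrow> cocommutative M"
    and G: "countable G" "carr M = module.span (scl M) G"
    and h: "bialgebra_map M B h" "bialgebra_map M B h'"
    and eq: "\<And>n t. n \<in> carr M \<Longrightarrow> t \<in> carr T \<Longrightarrow> \<theta> (tens B T (h n) t) = \<theta> (tens B T (h' n) t)"
    and n: "n \<in> carr M"
  shows "h n = h' n"
proof -
  note B = universal_among_bialgebra[OF un] and th = universal_among_bimeasuring[OF un]
  obtain N :: "('k, 'u) kbialg" and p where N: "bialgebra N" and p: "bialgebra_map M N p" "p ` carr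
      M = carr N"
    and ker: "\<And>x. x \<in> carr M \<Longrightarrow> p x = 0 \<longleftrightarrow> x \<in> {0}"
    by (rule quotient_bialgebra[OF U M(1) G biideal_zero[OF M(1)]]) blast
  note V = bialgebra_vect[OF M(1)] bialgebra_vect[OF N] bialgebra_vect[OF T] algebra_vect[OF A]
      bialgebra_vect[OF B]
  note lp = bialgebra_map_lin[OF p(1)]
  have inj: "inj_on p (carr M)"
  proof (rule inj_onI)
    fix x y assume xy: "x \<in> carr M" "y \<in> carr M" "p x = p y"
    then have "p (x - y) = 0" by (simp add: lin_minus[OF lp V(1)])
    then show "x = y" using ker[OF vect_diff[OF V(1) xy(1,2)]] by simp
  qed
  define g where "g = inv_into (carr M) p"
  have g: "g (p x) = x" if "x \<in> carr M" for x using inj that unfolding g_def by simp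
  have k: "bialgebra_map N B (\<lambda>x. h (g x))" "bialgebra_map N B (\<lambda>x. h' (g x))"
    by (rule bialgebra_map_descend[OF M(1) N V(5) p h(1)], simp add: g)
      (rule bialgebra_map_descend[OF M(1) N V(5) p h(2)], simp add: g)
  note l = bialgebra_map_lin[OF k(1)] bialgebra_map_lin[OF k(2)] bimeasuring_lin[OF th]
  define f where "f z = \<theta> (tmap N T B T (\<lambda>x. h (g x)) (\<lambda>t. t) z)" for z
  have lf: "lin (tspace N T) A f"
    unfolding f_def by (rule lin_comp[OF l(3) lin_tmap[OF V(2,3) l(1) lin_id]])
  have f: "f (tens N T x t) = \<theta> (tens B T (h (g x)) t)" if "x \<in> carr N" "t \<in> carr T" for x t
    unfolding f_def by (simp add: tmap_tens[OF V(2,3) l(1) lin_id that])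
  have bf: "bimeasuring N T A f"
    by (rule bimeasuring_pullback[OF B N T T A th k(1) bialgebra_map_id[OF T] lf f])
  have f': "f (tens N T x t) = \<theta> (tens B T (h' (g x)) t)" if "x \<in> carr N" "t \<in> carr T" for x t
  proof -
    have "x \<in> p ` carr M" using that(1) p(2) by simp
    then obtain y where y: "y \<in> carr M" "x = p y" by (rule imageE)
    have gx: "g x = y" using g[OF y(1)] y(2) by simp
    show ?thesis unfolding f[OF that] gx by (rule eq[OF y(1) that(2)])
  qed
  have fac: "factors_through N B T \<theta> f (\<lambda>x. h (g x))" "factors_through N B T \<theta> f (\<lambda>x. h' (g x))"
    by (rule iffD2[OF factors_through_iff[OF V(2-4) lf l(1,3)]], intro ballI f, assumption+)
      (rule iffD2[OF factors_through_iff[OF V(2-4) lf l(2,3)]], intro ballI f', assumption+)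
  have co: "cocommutative N" if cc by (rule cocommutative_image[OF M(1) M(2)[OF that] N p])
  obtain h0 where "bialgebra_map N B h0" "factors_through N B T \<theta> f h0"
    and h0: "\<forall>h'. bialgebra_map N B h' \<and> factors_through N B T \<theta> f h' \<longrightarrow> (\<forall>n\<in>carr N. h' n = h0 n)"
    by (rule universal_amongE[OF un N co bf])
  note pn = bialgebra_map_mem[OF p(1) n]
  have "h (g (p n)) = h' (g (p n))" using h0[rule_format, OF conjI[OF k(1) fac(1)] pn]
      h0[rule_format, OF conjI[OF k(2) fac(2)] pn] by simp
  then show ?thesis using g[OF n] by simp
qed

text \<open>
  An equality of maps may be tested on a subbialgebra of countable dimension that contains the
  given element.
\<close>

lemma universal_unique:
  fixes N :: "('k::field, 'v::ab_group_add, 'm) kbialg_scheme"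
  assumes U: "large_universe TYPE('k) TYPE('u::ab_group_add)" and T: "bialgebra T" and A: "algebra
      A"
    and un: "universal_among TYPE('u) cc B T A \<theta>"
    and N: "bialgebra N" "cc \<Longrightarrow> cocommutative N"
    and h: "bialgebra_map N B h" "bialgebra_map N B h'"
    and eq: "\<And>n t. n \<in> carr N \<Longrightarrow> t \<in> carr T \<Longrightarrow> \<theta> (tens B T (h n) t) = \<theta> (tens B T (h' n) t)"
    and n: "n \<in> carr N"
  shows "h n = h' n"
proof -
  note B = universal_among_bialgebra[OF un]
  obtain D where D: "countable_sub N D" "n \<in> D"
    using countable_sub_exists[OF N(1), of "{n}"] n by auto
  obtain G where G: "countable G" "D = module.span (scl N) G" and DN: "D \<subseteq> carr N" "bialgebra
      (N\<lparr>carr := D\<rparr>)"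
    using D(1) unfolding countable_sub_def by blast
  show ?thesis
  proof (rule universal_small_unique[OF U T A un DN(2)])
    show "cocommutative (N\<lparr>carr := D\<rparr>)" if cc by (rule cocommutative_sub[OF N(1) N(2)[OF that]
        DN(2,1)])
    show "carr (N\<lparr>carr := D\<rparr>) = module.span (scl (N\<lparr>carr := D\<rparr>)) G" using G(2) by simp
    show "bialgebra_map (N\<lparr>carr := D\<rparr>) B h" "bialgebra_map (N\<lparr>carr := D\<rparr>) B h'"
      by (rule bialgebra_map_restrict[OF N(1) DN(2,1) bialgebra_vect[OF B]] h)+
    show "n \<in> carr (N\<lparr>carr := D\<rparr>)" using D(2) by simp
  qed (use G(1) eq DN(1) in auto)
qed

lemma universal_unique_tensor:
  fixes C :: "('k::field, 'v::ab_group_add, 'm) kbialg_scheme"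
  assumes U: "large_universe TYPE('k) TYPE('u::ab_group_add)" and T: "bialgebra T" and A: "algebra
      A"
    and un: "universal_among TYPE('u) False B T A \<theta>" and C: "bialgebra C" "bialgebra D"
    and h: "bialgebra_map (tensor_bialg C D) B h" "bialgebra_map (tensor_bialg C D) B h'"
    and eq: "\<And>c d t. c \<in> carr C \<Longrightarrow> d \<in> carr D \<Longrightarrow> t \<in> carr T \<Longrightarrow>
      \<theta> (tens B T (h (tens C D c d)) t) = \<theta> (tens B T (h' (tens C D c d)) t)"
    and x: "x \<in> carr (tensor_bialg C D)"
  shows "h x = h' x"
proof (rule universal_unique[OF U T A un bialgebra_tensor[OF C] _ h _ x])
  fix n t assume n: "n \<in> carr (tensor_bialg C D)" and t: "t \<in> carr T"
  note l = lin_comp[OF bimeasuring_lin[OF universal_among_bimeasuring[OF un]]]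
    bialgebra_map_lin[OF h(1), unfolded tensor_bialg_simps] bialgebra_map_lin[OF h(2), unfolded
        tensor_bialg_simps]
  have "\<forall>n\<in>carr (tspace C D). \<theta> (tens B T (h n) t) = \<theta> (tens B T (h' n) t)"
    by (rule tens_ballI[where X=A]) (intro l lin_intros t eq | assumption)+
  then show "\<theta> (tens B T (h n) t) = \<theta> (tens B T (h' n) t)" using n by (simp add: tensor_bialg_simps)
qed simp

text \<open>
  Each subbialgebra \<open>D\<close> of countable dimension has a map \<open>H D\<close>. Any two of them lie in a third
  one, so by uniqueness these maps agree on intersections and glue to a map on \<open>N\<close>. Every axiom of
  a bialgebra map involves finitely many elements, hence may be checked inside one \<open>D\<close>.
\<close>

lemma universal_exists:
  fixes N :: "('k::field, 'v::ab_group_add, 'm) kbialg_scheme"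
  assumes U: "large_universe TYPE('k) TYPE('u::ab_group_add)" and T: "bialgebra T" and A: "algebra
      A"
    and un: "universal_among TYPE('u) cc B T A \<theta>"
    and N: "bialgebra N" "cc \<Longrightarrow> cocommutative N"
    and f: "bimeasuring N T A f"
  shows "\<exists>h. bialgebra_map N B h \<and> (\<forall>n\<in>carr N. \<forall>t\<in>carr T. \<theta> (tens B T (h n) t) = f (tens N T n t))"
proof -
  note B = universal_among_bialgebra[OF un]
  note S = bialgebra_algebra[OF N(1)] bialgebra_coalgebra[OF N(1)]
  note V = bialgebra_vect[OF N(1)] bialgebra_vect[OF B]
  let ?N = "\<lambda>D. N\<lparr>carr := D\<rparr>"
  let ?P = "\<lambda>D h. bialgebra_map (?N D) B h \<and> (\<forall>n\<in>D. \<forall>t\<in>carr T. \<theta> (tens B T (h n) t) = f (tens N T n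
      t))"
  have sub: "D \<subseteq> carr N" "bialgebra (?N D)" if "countable_sub N D" for D
    using that unfolding countable_sub_def by blast+
  have cosub: "cocommutative (?N D)" if "countable_sub N D" cc for D
    by (rule cocommutative_sub[OF N(1) N(2)[OF that(2)] sub(2,1)[OF that(1)]])
  have "\<exists>h. ?P D h" if D: "countable_sub N D" for D
  proof -
    obtain G where G: "countable G" "D = module.span (scl N) G"
      using D unfolding countable_sub_def by blast
    have bf: "bimeasuring (?N D) T A f" by (rule bimeasuring_sub[OF N(1) sub(2,1)[OF D] T A f])
    have "f (tens N T 0 t) = 0" if "t \<in> carr T" for t
      using lin_0[OF lin_comp[OF bimeasuring_lin[OF f] lin_tens1[OF lin_id that]] V(1)] .
    then show ?thesis
      using universal_small_exists[OF U T A un sub(2)[OF D] cosub[OF D] G(1) _ biideal_zero[OF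
          sub(2)[OF D]] bf] G(2)
      by auto
  qed
  then obtain H where H: "\<And>D. countable_sub N D \<Longrightarrow> ?P D (H D)" by metis
  have agree: "H D n = H E n" if D: "countable_sub N D" and E: "countable_sub N E" and DE: "D \<subseteq> E"
      and n: "n \<in> D" for D E n
  proof (rule universal_unique[OF U T A un sub(2)[OF D] cosub[OF D]])
    show "bialgebra_map (?N D) B (H D)" using H[OF D] by blast
    show "bialgebra_map (?N D) B (H E)"
      using bialgebra_map_restrict[OF sub(2)[OF E], of D B "H E"] sub(2)[OF D] DE V(2) H[OF E] by
          simp
  qed (use H[OF D] H[OF E] DE n in auto)
  have agree2: "H D n = H E n" if D: "countable_sub N D" and E: "countable_sub N E" and n: "n \<in> D"
      "n \<in> E" for D E n
  proof -
    interpret V: vector_space "scl N" using V(1) by (simp add: vect_def)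
    obtain G where G: "countable G" "D = V.span G" using D unfolding countable_sub_def by blast
    obtain G' where G': "countable G'" "E = V.span G'" using E unfolding countable_sub_def by blast
    have "G \<union> G' \<subseteq> carr N" using sub(1)[OF D] sub(1)[OF E] V.span_superset G(2) G'(2) by blast
    then obtain K where K: "countable_sub N K" "G \<union> G' \<subseteq> K"
      using countable_sub_exists[OF N(1), of "G \<union> G'"] G(1) G'(1) by auto
    have "V.subspace K" using K(1) V.subspace_span unfolding countable_sub_def by blast
    then have "D \<subseteq> K" "E \<subseteq> K" using K(2) G(2) G'(2) V.span_minimal by auto
    then show ?thesis using agree[OF D K(1)] agree[OF E K(1)] n by auto
  qed
  define h where "h n = H (SOME D. countable_sub N D \<and> n \<in> D) n" for n
  have hH: "h n = H D n" if "countable_sub N D" "n \<in> D" for D n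
    using someI_ex[of "\<lambda>D. countable_sub N D \<and> n \<in> D"] agree2[OF _ that(1) _ that(2)] that
    unfolding h_def by blast
  have ex: "\<exists>D. countable_sub N D \<and> {x, y} \<subseteq> D" if "x \<in> carr N" "y \<in> carr N" for x y
    using countable_sub_exists[OF N(1), of "{x, y}"] that by auto
  have lh: "lin N B h"
  proof (rule linI)
    fix x assume x: "x \<in> carr N"
    obtain D where D: "countable_sub N D" "x \<in> D" using ex[OF x x] by auto
    note l = bialgebra_map_lin[OF conjunct1[OF H[OF D(1)]]]
    show "h x \<in> carr B" using lin_mem[OF l, of x] D by (simp add: hH)
    show "h (scl N c x) = scl B c (h x)" for c
      using lin_scl[OF l, of x c] vect_scl[OF bialgebra_vect[OF sub(2)[OF D(1)]], of x c] D by (simp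
          add: hH)
  next
    fix x y assume x: "x \<in> carr N" and y: "y \<in> carr N"
    obtain D where D: "countable_sub N D" "x \<in> D" "y \<in> D" using ex[OF x y] by auto
    note l = bialgebra_map_lin[OF conjunct1[OF H[OF D(1)]]]
    show "h (x + y) = h x + h y"
      using lin_add[OF l, of x y] vect_add[OF bialgebra_vect[OF sub(2)[OF D(1)]], of x y] D by (simp
          add: hH)
  qed
  have "bialgebra_map N B h"
  proof (rule bialgebra_mapI[OF N(1) lh])
    fix x y assume x: "x \<in> carr N" and y: "y \<in> carr N"
    obtain D where D: "countable_sub N D" "x \<in> D" "y \<in> D" using ex[OF x y] by auto
    show "h (mul N x y) = mul B (h x) (h y)"
      using bialgebra_map_mul[OF conjunct1[OF H[OF D(1)]], of x y]
        algebra_mul_mem[OF bialgebra_algebra[OF sub(2)[OF D(1)]], of x y] D by (simp add: hH)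
  next
    have u: "unit N \<in> carr N" by (rule algebra_unit[OF S(1)])
    obtain D where D: "countable_sub N D" "unit N \<in> D" using ex[OF u u] by auto
    show "h (unit N) = unit B" using bialgebra_map_unit[OF conjunct1[OF H[OF D(1)]]] D by (simp add:
        hH)
  next
    fix x assume x: "x \<in> carr N"
    obtain D where D: "countable_sub N D" "x \<in> D" using ex[OF x x] by auto
    note m = conjunct1[OF H[OF D(1)]]
    note C = bialgebra_coalgebra[OF sub(2)[OF D(1)]]
    show "counit B (h x) = counit N x" using bialgebra_map_counit[OF m, of x] D by (simp add: hH)
    have cx: "comul N x \<in> carr (tspace (?N D) (?N D))" using comul_mem[OF C, of x] D by simp
    have "comul B (h x) = tsum (?N D) (?N D) (comul N x) (\<lambda>a b. tens B B (H D a) (H D b))"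
      using coalgebra_map_comul[OF C bialgebra_map_coalgebra_map[OF m], of x] D by (simp add: hH)
    also have "\<dots> = tsum (?N D) (?N D) (comul N x) (\<lambda>a b. tens B B (h a) (h b))"
      by (rule tsum_cong[OF bialgebra_vect[OF sub(2)[OF D(1)]] cx]) (simp add: hH[OF D(1)])
    also have "\<dots> = sw N x (\<lambda>a b. tens B B (h a) (h b))"
      by (rule tsum_update[where X="tspace B B", OF V(1) bialgebra_vect[OF sub(2)[OF D(1)]]
          sub(1)[OF D(1)] vect_tspace _ cx])
        (intro bilinI lin_intros lh lin_mem[OF lh] | assumption)+
    finally show "comul B (h x) = sw N x (\<lambda>a b. tens B B (h a) (h b))" .
  qed
  moreover have "\<theta> (tens B T (h n) t) = f (tens N T n t)" if n: "n \<in> carr N" and t: "t \<in> carr T" for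
      n t
  proof -
    obtain D where D: "countable_sub N D" "n \<in> D" using ex[OF n n] by auto
    then show ?thesis using H[OF D(1)] t by (simp add: hH)
  qed
  ultimately show ?thesis by blast
qed


section \<open>Uniqueness among coalgebra maps\<close>

text \<open>
  The differences \<open>d x = \<alpha> x - \<beta> x\<close> span a coideal, as \<open>\<Delta> (d x) = d x\<^sub>1 \<otimes> \<alpha> x\<^sub>2 + \<beta> x\<^sub>1 \<otimes> d x\<^sub>2\<close>;
  the ideal generated by a coideal is a biideal.
\<close>

lemma biideal_of_coalgebra_maps:
  assumes M: "bialgebra M" and C: "coalgebra C" and al: "coalgebra_map C M \<alpha>" "coalgebra_map C M \<beta>"
  shows "biideal M (module.span (scl M) {mul M (mul M a (\<alpha> x - \<beta> x)) b | a b x.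
     a \<in> carr M \<and> b \<in> carr M \<and> x \<in> carr C})"
proof -
  note S = bialgebra_algebra[OF M] bialgebra_coalgebra[OF M]
  note V = bialgebra_vect[OF M] coalgebra_vect[OF C] vect_tspace vect_ground
  note la = coalgebra_map_lin[OF al(1)] and lb = coalgebra_map_lin[OF al(2)]
  note ll = lin_mem[OF la] lin_mem[OF lb] lin_comp[OF la] lin_comp[OF lb]
  interpret V: vector_space "scl M" using V(1) by (simp add: vect_def)
  interpret P: vector_space pt_scale by (rule vector_space_pt_scale)
  interpret K: vector_space "(*) :: 'a \<Rightarrow> 'a \<Rightarrow> 'a"
    by unfold_locales (auto simp: algebra_simps)
  define d where "d x = \<alpha> x - \<beta> x" for x
  have dM: "d x \<in> carr M" if "x \<in> carr C" for x
    unfolding d_def using that by (intro mem_intros V ll)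
  define E where "E = {mul M (mul M a (d x)) b | a b x. a \<in> carr M \<and> b \<in> carr M \<and> x \<in> carr C}"
  let ?J = "V.span E"
  let ?K = "{tens M M a b | a b. a \<in> carr M \<and> b \<in> carr M \<and> (a \<in> ?J \<or> b \<in> ?J)}"
  have EM: "E \<subseteq> carr M" unfolding E_def using dM by (auto intro!: algebra_mul_mem S)
  have EJ: "E \<subseteq> ?J" by (rule V.span_superset)
  have mulJ: "mul M m x \<in> ?J" "mul M x m \<in> ?J" if x: "x \<in> ?J" and m: "m \<in> carr M" for x m
  proof -
    have "mul M m y \<in> E" "mul M y m \<in> E" if y: "y \<in> E" for y
    proof -
      obtain a b z where *: "y = mul M (mul M a (d z)) b" "a \<in> carr M" "b \<in> carr M" "z \<in> carr C"
        using y unfolding E_def by blast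
      have "mul M m y = mul M (mul M (mul M m a) (d z)) b"
        by (simp add: *(1) algebra_assoc[OF S(1)] algebra_mul_mem S * dM m)
      then show "mul M m y \<in> E" unfolding E_def using * m algebra_mul_mem[OF S(1)] by blast
      have "mul M y m = mul M (mul M a (d z)) (mul M b m)"
        by (simp add: *(1) algebra_assoc[OF S(1)] algebra_mul_mem S * dM m)
      then show "mul M y m \<in> E" unfolding E_def using * m algebra_mul_mem[OF S(1)] by blast
    qed
    then show "mul M m x \<in> ?J" "mul M x m \<in> ?J"
      using EJ by (auto intro!: lin_span_mem[OF V(1,1) bilin_lin2[OF algebra_mul[OF S(1)] m] EM
          V.subspace_span _ x]
        lin_span_mem[OF V(1,1) bilin_lin1[OF algebra_mul[OF S(1)] m] EM V.subspace_span _ x])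
  qed
  have "counit M x \<in> {0}" if x: "x \<in> ?J" for x
  proof (rule lin_span_mem[OF V(1,4) coalgebra_counit[OF S(2)] EM _ _ x])
    have "counit M (mul M (mul M a (d z)) b) = 0" if "a \<in> carr M" "b \<in> carr M" "z \<in> carr C" for a b
        z
    proof -
      have "counit M (d z) = 0"
        unfolding d_def by (simp add: lin_minus[OF coalgebra_counit[OF S(2)] V(1)] ll that
            coalgebra_map_counit[OF al(1)] coalgebra_map_counit[OF al(2)])
      then show ?thesis by (simp add: counit_mul[OF M] algebra_mul_mem S dM that)
    qed
    then show "counit M ` E \<subseteq> {0}" unfolding E_def by auto
  qed (simp add: K.subspace_single_0)
  moreover have "comul M x \<in> P.span ?K" if x: "x \<in> ?J" for x
  proof (rule lin_span_mem[OF V(1,3) coalgebra_comul[OF S(2)] EM _ _ x])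
    show "module.subspace (scl (tspace M M)) (P.span ?K)" unfolding scl_tspace by (rule
        P.subspace_span)
    let ?X = "\<lparr>carr = P.span ?K, scl = pt_scale\<rparr>"
    have VX: "vect ?X" unfolding vect_def by (simp add: vector_space_pt_scale)
    have "comul M (mul M (mul M a (d z)) b) \<in> P.span ?K" if abz: "a \<in> carr M" "b \<in> carr M" "z \<in> carr
        C" for a b z
    proof -
      let ?t = "\<lambda>a1 a2 y1 y2 b1 b2. tens M M (mul M (mul M a1 y1) b1) (mul M (mul M a2 y2) b2)"
      have exp: "comul M (mul M (mul M a (\<gamma> z)) b) = sw M a (\<lambda>a1 a2. sw C z (\<lambda>z1 z2.
          sw M b (\<lambda>b1 b2. ?t a1 a2 (\<gamma> z1) (\<gamma> z2) b1 b2)))"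
        if g: "coalgebra_map C M \<gamma>" for \<gamma>
      proof -
        note lg = lin_mem[OF coalgebra_map_lin[OF g]] lin_comp[OF coalgebra_map_lin[OF g]]
        have "comul M (mul M (mul M a (\<gamma> z)) b) = sw M (mul M a (\<gamma> z)) (\<lambda>y1 y2.
           sw M b (\<lambda>b1 b2. tens M M (mul M y1 b1) (mul M y2 b2)))"
          by (intro comul_mul M algebra_mul_mem S abz lg)
        also have "\<dots> = sw M a (\<lambda>a1 a2. sw M (\<gamma> z) (\<lambda>y1 y2.
          sw M b (\<lambda>b1 b2. ?t a1 a2 y1 y2 b1 b2)))"
          by (intro tsum_comul_mul[where X="tspace M M"] M abz lg V bilinI lin_intros mem_intros S)
        also have "\<dots> = sw M a (\<lambda>a1 a2. sw C z (\<lambda>z1 z2.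
          sw M b (\<lambda>b1 b2. ?t a1 a2 (\<gamma> z1) (\<gamma> z2) b1 b2)))"
          by (intro tsum_cong tsum_coalgebra_map[where X="tspace M M"] C g M abz V bilinI lin_intros
              mem_intros S)
        finally show ?thesis .
      qed
      have "mul M (mul M a (d z)) b = mul M (mul M a (\<alpha> z)) b - mul M (mul M a (\<beta> z)) b"
        unfolding d_def by (simp add: abz ll lin_minus[OF bilin_lin1[OF algebra_mul[OF S(1)]] V(1)]
            lin_minus[OF bilin_lin2[OF algebra_mul[OF S(1)]] V(1)] algebra_mul_mem S)
      then have "comul M (mul M (mul M a (d z)) b) = comul M (mul M (mul M a (\<alpha> z)) b) - comul M
          (mul M (mul M a (\<beta> z)) b)"
        by (simp add: lin_minus[OF coalgebra_comul[OF S(2)] V(1)] abz ll algebra_mul_mem S)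
      also have "\<dots> = sw M a (\<lambda>a1 a2. sw C z (\<lambda>z1 z2. sw M b (\<lambda>b1 b2.
          ?t a1 a2 (\<alpha> z1) (\<alpha> z2) b1 b2 - ?t a1 a2 (\<beta> z1) (\<beta> z2) b1 b2)))"
        unfolding exp[OF al(1)] exp[OF al(2)] tsum_minus ..
      also have "\<dots> \<in> carr ?X"
      proof (intro tsum_mem VX V comul_mem S C abz)
        fix a1 a2 z1 z2 b1 b2 assume h: "a1 \<in> carr M" "a2 \<in> carr M" "b1 \<in> carr M" "b2 \<in> carr M" "z1
            \<in> carr C" "z2 \<in> carr C"
        let ?m = "\<lambda>a y b. mul M (mul M a y) b"
        have mm: "?m a y b \<in> carr M" if "a \<in> carr M" "y \<in> carr M" "b \<in> carr M" for a y b
          using that by (intro mem_intros S)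
        have md: "?m a (d z) b = ?m a (\<alpha> z) b - ?m a (\<beta> z) b" if "a \<in> carr M" "b \<in> carr M" "z \<in> carr
            C" for a b z
          unfolding d_def by (simp add: that ll lin_minus[OF bilin_lin1[OF algebra_mul[OF S(1)]]
              V(1)]
            lin_minus[OF bilin_lin2[OF algebra_mul[OF S(1)]] V(1)] algebra_mul_mem S)
        have dJ: "?m a (d z) b \<in> ?J" if "a \<in> carr M" "b \<in> carr M" "z \<in> carr C" for a b z
          using EJ that unfolding E_def by blast
        have "?t a1 a2 (\<alpha> z1) (\<alpha> z2) b1 b2 - ?t a1 a2 (\<beta> z1) (\<beta> z2) b1 b2
            = tens M M (?m a1 (d z1) b1) (?m a2 (\<alpha> z2) b2) + tens M M (?m a1 (\<beta> z1) b1) (?m a2 (d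
                z2) b2)"
          by (simp add: md h lin_minus[OF bilin_lin1[OF bilin_tens] V(1)] lin_minus[OF bilin_lin2[OF
              bilin_tens] V(1)] mm ll
            del: plus_fun_apply)
        also have "\<dots> \<in> P.span ?K"
        proof (rule P.span_add)
          have m: "?m a1 (d z1) b1 \<in> carr M" "?m a2 (\<alpha> z2) b2 \<in> carr M" "?m a1 (\<beta> z1) b1 \<in> carr M"
              "?m a2 (d z2) b2 \<in> carr M"
            by (intro mm h dM ll)+
          show "tens M M (?m a1 (d z1) b1) (?m a2 (\<alpha> z2) b2) \<in> P.span ?K"
            by (rule P.span_base, rule CollectI, intro exI conjI disjI1, rule refl) (intro m dJ h)+
          show "tens M M (?m a1 (\<beta> z1) b1) (?m a2 (d z2) b2) \<in> P.span ?K"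
            by (rule P.span_base, rule CollectI, intro exI conjI disjI2, rule refl) (intro m dJ h)+
        qed
        finally show "?t a1 a2 (\<alpha> z1) (\<alpha> z2) b1 b2 - ?t a1 a2 (\<beta> z1) (\<beta> z2) b1 b2 \<in> carr ?X" by simp
      qed
      finally show ?thesis by simp
    qed
    then show "comul M ` E \<subseteq> P.span ?K" unfolding E_def by blast
  qed
  moreover have "?J \<subseteq> carr M" by (rule span_subset_carr[OF V(1) EM])
  ultimately have "biideal M ?J"
    unfolding biideal_def using mulJ V.subspace_span by simp
  then show ?thesis unfolding E_def d_def .
qed

text \<open>
  By \<open>f(a y b, t) = f(a, t\<^sub>1) f(y, t\<^sub>2) f(b, t\<^sub>3)\<close>, a bimeasuring that vanishes on a set vanishes
  on the ideal generated by it.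
\<close>

lemma bimeasuring_vanishes:
  assumes M: "bialgebra M" and T: "bialgebra T" and A: "algebra A" and f: "bimeasuring M T A f"
    and X: "\<And>y. y \<in> X \<Longrightarrow> d y \<in> carr M"
    and f0: "\<And>y t. y \<in> X \<Longrightarrow> t \<in> carr T \<Longrightarrow> f (tens M T (d y) t) = 0"
    and x: "x \<in> module.span (scl M) {mul M (mul M a (d y)) b | a b y. a \<in> carr M \<and> b \<in> carr M \<and> y \<in>
        X}"
    and t: "t \<in> carr T"
  shows "f (tens M T x t) = 0"
proof -
  note S = bialgebra_algebra[OF M] bialgebra_coalgebra[OF T]
  note V = bialgebra_vect[OF M] bialgebra_vect[OF T] algebra_vect[OF A]
  interpret A: vector_space "scl A" using V(3) by (simp add: vect_def)
  note l = lin_mem[OF bimeasuring_lin[OF f]]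
  have mul0: "mul A 0 u = 0" "mul A u 0 = 0" if "u \<in> carr A" for u
    using lin_0[OF bilin_lin1[OF algebra_mul[OF A] that] V(3)] lin_0[OF bilin_lin2[OF algebra_mul[OF
        A] that] V(3)] .
  have 1: "f (tens M T (mul M a (d y)) s) = 0" if a: "a \<in> carr M" and y: "y \<in> X" and s: "s \<in> carr T"
      for a y s
  proof -
    have "f (tens M T (mul M a (d y)) s) = sw T s (\<lambda>t1 t2. mul A (f (tens M T a t1)) (f (tens M T (d
        y) t2)))"
      by (rule bimeasuring_mul_left[OF M T A f a _ s]) (rule X[OF y])
    also have "\<dots> = sw T s (\<lambda>t1 t2. 0)"
      by (intro tsum_cong V mem_intros S s) (simp add: f0 y mul0 l a tens_in_tspace)
    finally show ?thesis by simp
  qed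
  have 2: "f (tens M T (mul M (mul M a (d y)) b) t) = 0" if a: "a \<in> carr M" "b \<in> carr M" and y: "y \<in>
      X" for a b y
  proof -
    have "f (tens M T (mul M (mul M a (d y)) b) t)
       = sw T t (\<lambda>t1 t2. mul A (f (tens M T (mul M a (d y)) t1)) (f (tens M T b t2)))"
      by (rule bimeasuring_mul_left[OF M T A f _ a(2) t]) (intro algebra_mul_mem S X y a)
    also have "\<dots> = sw T t (\<lambda>t1 t2. 0)"
      by (intro tsum_cong V mem_intros S t) (simp add: 1 a y mul0 l tens_in_tspace)
    finally show ?thesis by simp
  qed
  have "f (tens M T x t) \<in> {0}"
  proof (rule lin_span_mem[OF V(1,3) _ _ _ _ x])
    show "lin M A (\<lambda>x. f (tens M T x t))" by (rule lin_comp[OF bimeasuring_lin[OF f]]) (intro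
        lin_intros t)
    show "{mul M (mul M a (d y)) b | a b y. a \<in> carr M \<and> b \<in> carr M \<and> y \<in> X} \<subseteq> carr M"
      using X by (auto intro!: algebra_mul_mem S)
    show "(\<lambda>x. f (tens M T x t)) ` {mul M (mul M a (d y)) b | a b y. a \<in> carr M \<and> b \<in> carr M \<and> y \<in>
        X} \<subseteq> {0}"
      using 2 by auto
  qed (rule A.subspace_single_0)
  then show ?thesis by simp
qed

text \<open>
  \<open>E\<close> and \<open>D\<close> are subbialgebras of countable dimension, \<open>E\<close> containing \<open>c\<close> and \<open>D\<close> containing the
  images of \<open>E\<close> under both maps, so that the argument with the biideal takes place in \<open>D\<close>.
\<close>

lemma universal_coalgebra_map_unique:
  fixes C :: "('k::field, 'v::ab_group_add, 'm) kbialg_scheme"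
  assumes U: "large_universe TYPE('k) TYPE('u::ab_group_add)" and T: "bialgebra T" and A: "algebra
      A"
    and un: "universal_among TYPE('u) False B T A \<theta>"
    and C: "bialgebra C" and al: "coalgebra_map C B \<alpha>" "coalgebra_map C B \<beta>"
    and eq: "\<And>c t. c \<in> carr C \<Longrightarrow> t \<in> carr T \<Longrightarrow> \<theta> (tens B T (\<alpha> c) t) = \<theta> (tens B T (\<beta> c) t)"
    and c: "c \<in> carr C"
  shows "\<alpha> c = \<beta> c"
proof -
  note B = universal_among_bialgebra[OF un] and th = universal_among_bimeasuring[OF un]
  note V = bialgebra_vect[OF C] bialgebra_vect[OF B]
  interpret VC: vector_space "scl C" using V(1) by (simp add: vect_def)
  interpret VB: vector_space "scl B" using V(2) by (simp add: vect_def)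
  obtain E where E: "countable_sub C E" "c \<in> E"
    using countable_sub_exists[OF C, of "{c}"] c by auto
  obtain G where G: "countable G" "E = VC.span G" and EC: "E \<subseteq> carr C" "bialgebra (C\<lparr>carr := E\<rparr>)"
    using E(1) unfolding countable_sub_def by blast
  have GC: "G \<subseteq> carr C" using VC.span_superset G(2) EC(1) by blast
  have "\<alpha> ` G \<union> \<beta> ` G \<subseteq> carr B"
    using GC lin_mem[OF coalgebra_map_lin[OF al(1)]] lin_mem[OF coalgebra_map_lin[OF al(2)]] by
        blast
  then obtain D where D: "countable_sub B D" "\<alpha> ` G \<union> \<beta> ` G \<subseteq> D"
    using countable_sub_exists[OF B, of "\<alpha> ` G \<union> \<beta> ` G"] G(1) by auto
  obtain G' where G': "countable G'" "D = VB.span G'" and DB: "D \<subseteq> carr B" "bialgebra (B\<lparr>carr :=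
      D\<rparr>)"
    using D(1) unfolding countable_sub_def by blast
  let ?E = "C\<lparr>carr := E\<rparr>" and ?D = "B\<lparr>carr := D\<rparr>"
  note CE = bialgebra_coalgebra[OF EC(2)]
  have sD: "VB.subspace D" using G'(2) VB.subspace_span by blast
  have restr: "coalgebra_map ?E ?D \<gamma>" if g: "coalgebra_map C B \<gamma>" and GD: "\<gamma> ` G \<subseteq> D" for \<gamma>
  proof (rule coalgebra_mapI[OF CE])
    note lg = coalgebra_map_lin[OF g]
    have "\<gamma> x \<in> D" if "x \<in> E" for x
      by (rule lin_span_mem[OF V lg GC sD GD]) (use that G(2) in blast)
    then show "lin ?E ?D \<gamma>" using lg EC(1) unfolding lin_def by (auto simp: subset_iff)
    fix x assume x: "x \<in> carr ?E"
    then have xC: "x \<in> carr C" using EC(1) by auto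
    show "counit ?D (\<gamma> x) = counit ?E x" using coalgebra_map_counit[OF g xC] by simp
    have "comul B (\<gamma> x) = sw C x (\<lambda>a b. tens B B (\<gamma> a) (\<gamma> b))"
      by (rule coalgebra_map_comul[OF bialgebra_coalgebra[OF C] g xC])
    also have "\<dots> = tsum ?E ?E (comul C x) (\<lambda>a b. tens B B (\<gamma> a) (\<gamma> b))"
      using comul_mem[OF CE x]
      by (intro tsum_update[where X="tspace B B", OF V(1) bialgebra_vect[OF EC(2)] EC(1)
          vect_tspace, symmetric] bilinI lin_intros lg lin_mem[OF lg]) auto
    finally show "comul ?D (\<gamma> x) = sw ?E x (\<lambda>a b. tens ?D ?D (\<gamma> a) (\<gamma> b))" by simp
  qed
  let ?J = "module.span (scl ?D) {mul ?D (mul ?D a (\<alpha> x - \<beta> x)) b | a b x. a \<in> carr ?D \<and> b \<in> carr ?D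
      \<and> x \<in> carr ?E}"
  have al': "coalgebra_map ?E ?D \<alpha>" "coalgebra_map ?E ?D \<beta>" using restr al D(2) by auto
  have J: "biideal ?D ?J"
    by (rule biideal_of_coalgebra_maps[OF DB(2) CE al'])
  have bm: "bimeasuring ?D T A \<theta>" by (rule bimeasuring_sub[OF B DB(2,1) T A th])
  have XD: "\<alpha> x - \<beta> x \<in> carr ?D" if "x \<in> carr ?E" for x
    by (rule vect_diff[OF bialgebra_vect[OF DB(2)] lin_mem[OF coalgebra_map_lin[OF al'(1)] that]
        lin_mem[OF coalgebra_map_lin[OF al'(2)] that]])
  have X0: "\<theta> (tens ?D T (\<alpha> x - \<beta> x) t) = 0" if x: "x \<in> carr ?E" and t: "t \<in> carr T" for x t
  proof -
    have xC: "x \<in> carr C" using x EC(1) by auto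
    have "\<theta> (tens B T (\<alpha> x - \<beta> x) t) = \<theta> (tens B T (\<alpha> x) t) - \<theta> (tens B T (\<beta> x) t)"
      by (rule lin_minus[OF lin_comp[OF bimeasuring_lin[OF th] lin_tens1[OF lin_id t]] V(2)
          lin_mem[OF coalgebra_map_lin[OF al(1)] xC] lin_mem[OF coalgebra_map_lin[OF al(2)] xC]])
    then show ?thesis by (simp add: eq[OF xC t])
  qed
  have J0: "\<theta> (tens ?D T x t) = 0" if "x \<in> ?J" "t \<in> carr T" for x t
    by (rule bimeasuring_vanishes[OF DB(2) T A bm XD X0 that])
  have GD: "carr ?D = module.span (scl ?D) G'" using G'(2) by simp
  obtain h where h: "bialgebra_map ?D B h" "\<forall>n\<in>carr ?D. \<forall>t\<in>carr T. \<theta> (tens B T (h n) t) = \<theta> (tens ?D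
      T n t)"
    "\<forall>x\<in>?J. h x = 0"
    using universal_small_exists[OF U T A un DB(2) _ G'(1) GD J bm J0] by blast
  have hid: "h x = x" if "x \<in> carr ?D" for x
    by (rule universal_unique[OF U T A un DB(2) _ h(1) bialgebra_map_incl[OF DB(2,1)] _ that]) (use
        h(2) in auto)
  have u: "unit B \<in> D" using algebra_unit[OF bialgebra_algebra[OF DB(2)]] by simp
  have cE: "c \<in> carr ?E" using E(2) by simp
  note dD = XD[OF cE]
  have "\<alpha> c - \<beta> c = mul ?D (mul ?D (unit ?D) (\<alpha> c - \<beta> c)) (unit ?D)"
    by (simp only: algebra_unit_left[OF bialgebra_algebra[OF DB(2)] dD] algebra_unit_right[OF
        bialgebra_algebra[OF DB(2)] dD])
  moreover have "\<dots> \<in> ?J"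
  proof -
    interpret VD: vector_space "scl ?D" using bialgebra_vect[OF DB(2)] by (simp add: vect_def)
    have "unit ?D \<in> carr ?D" using u by simp
    then show ?thesis
      by - (rule VD.span_base, rule CollectI, rule exI[of _ "unit ?D"], rule exI[of _ "unit ?D"],
        rule exI[of _ c], intro conjI refl cE)
  qed
  ultimately have "\<alpha> c - \<beta> c \<in> ?J" by simp
  then have "h (\<alpha> c - \<beta> c) = 0" using h(3) by blast
  then show ?thesis using hid[OF dD] by simp
qed


section \<open>Restriction and cocommutative parts\<close>

lemma universal_restrict:
  fixes N :: "('k::field, 'v::ab_group_add, 'm) kbialg_scheme"
  assumes U: "large_universe TYPE('k) TYPE('u::ab_group_add)" and T: "bialgebra T" "bialgebra T'"
      and A: "algebra A"
    and un: "universal_among TYPE('u) False B T' A \<theta>"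
    and N: "bialgebra N" and f: "bimeasuring N T A f" and q: "bialgebra_map T' T q"
  obtains h where "bialgebra_map N B h"
    "\<forall>n\<in>carr N. \<forall>t\<in>carr T'. \<theta> (tens B T' (h n) t) = f (tens N T n (q t))"
proof -
  obtain g where g: "bimeasuring N T' A g" "\<forall>m\<in>carr N. \<forall>t\<in>carr T'. g (tens N T' m t) = f (tens N T m
      (q t))"
    by (rule bimeasuring_comp[OF N N T A f bialgebra_map_id[OF N] q])
  obtain h where h: "bialgebra_map N B h" "\<forall>n\<in>carr N. \<forall>t\<in>carr T'. \<theta> (tens B T' (h n) t) = g (tens N
      T' n t)"
    using universal_exists[OF U T(2) A un N _ g(1)] by auto
  show thesis by (rule that[OF h(1)]) (simp add: h(2) g(2))
qed

text \<open>
  The bimeasuring represented by \<open>h\<close> is also represented by a map \<open>k\<close> into the cocommutative part.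
  By uniqueness in \<open>B\<close> the two maps are equal.
\<close>

lemma maps_into_cocomm_part:
  fixes N :: "('k::field, 'v::ab_group_add, 'm) kbialg_scheme" and B :: "('k, 'b::ab_group_add)
      kbialg"
  assumes U: "large_universe TYPE('k) TYPE('u::ab_group_add)" and T: "bialgebra T" and A: "algebra
      A"
    and un: "universal_among TYPE('u) False B T A \<theta>"
    and part: "cocomm_universal_part TYPE('u) B T A \<theta> D"
    and N: "bialgebra N" "cocommutative N" and h: "bialgebra_map N B h"
  shows "h ` carr N \<subseteq> D"
proof -
  have DB: "D \<subseteq> carr B" and unD: "universal_among TYPE('u) True (B\<lparr>carr := D\<rparr>) T A \<theta>"
    using part universal_amongI(2) unfolding cocomm_universal_part_def by blast+
  note B = universal_among_bialgebra[OF un] and th = universal_among_bimeasuring[OF un]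
  obtain f where f: "bimeasuring N T A f" "\<forall>n\<in>carr N. \<forall>t\<in>carr T. f (tens N T n t) = \<theta> (tens B T (h
      n) t)"
    by (rule bimeasuring_comp[OF B N(1) T T A th h bialgebra_map_id[OF T]])
  obtain k where k: "bialgebra_map N (B\<lparr>carr := D\<rparr>) k"
    "\<forall>n\<in>carr N. \<forall>t\<in>carr T. \<theta> (tens (B\<lparr>carr := D\<rparr>) T (k n) t) = f (tens N T n t)"
    using universal_exists[OF U T A unD N f(1)] by auto
  have kB: "bialgebra_map N B k" by (rule bialgebra_map_codom(1)[OF N(1) k(1) DB])
  have "h n = k n" if "n \<in> carr N" for n
    by (rule universal_unique[OF U T A un N(1) _ h kB _ that]) (use k(2) f(2) in auto)
  then show ?thesis using bialgebra_map_mem[OF k(1)] by auto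
qed

lemma cocomm_universal_partD:
  assumes "cocomm_universal_part u B T A \<theta> D"
  shows "D \<subseteq> carr B" and "bialgebra (B\<lparr>carr := D\<rparr>)" and "cocommutative (B\<lparr>carr := D\<rparr>)"
  using assms unfolding cocomm_universal_part_def universal_cocomm_bimeasuring_def by simp_all


section \<open>The bialgebra of a tensor product\<close>

theorem mainTheorem3:
  fixes T :: "('k::field, 't::ab_group_add) kbialg"
    and S :: "('k, 's::ab_group_add) kbialg"
    and A :: "('k, 'a::ab_group_add) kalg"
    and BT :: "('k, 'b::ab_group_add) kbialg" and \<theta>T :: "('k, 'b, 't) tensor \<Rightarrow> 'a"
    and BS :: "('k, 'c::ab_group_add) kbialg" and \<theta>S :: "('k, 'c, 's) tensor \<Rightarrow> 'a"
    and BTS :: "('k, 'd::ab_group_add) kbialg"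
    and \<theta>TS :: "('k, 'd, ('k, 't, 's) tensor) tensor \<Rightarrow> 'a"
    and \<psi> :: "('k, ('k, 'b, 'c) tensor, ('k, 't, 's) tensor) tensor \<Rightarrow> 'a"
    and DT :: "'b set" and DS :: "'c set" and DTS :: "'d set"
  assumes "large_universe TYPE('k) TYPE('u::ab_group_add)"
    and "bialgebra T" and "bialgebra S" and "comm_algebra A"
    and "universal_bimeasuring TYPE('u) BT T A \<theta>T"
    and "universal_bimeasuring TYPE('u) BS S A \<theta>S"
    and "universal_bimeasuring TYPE('u) BTS (tensor_bialg T S) A \<theta>TS"
    and "cocomm_universal_part TYPE('u) BT T A \<theta>T DT"
    and "cocomm_universal_part TYPE('u) BS S A \<theta>S DS"
    and "cocomm_universal_part TYPE('u) BTS (tensor_bialg T S) A \<theta>TS DTS"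
    and "lin (tspace (tspace BT BS) (tspace T S)) A \<psi>"
    and "\<forall>f\<in>carr BT. \<forall>g\<in>carr BS. \<forall>t\<in>carr T. \<forall>s\<in>carr S.
           \<psi> (tens (tspace BT BS) (tspace T S) (tens BT BS f g) (tens T S t s))
           = mul A (\<theta>T (tens BT T f t)) (\<theta>S (tens BS S g s))"
  shows "bimeasuring (tensor_bialg BT BS) (tensor_bialg T S) A \<psi> \<and>
    (\<exists>\<alpha>. coalgebra_map (tensor_bialg BT BS) BTS \<alpha> \<and>
         factors_through (tensor_bialg BT BS) BTS (tensor_bialg T S) \<theta>TS \<psi> \<alpha> \<and>
         (\<forall>\<alpha>'. coalgebra_map (tensor_bialg BT BS) BTS \<alpha>' \<and>
               factors_through (tensor_bialg BT BS) BTS (tensor_bialg T S) \<theta>TS \<psi> \<alpha>' \<longrightarrow>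
               (\<forall>x\<in>carr (tensor_bialg BT BS). \<alpha>' x = \<alpha> x)) \<and>
         inj_on \<alpha> (carr (tensor_bialg BT BS)) \<and>
         bialgebra_iso (tensor_bialg (BT\<lparr>carr := DT\<rparr>) (BS\<lparr>carr := DS\<rparr>)) (BTS\<lparr>carr := DTS\<rparr>) \<alpha>)"
proof -
  note U = assms(1) and T = assms(2) and S = assms(3) and A = assms(4) and psi = assms(11)
  note al = comm_algebra_algebra[OF A]
  note unT = universal_amongI(1)[OF assms(5)] and unS = universal_amongI(1)[OF assms(6)]
    and unTS = universal_amongI(1)[OF assms(7)]
  note BT = universal_among_bialgebra[OF unT] and BS = universal_among_bialgebra[OF unS]
    and BTS = universal_among_bialgebra[OF unTS]
  note bT = universal_among_bimeasuring[OF unT] and bS = universal_among_bimeasuring[OF unS]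
    and bTS = universal_among_bimeasuring[OF unTS]
  let ?TS = "tensor_bialg T S" and ?N = "tensor_bialg BT BS"
  let ?W = "tspace BT BS" and ?W' = "tspace T S"
  note TS = bialgebra_tensor[OF T S] and N = bialgebra_tensor[OF BT BS]
  note V = bialgebra_vect[OF T] bialgebra_vect[OF S] bialgebra_vect[OF BT] bialgebra_vect[OF BS]
    bialgebra_vect[OF BTS] algebra_vect[OF al] vect_tspace vect_tensor_bialg[of BT BS]
        vect_tensor_bialg[of T S]
  note psi_eq = assms(12)[rule_format]
  have bpsi: "bimeasuring ?N ?TS A \<psi>"
    by (rule bimeasuring_tensor[OF BT BS T S A bT bS psi psi_eq])
  obtain \<alpha> where alm: "bialgebra_map ?N BTS \<alpha>"
    and al_eq: "\<forall>n\<in>carr ?N. \<forall>t\<in>carr ?TS. \<theta>TS (tens BTS ?TS (\<alpha> n) t) = \<psi> (tens ?N ?TS n t)"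
    using universal_exists[OF U TS al unTS N _ bpsi] by auto
  note fac_iff = factors_through_iff[OF V(8,9,6) bimeasuring_lin[OF bpsi] _ bimeasuring_lin[OF bTS]]
  have fac: "factors_through ?N BTS ?TS \<theta>TS \<psi> \<alpha>"
    using fac_iff[OF bialgebra_map_lin[OF alm]] al_eq by simp
  have unique: "\<forall>x\<in>carr ?N. \<alpha>' x = \<alpha> x"
    if "coalgebra_map ?N BTS \<alpha>'" "factors_through ?N BTS ?TS \<theta>TS \<psi> \<alpha>'" for \<alpha>'
  proof
    fix x assume x: "x \<in> carr ?N"
    have "\<forall>n\<in>carr ?N. \<forall>t\<in>carr ?TS. \<psi> (tens ?N ?TS n t) = \<theta>TS (tens BTS ?TS (\<alpha>' n) t)"
      using fac_iff[OF coalgebra_map_lin[OF that(1)]] that(2) by simp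
    then show "\<alpha>' x = \<alpha> x"
      by (intro universal_coalgebra_map_unique[OF U TS al unTS N that(1)
          bialgebra_map_coalgebra_map[OF alm] _ x])
        (use al_eq in simp)
  qed
  \<comment> \<open>Restriction along \<open>t \<mapsto> t \<otimes> 1\<close> and \<open>s \<mapsto> 1 \<otimes> s\<close>; composed with \<open>\<alpha>\<close> it will be \<open>id \<otimes> \<epsilon>\<close> and \<open>\<epsilon> \<otimes>
      id\<close>.\<close>
  obtain p where p: "bialgebra_map BTS BT p"
    "\<forall>n\<in>carr BTS. \<forall>t\<in>carr T. \<theta>T (tens BT T (p n) t) = \<theta>TS (tens BTS ?TS n (tens T S t (unit S)))"
    by (rule universal_restrict[OF U TS T al unT BTS bTS bialgebra_map_incl1[OF T S]])
  obtain q where q: "bialgebra_map BTS BS q"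
    "\<forall>n\<in>carr BTS. \<forall>s\<in>carr S. \<theta>S (tens BS S (q n) s) = \<theta>TS (tens BTS ?TS n (tens T S (unit T) s))"
    by (rule universal_restrict[OF U TS S al unS BTS bTS bialgebra_map_incl2[OF T S]])
  define p1 where "p1 x = tsum BT BS x (\<lambda>b c. scl BT (counit BS c) b)" for x
  have p1: "bialgebra_map ?N BT p1"
    unfolding p1_def by (rule bialgebra_map_proj1[OF BT BS])
  have p1t: "p1 (tens BT BS b c) = scl BT (counit BS c) b" if "b \<in> carr BT" "c \<in> carr BS" for b c
    unfolding p1_def
    by (intro tsum_tens[where X=BT] lin_intros V bilinI mem_intros bialgebra_coalgebra[OF BS] that)
  obtain q1 where q1: "bialgebra_map ?N BS q1"
    and q1t: "\<And>b c. b \<in> carr BT \<Longrightarrow> c \<in> carr BS \<Longrightarrow> q1 (tens BT BS b c) = scl BS (counit BT b) c"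
    by (rule bialgebra_map_proj2[OF BT BS]) blast
  note un_mem = algebra_unit[OF bialgebra_algebra[OF T]] algebra_unit[OF bialgebra_algebra[OF S]]
  note mT = lin_mem[OF bimeasuring_lin[OF bT]] lin_mem[OF bimeasuring_lin[OF bS]]
  have al_pure: "\<theta>TS (tens BTS ?TS (\<alpha> (tens BT BS b c)) (tens T S t s)) = mul A (\<theta>T (tens BT T b t))
      (\<theta>S (tens BS S c s))"
    and al_mem: "\<alpha> (tens BT BS b c) \<in> carr BTS"
    if "b \<in> carr BT" "c \<in> carr BS" "t \<in> carr T" "s \<in> carr S" for b c t s
    using al_eq that psi_eq bialgebra_map_mem[OF alm] by (simp_all add: tensor_bialg_simps
        tens_in_tspace)
  have pal: "p (\<alpha> x) = p1 x" if x: "x \<in> carr ?N" for x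
  proof (rule universal_unique_tensor[OF U T al unT BT BS bialgebra_map_comp[OF N V(5,3) alm p(1)]
      p1 _ x])
    fix b c t assume h: "b \<in> carr BT" "c \<in> carr BS" "t \<in> carr T"
    have "\<theta>T (tens BT T (p1 (tens BT BS b c)) t) = scl A (counit BS c) (\<theta>T (tens BT T b t))"
      unfolding p1t[OF h(1,2)]
      by (rule lin_scl[OF lin_comp[OF bimeasuring_lin[OF bT] lin_tens1[OF lin_id h(3)]] h(1)])
    then show "\<theta>T (tens BT T (p (\<alpha> (tens BT BS b c))) t) = \<theta>T (tens BT T (p1 (tens BT BS b c)) t)"
      using h p(2) un_mem by (simp add: al_pure al_mem bimeasuring_unit_right[OF bS] scl_unit_mul[OF
          al] mT tens_in_tspace)
  qed
  have qal: "q (\<alpha> x) = q1 x" if x: "x \<in> carr ?N" for x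
  proof (rule universal_unique_tensor[OF U S al unS BT BS bialgebra_map_comp[OF N V(5,4) alm q(1)]
      q1 _ x])
    fix b c s assume h: "b \<in> carr BT" "c \<in> carr BS" "s \<in> carr S"
    have "\<theta>S (tens BS S (q1 (tens BT BS b c)) s) = scl A (counit BT b) (\<theta>S (tens BS S c s))"
      unfolding q1t[OF h(1,2)]
      by (rule lin_scl[OF lin_comp[OF bimeasuring_lin[OF bS] lin_tens1[OF lin_id h(3)]] h(2)])
    then show "\<theta>S (tens BS S (q (\<alpha> (tens BT BS b c))) s) = \<theta>S (tens BS S (q1 (tens BT BS b c)) s)"
      using h q(2) un_mem by (simp add: al_pure al_mem bimeasuring_unit_right[OF bT] scl_unit_mul[OF
          al] mT tens_in_tspace)
  qed
  define \<beta> where "\<beta> y = sw BTS y (\<lambda>u v. tens BT BS (p u) (q v))" for y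
  note lp = lin_comp[OF bialgebra_map_lin[OF p(1)]] lin_comp[OF bialgebra_map_lin[OF q(1)]]
    lin_mem[OF bialgebra_map_lin[OF p(1)]] lin_mem[OF bialgebra_map_lin[OF q(1)]]
  have bal: "\<beta> (\<alpha> x) = x" if x: "x \<in> carr ?N" for x
  proof -
    have x': "x \<in> carr ?W" using x by (simp add: tensor_bialg_simps)
    have "\<beta> (\<alpha> x) = sw ?N x (\<lambda>u v. tens BT BS (p (\<alpha> u)) (q (\<alpha> v)))"
      unfolding \<beta>_def
      by (rule tsum_coalgebra_map[where X="?W", OF bialgebra_coalgebra[OF N] V(5)
          bialgebra_map_coalgebra_map[OF alm] x V(7)])
        (intro bilinI lin_intros lp lin_id | assumption)+
    also have "\<dots> = sw ?N x (\<lambda>u v. tens BT BS (p1 u) (q1 v))"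
      by (intro tsum_cong V comul_mem bialgebra_coalgebra[OF N] x) (simp add: pal qal)
    also have "\<dots> = tsum ?W ?W (comul ?N x) (\<lambda>u v. tens BT BS (p1 u) (q1 v))"
      by (simp only: tsum_tensor_bialg)
    also have "\<dots> = x"
      by (rule tmap_projections_comul[OF BT BS x' bialgebra_map_lin[OF p1, unfolded
          tensor_bialg_simps] p1t
          bialgebra_map_lin[OF q1, unfolded tensor_bialg_simps] q1t])
    finally show ?thesis .
  qed
  have inj: "inj_on \<alpha> (carr ?N)" by (rule inj_on_inverseI[of _ \<beta>]) (rule bal)
  let ?DT = "BT\<lparr>carr := DT\<rparr>" and ?DS = "BS\<lparr>carr := DS\<rparr>" and ?D = "BTS\<lparr>carr := DTS\<rparr>"
  let ?P = "tensor_bialg ?DT ?DS"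
  note DT = cocomm_universal_partD[OF assms(8)] and DS = cocomm_universal_partD[OF assms(9)]
    and D = cocomm_universal_partD[OF assms(10)]
  note P = bialgebra_tensor[OF DT(2) DS(2)]
  have coP: "cocommutative ?P"
    by (rule cocommutative_tensor[OF bialgebra_coalgebra[OF DT(2)] DT(3) bialgebra_coalgebra[OF
        DS(2)] DS(3)])
  have PN: "bialgebra_map ?P ?N (\<lambda>x. x)"
    by (rule bialgebra_map_tensor_sub[OF BT DT(2,1) BS DS(2,1)])
  have alP: "bialgebra_map ?P BTS \<alpha>"
    by (rule bialgebra_map_comp[OF P V(8,5) PN alm])
  have alPD: "\<alpha> ` carr ?P \<subseteq> DTS"
    by (rule maps_into_cocomm_part[OF U TS al unTS assms(10) P coP alP])
  have map: "bialgebra_map ?P ?D \<alpha>"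
    by (rule bialgebra_map_codom(2)[OF P alP alPD])
  note VD = bialgebra_vect[OF D(2)] bialgebra_vect[OF DT(2)] bialgebra_vect[OF DS(2)]
  have pD: "bialgebra_map ?D BT p" "bialgebra_map ?D BS q"
    by (rule bialgebra_map_restrict[OF BTS D(2,1) V(3) p(1)], rule bialgebra_map_restrict[OF BTS
        D(2,1) V(4) q(1)])
  have pDT: "bialgebra_map ?D ?DT p"
    by (rule bialgebra_map_codom(2)[OF D(2) pD(1) maps_into_cocomm_part[OF U T al unT assms(8)
        D(2,3) pD(1)]])
  have qDS: "bialgebra_map ?D ?DS q"
    by (rule bialgebra_map_codom(2)[OF D(2) pD(2) maps_into_cocomm_part[OF U S al unS assms(9)
        D(2,3) pD(2)]])
  \<comment> \<open>\<open>\<gamma>\<close> is the left inverse \<open>\<beta>\<close> restricted to the cocommutative part, where \<open>\<Delta>\<close> is a bialgebra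
      map.\<close>
  define \<gamma> where "\<gamma> y = tmap ?D ?D ?DT ?DS p q (comul ?D y)" for y
  have gam: "bialgebra_map ?D ?P \<gamma>"
    unfolding \<gamma>_def
    by (rule bialgebra_map_comp[OF D(2) vect_tensor_bialg vect_tensor_bialg bialgebra_map_comul[OF
        D(2,3)]
      bialgebra_map_tmap[OF D(2) DT(2) D(2) DS(2) pDT qDS]])
  have gam_eq: "\<gamma> y = tsum ?D ?D (comul BTS y) (\<lambda>u v. tens BT BS (p u) (q v))" if "y \<in> carr ?D" for
      y
    using tmap_eq_tsum[OF VD(1,1) bialgebra_map_lin[OF pDT] bialgebra_map_lin[OF qDS]
        comul_mem[OF bialgebra_coalgebra[OF D(2)] that]]
    by (simp add: \<gamma>_def)
  have gamN: "bialgebra_map ?D ?N \<gamma>"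
    using bialgebra_map_comp[OF D(2) vect_tensor_bialg V(8) gam PN] .
  have bD: "bimeasuring ?D ?TS A \<theta>TS" by (rule bimeasuring_sub[OF BTS D(2,1) TS al bTS])
  note lpD = lin_comp[OF bialgebra_map_lin[OF pD(1)]] lin_comp[OF bialgebra_map_lin[OF pD(2)]]
    lin_mem[OF bialgebra_map_lin[OF pD(1)]] lin_mem[OF bialgebra_map_lin[OF pD(2)]]
  have DW: "carr ?D \<subseteq> carr BTS" using D(1) by simp
  have alg: "\<alpha> (\<gamma> y) = y" if y: "y \<in> carr ?D" for y
  proof (rule universal_unique[OF U TS al unTS D(2) _ bialgebra_map_comp[OF D(2) V(8,5) gamN alm]
        bialgebra_map_incl[OF D(2,1)] _ y])
    fix n z assume n: "n \<in> carr ?D" and z: "z \<in> carr ?TS"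
    have gn: "\<gamma> n \<in> carr ?W" using bialgebra_map_mem[OF gamN n] by (simp add: tensor_bialg_simps)
    have cn: "comul BTS n \<in> carr (tspace ?D ?D)"
      using comul_mem[OF bialgebra_coalgebra[OF D(2)] n] by simp
    have nB: "n \<in> carr BTS" using n DW by blast
    have "\<forall>z\<in>carr ?W'. \<psi> (tens ?W ?W' (\<gamma> n) z) = \<theta>TS (tens BTS ?W' n z)"
    proof (rule tens_ballI[where X=A])
      fix t s assume ts: "t \<in> carr T" "s \<in> carr S"
      let ?t = "tens T S t (unit S)" and ?s = "tens T S (unit T) s"
      have mem: "?t \<in> carr ?TS" "?s \<in> carr ?TS"
        using ts un_mem by (simp_all add: tensor_bialg_simps tens_in_tspace)
      have "\<psi> (tens ?W ?W' (\<gamma> n) (tens T S t s))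
         = tsum ?D ?D (comul BTS n) (\<lambda>u v. \<psi> (tens ?W ?W' (tens BT BS (p u) (q v)) (tens T S t s)))"
        unfolding gam_eq[OF n]
        by (rule tsum_lin[where X="?W" and Y=A and L="\<lambda>x. \<psi> (tens ?W ?W' x (tens T S t s))"])
          (intro VD V cn lin_comp[OF psi] lin_intros mem_intros ts lpD | assumption)+
      also have "\<dots> = tsum ?D ?D (comul BTS n) (\<lambda>u v. mul A (\<theta>TS (tens BTS ?TS u ?t)) (\<theta>TS (tens BTS
          ?TS v ?s)))"
      proof (rule tsum_cong[OF VD(1) cn])
        fix u v assume uv: "u \<in> carr ?D" "v \<in> carr ?D"
        then have "u \<in> carr BTS" "v \<in> carr BTS" using DW by blast+
        then show "\<psi> (tens ?W ?W' (tens BT BS (p u) (q v)) (tens T S t s))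
            = mul A (\<theta>TS (tens BTS ?TS u ?t)) (\<theta>TS (tens BTS ?TS v ?s))"
          using p(2) q(2) ts by (simp add: psi_eq lp)
      qed
      also have "\<dots> = \<theta>TS (tens BTS ?TS n (mul ?TS ?t ?s))"
        using bimeasuring_mul_right[OF D(2) TS al bD n mem] by simp
      also have "mul ?TS ?t ?s = tens T S t s"
        by (simp add: tensor_bialg_simps tmul_tens bialgebra_algebra T S ts un_mem algebra_unit_left
            algebra_unit_right)
      finally show "\<psi> (tens ?W ?W' (\<gamma> n) (tens T S t s)) = \<theta>TS (tens BTS ?W' n (tens T S t s))"
        by (simp only: tens_tensor_bialg)
    qed (intro lin_comp[OF psi] lin_comp[OF bimeasuring_lin[OF bTS, unfolded tensor_bialg_simps]]
        lin_intros gn nB)+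
    then show "\<theta>TS (tens BTS ?TS (\<alpha> (\<gamma> n)) z) = \<theta>TS (tens BTS ?TS n z)"
      using z gn al_eq by (simp add: tensor_bialg_simps)
  qed simp
  have "bij_betw \<alpha> (carr ?P) (carr ?D)"
    unfolding bij_betw_def
  proof
    have "carr ?P \<subseteq> carr ?N" using bialgebra_map_mem[OF PN] by blast
    then show "inj_on \<alpha> (carr ?P)" by (rule inj_on_subset[OF inj])
    have "y \<in> \<alpha> ` carr ?P" if "y \<in> carr ?D" for y
      using alg[OF that] bialgebra_map_mem[OF gam that] by (metis imageI)
    then show "\<alpha> ` carr ?P = carr ?D" using alPD by auto
  qed
  then have iso: "bialgebra_iso ?P ?D \<alpha>" unfolding bialgebra_iso_def using map by simp
  show ?thesis
    by (intro conjI exI[of _ \<alpha>] allI impI bpsi bialgebra_map_coalgebra_map[OF alm] fac inj iso)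
      (rule unique; (elim conjE, assumption))
qed

end
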